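(* Let $k$ be a constant and let $B_1,\dots,B_k$ be run-length compressed BWTs (or run-length compressed eBWTs) of strings (or sets of circular strings) over an alphabet of size $\sigma$. Let $R$ be the total number of runs in $B_1,\dots,B_k$, and let $L$ be the sum, over all boundaries between consecutive blocks in the combined eBWT, of the length of the longest common prefix of the contexts of the two characters adjacent to that boundary. Then the run-length compressed combined eBWT (the combined RLBWT) can be built in $\tilde{O}(L+\sigma+R)$ time and $O(R)$ space.
   Context: For a circular string, the context of a character is the (infinite, periodic) string read starting immediately after that character and wrapping around. The Burrows–Wheeler Transform (BWT) of a circular string (e.g. a string with a terminator \$ appended, viewed circularly) lists its characters in the lexicographic order of their contexts; the extended BWT (eBWT) of a multiset of circular strings lists all characters of all the strings in the lexicographic order of their contexts. An RLBWT is such a BWT or eBWT stored run-length compressed, i.e. as the sequence of its maximal runs of equal characters. The combined eBWT of $B_1,\dots,B_k$ is the eBWT of the multiset union of all the underlying circular strings; each of its characters comes from exactly one of the original $B_i$. A block is a maximal interval of consecutive positions of the combined eBWT whose characters all come from the same original $B_i$; a boundary is a pair of adjacent positions belonging to different blocks. The notation $\tilde{O}(\cdot)$ hides polylogarithmic factors (in the total length of the strings). *)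

theory Defs
  imports
    Complex_Main
    "HOL-Library.Extended_Real"
    "HOL-Library.Fun_Lexorder"
begin

section \<open>Circular strings and the extended Burrows--Wheeler transform\<close>

text \<open>
  A circular string is represented by any non-empty list that reads it off, and a multiset of
  circular strings by any list of such representatives (so multiplicities are kept). The BWT of
  a single circular string is the eBWT of the corresponding one-element list. Characters are
  the numbers below the alphabet size.
\<close>

type_synonym collection = "nat list list"

definition collection_over :: "nat \<Rightarrow> collection \<Rightarrow> bool" where
  "collection_over \<sigma> M \<longleftrightarrow> M \<noteq> [] \<and> (\<forall>S \<in> set M. S \<noteq> [] \<and> set S \<subseteq> {..<\<sigma>})"

definition total_length :: "collection \<Rightarrow> nat" where
  "total_length M = (\<Sum>S\<leftarrow>M. length S)"

text \<open>A character occurrence \<open>(q, p)\<close> is position \<open>p\<close> of the \<open>q\<close>-th string.\<close>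

definition occs :: "collection \<Rightarrow> (nat \<times> nat) set" where
  "occs M = {(q, p). q < length M \<and> p < length (M ! q)}"

definition char_at :: "collection \<Rightarrow> nat \<times> nat \<Rightarrow> nat" where
  "char_at M x = M ! fst x ! snd x"

definition ctx :: "collection \<Rightarrow> nat \<times> nat \<Rightarrow> nat \<Rightarrow> nat" where
  "ctx M x = (\<lambda>j. M ! fst x ! ((snd x + 1 + j) mod length (M ! fst x)))"

text \<open>
  \<open>xs\<close> lists every occurrence once, in lexicographic order of the contexts. The order among
  occurrences with equal contexts is left open. It does not affect the resulting transform:
  equal periodic contexts are preceded by equal characters.
\<close>

definition context_order :: "collection \<Rightarrow> (nat \<times> nat) list \<Rightarrow> bool" where
  "context_order M xs \<longleftrightarrow> distinct xs \<and> set xs = occs M \<and>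
     sorted_wrt (\<lambda>x y. \<not> less_fun (ctx M y) (ctx M x)) xs"

definition is_ebwt :: "collection \<Rightarrow> nat list \<Rightarrow> bool" where
  "is_ebwt M B \<longleftrightarrow> (\<exists>xs. context_order M xs \<and> B = map (char_at M) xs)"

function rle :: "'a list \<Rightarrow> ('a \<times> nat) list" where
  "rle [] = []"
| "rle (x # xs) = (x, Suc (length (takeWhile (\<lambda>y. y = x) xs))) # rle (dropWhile (\<lambda>y. y = x) xs)"
  by pat_completeness auto
termination
  by (relation "measure length") (auto simp: le_imp_less_Suc length_dropWhile_le)


section \<open>Blocks and boundaries of the combined transform\<close>

text \<open>
  The combined collection of \<open>Ms\<close> is \<open>concat Ms\<close>; its \<open>q\<close>-th string comes from the member of
  \<open>Ms\<close> with index \<open>source Ms q\<close>.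
\<close>

definition source :: "collection list \<Rightarrow> nat \<Rightarrow> nat" where
  "source Ms q = concat (map (\<lambda>i. replicate (length (Ms ! i)) i) [0..<length Ms]) ! q"

text \<open>\<open>is_block os a b\<close>: the positions \<open>a, ..., b - 1\<close> form a maximal constant interval of \<open>os\<close>.\<close>

definition is_block :: "nat list \<Rightarrow> nat \<Rightarrow> nat \<Rightarrow> bool" where
  "is_block os a b \<longleftrightarrow> a < b \<and> b \<le> length os \<and> (\<forall>j \<in> {a..<b}. os ! j = os ! a) \<and>
     (0 < a \<longrightarrow> os ! (a - 1) \<noteq> os ! a) \<and> (b < length os \<longrightarrow> os ! b \<noteq> os ! a)"

text \<open>The boundary between positions \<open>b - 1\<close> and \<open>b\<close> is represented by \<open>b\<close>.\<close>

definition boundaries :: "nat list \<Rightarrow> nat set" where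
  "boundaries os = {b. b < length os \<and> (\<exists>a. is_block os a b)}"

definition lcp :: "(nat \<Rightarrow> 'a) \<Rightarrow> (nat \<Rightarrow> 'a) \<Rightarrow> enat" where
  "lcp f g = (if f = g then \<infinity> else enat (LEAST j. f j \<noteq> g j))"

definition boundary_lcp_sum :: "collection list \<Rightarrow> (nat \<times> nat) list \<Rightarrow> enat" where
  "boundary_lcp_sum Ms xs =
     (\<Sum>b \<in> boundaries (map (source Ms \<circ> fst) xs).
        lcp (ctx (concat Ms) (xs ! (b - 1))) (ctx (concat Ms) (xs ! b)))"


section \<open>Word RAM\<close>

text \<open>
  A structured word RAM. A program has finitely many named registers, a random-access working
  memory with cells \<open>0, ..., m - 1\<close>, a random-access read-only input and an append-only output.
  All values, including all intermediate ones, have to be smaller than the word bound \<open>W\<close>.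
  Overflow or an address out of range makes the execution fail (get stuck). Every operator,
  memory access and command costs one time unit. Space is the number \<open>m\<close> of working memory
  cells that are made available; neither the input nor the output can be used as working
  memory, and they are not counted.
\<close>

type_synonym vname = string

datatype binop = Plus | Minus | Times | Div | Mod | Less | Equal

datatype exp = Const nat | Var vname | Mem exp | Inp exp | Bin binop exp exp

datatype com =
    Skip
  | Assign vname exp
  | Store exp exp
  | Output exp
  | Seq com com
  | If exp com com
  | While exp com

record ram_state =
  reg :: "vname \<Rightarrow> nat"
  mem :: "nat \<Rightarrow> nat"
  outp :: "nat list"

definition init_state :: ram_state where
  "init_state = \<lparr>reg = (\<lambda>_. 0), mem = (\<lambda>_. 0), outp = []\<rparr>"

text \<open>Subtraction is truncated, \<open>a div 0 = 0\<close> and \<open>a mod 0 = a\<close>.\<close>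

fun apply_op :: "binop \<Rightarrow> nat \<Rightarrow> nat \<Rightarrow> nat" where
  "apply_op Plus a b = a + b"
| "apply_op Minus a b = a - b"
| "apply_op Times a b = a * b"
| "apply_op Div a b = a div b"
| "apply_op Mod a b = a mod b"
| "apply_op Less a b = (if a < b then 1 else 0)"
| "apply_op Equal a b = (if a = b then 1 else 0)"

definition word :: "nat \<Rightarrow> nat \<Rightarrow> nat option" where
  "word W a = (if a < W then Some a else None)"

fun eval :: "nat \<Rightarrow> nat \<Rightarrow> nat list \<Rightarrow> ram_state \<Rightarrow> exp \<Rightarrow> nat option" where
  "eval W m inp s (Const n) = word W n"
| "eval W m inp s (Var x) = word W (reg s x)"
| "eval W m inp s (Mem e) = (case eval W m inp s e of
      Some a \<Rightarrow> if a < m then word W (mem s a) else None | None \<Rightarrow> None)"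
| "eval W m inp s (Inp e) = (case eval W m inp s e of
      Some a \<Rightarrow> if a < length inp then word W (inp ! a) else None | None \<Rightarrow> None)"
| "eval W m inp s (Bin f e1 e2) = (case (eval W m inp s e1, eval W m inp s e2) of
      (Some a, Some b) \<Rightarrow> word W (apply_op f a b) | _ \<Rightarrow> None)"

fun cost :: "exp \<Rightarrow> nat" where
  "cost (Const n) = 1"
| "cost (Var x) = 1"
| "cost (Mem e) = 1 + cost e"
| "cost (Inp e) = 1 + cost e"
| "cost (Bin f e1 e2) = 1 + cost e1 + cost e2"

text \<open>
  \<open>exec W m inp c s t s'\<close>: started in state \<open>s\<close>, the command \<open>c\<close> terminates without failure
  in state \<open>s'\<close> after \<open>t\<close> time units. The language is deterministic.
\<close>

inductive exec ::
  "nat \<Rightarrow> nat \<Rightarrow> nat list \<Rightarrow> com \<Rightarrow> ram_state \<Rightarrow> nat \<Rightarrow> ram_state \<Rightarrow> bool"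
  for W m :: nat and inp :: "nat list"
where
  Skip: "exec W m inp Skip s 1 s"
| Assign: "eval W m inp s e = Some a \<Longrightarrow>
    exec W m inp (Assign x e) s (1 + cost e) (s\<lparr>reg := (reg s)(x := a)\<rparr>)"
| Store: "eval W m inp s e1 = Some a \<Longrightarrow> a < m \<Longrightarrow> eval W m inp s e2 = Some b \<Longrightarrow>
    exec W m inp (Store e1 e2) s (1 + cost e1 + cost e2) (s\<lparr>mem := (mem s)(a := b)\<rparr>)"
| Output: "eval W m inp s e = Some a \<Longrightarrow>
    exec W m inp (Output e) s (1 + cost e) (s\<lparr>outp := outp s @ [a]\<rparr>)"
| Seq: "exec W m inp c1 s t1 s1 \<Longrightarrow> exec W m inp c2 s1 t2 s2 \<Longrightarrow>
    exec W m inp (Seq c1 c2) s (1 + t1 + t2) s2"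
| If_True: "eval W m inp s e = Some a \<Longrightarrow> a \<noteq> 0 \<Longrightarrow> exec W m inp c1 s t s' \<Longrightarrow>
    exec W m inp (If e c1 c2) s (1 + cost e + t) s'"
| If_False: "eval W m inp s e = Some 0 \<Longrightarrow> exec W m inp c2 s t s' \<Longrightarrow>
    exec W m inp (If e c1 c2) s (1 + cost e + t) s'"
| While_True: "eval W m inp s e = Some a \<Longrightarrow> a \<noteq> 0 \<Longrightarrow> exec W m inp c s t1 s1 \<Longrightarrow>
    exec W m inp (While e c) s1 t2 s2 \<Longrightarrow>
    exec W m inp (While e c) s (1 + cost e + t1 + t2) s2"
| While_False: "eval W m inp s e = Some 0 \<Longrightarrow> exec W m inp (While e c) s (1 + cost e) s"


section \<open>Input and output format\<close>

text \<open>
  Run-length compressed transforms are stored as sequences of (character, length) pairs. Each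
  input transform is preceded by its number of runs, the whole input by the alphabet size.
\<close>

definition encode_runs :: "(nat \<times> nat) list \<Rightarrow> nat list" where
  "encode_runs rs = concat (map (\<lambda>(a, l). [a, l]) rs)"

definition encode_input :: "nat \<Rightarrow> nat list list \<Rightarrow> nat list" where
  "encode_input \<sigma> Bs = \<sigma> # concat (map (\<lambda>B. length (rle B) # encode_runs (rle B)) Bs)"

definition total_runs :: "nat list list \<Rightarrow> nat" where
  "total_runs Bs = (\<Sum>B\<leftarrow>Bs. length (rle B))"

end

theory Submission
  imports Defs "HOL-Library.Multiset" "HOL-Library.Log_Nat"
begin

text \<open>
  Tag every character of the \<open>i\<close>-th input with \<open>i\<close>. The concatenation of the tagged transforms is
  then a transform of the tagged collection, so one table of its \<open>R\<close> runs, stably sorted by tagged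
  character, yields the inverse LF mapping of all inputs at once: the successive characters of any
  context cost one binary search each.

  The inputs are merged block by block. The smallest of the \<open>k\<close> current contexts is found by reading
  them in parallel and dropping those that exceed the minimum, until one is left. The end of its
  block is found by binary search, each probe being another such comparison. By monotonicity of
  longest common prefixes in a sorted sequence, a comparison reads no deeper than one more than the
  LCP at the end of the current or of the next block. Boundaries with LCP 0 number at most \<open>\<sigma>\<close>,
  all others are paid for by \<open>L\<close>. If \<open>L\<close> is infinite only termination matters; it is guaranteed by
  cutting comparisons off at depth \<open>N\<^sup>2\<close>, where periodic contexts that agree so far are equal.
\<close>

section \<open>Reasoning about word RAM programs\<close>

text \<open>The transforms are sorted within each input only, so their concatenation is in general
  no transform. Replacing a character \<open>c\<close> of input \<open>i\<close> by
  \<open>i * \<sigma> + c\<close> makes every context of an earlier input smaller than every context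
  of a later one; the concatenation is then sorted and can be inverted like a single transform, and
  reduction modulo \<open>\<sigma>\<close> gives back the contexts to be compared.

  A probe beyond the end of the current block is won by the first row of the next block. This is why
  the LCP at the end of the next block enters, and why each boundary is charged for at most two
  blocks.

  Contexts may coincide, also across inputs, and the given order resolves such ties arbitrarily. The
  computed order is therefore matched with it through contexts only; sources have to match only if
  \<open>L\<close> is finite, and then no tie crosses inputs.

  Every input has at least one run, so \<open>k \<le> R\<close>, and columns indexed by inputs fit
  into the same \<open>16 * R\<close> cells as those indexed by runs. Rows are never written one by
  one: each output step completes a run of an input or a block.\<close>

fun val :: "nat list \<Rightarrow> ram_state \<Rightarrow> exp \<Rightarrow> nat" where
  "val inp s (Const n) = n"
| "val inp s (Var x) = reg s x"
| "val inp s (Mem e) = mem s (val inp s e)"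
| "val inp s (Inp e) = inp ! val inp s e"
| "val inp s (Bin f e1 e2) = apply_op f (val inp s e1) (val inp s e2)"

text \<open>Splitting \<open>eval\<close> into a total value and a side condition keeps the
  arithmetic apart from the overflow and range checks.\<close>

fun safe :: "nat \<Rightarrow> nat \<Rightarrow> nat list \<Rightarrow> ram_state \<Rightarrow> exp \<Rightarrow> bool" where
  "safe W m inp s (Const n) \<longleftrightarrow> n < W"
| "safe W m inp s (Var x) \<longleftrightarrow> reg s x < W"
| "safe W m inp s (Mem e) \<longleftrightarrow> safe W m inp s e \<and> val inp s e < m \<and> mem s (val inp s e) < W"
| "safe W m inp s (Inp e) \<longleftrightarrow> safe W m inp s e \<and> val inp s e < length inp \<and> inp ! val inp s e < W"
| "safe W m inp s (Bin f e1 e2) \<longleftrightarrow> safe W m inp s e1 \<and> safe W m inp s e2 \<and>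
     apply_op f (val inp s e1) (val inp s e2) < W"

lemma eval_eq: "eval W m inp s e = (if safe W m inp s e then Some (val inp s e) else None)"
  by (induction e) (auto simp: word_def split: option.splits)

text \<open>Termination, absence of failure and running time in one predicate. The existential form
  suffices, since in the end only one execution has to be exhibited.\<close>

definition wp :: "nat \<Rightarrow> nat \<Rightarrow> nat list \<Rightarrow> com \<Rightarrow> ram_state \<Rightarrow> (nat \<Rightarrow> ram_state \<Rightarrow> bool) \<Rightarrow> bool" where
  "wp W m inp c s Q \<longleftrightarrow> (\<exists>t s'. exec W m inp c s t s' \<and> Q t s')"

lemma wp_mono: "wp W m inp c s Q \<Longrightarrow> (\<And>t s'. Q t s' \<Longrightarrow> Q' t s') \<Longrightarrow> wp W m inp c s Q'"
  unfolding wp_def by blast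

lemma wp_Skip [simp]: "wp W m inp Skip s Q \<longleftrightarrow> Q 1 s"
  using exec.Skip[of W m inp s] by (auto simp: wp_def elim: exec.cases)

lemma wp_Assign [simp]: "wp W m inp (Assign x e) s Q \<longleftrightarrow>
    safe W m inp s e \<and> Q (1 + cost e) (s\<lparr>reg := (reg s)(x := val inp s e)\<rparr>)"
  (is "?l \<longleftrightarrow> ?r")
proof
  show "?l \<Longrightarrow> ?r" by (auto simp: wp_def eval_eq elim!: exec.cases split: if_splits)
  show "?r \<Longrightarrow> ?l" unfolding wp_def using exec.Assign[of W m inp s e "val inp s e" x]
    by (auto simp: eval_eq)
qed

lemma wp_Store [simp]: "wp W m inp (Store e1 e2) s Q \<longleftrightarrow>
    safe W m inp s e1 \<and> safe W m inp s e2 \<and> val inp s e1 < m \<and>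
    Q (1 + cost e1 + cost e2) (s\<lparr>mem := (mem s)(val inp s e1 := val inp s e2)\<rparr>)"
  (is "?l \<longleftrightarrow> ?r")
proof
  show "?l \<Longrightarrow> ?r" by (auto simp: wp_def eval_eq elim!: exec.cases split: if_splits)
  show "?r \<Longrightarrow> ?l" unfolding wp_def
    using exec.Store[of W m inp s e1 "val inp s e1" e2 "val inp s e2"] by (auto simp: eval_eq)
qed

lemma wp_Output [simp]: "wp W m inp (Output e) s Q \<longleftrightarrow>
    safe W m inp s e \<and> Q (1 + cost e) (s\<lparr>outp := outp s @ [val inp s e]\<rparr>)"
  (is "?l \<longleftrightarrow> ?r")
proof
  show "?l \<Longrightarrow> ?r" by (auto simp: wp_def eval_eq elim!: exec.cases split: if_splits)
  show "?r \<Longrightarrow> ?l" unfolding wp_def using exec.Output[of W m inp s e "val inp s e"]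
    by (auto simp: eval_eq)
qed

lemma wp_Seq [simp]: "wp W m inp (Seq c1 c2) s Q \<longleftrightarrow>
    wp W m inp c1 s (\<lambda>t1 s1. wp W m inp c2 s1 (\<lambda>t2 s2. Q (1 + t1 + t2) s2))"
  (is "?l \<longleftrightarrow> ?r")
proof
  show "?l \<Longrightarrow> ?r" unfolding wp_def by (fastforce elim: exec.cases)
  show "?r \<Longrightarrow> ?l" unfolding wp_def by (blast intro: exec.Seq)
qed

lemma wp_If [simp]: "wp W m inp (If e c1 c2) s Q \<longleftrightarrow> safe W m inp s e \<and>
    (val inp s e \<noteq> 0 \<longrightarrow> wp W m inp c1 s (\<lambda>t s'. Q (1 + cost e + t) s')) \<and>
    (val inp s e = 0 \<longrightarrow> wp W m inp c2 s (\<lambda>t s'. Q (1 + cost e + t) s'))"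
  (is "?l \<longleftrightarrow> ?r")
proof
  assume ?l
  then obtain t s' where "exec W m inp (If e c1 c2) s t s'" "Q t s'" by (auto simp: wp_def)
  then show ?r by cases (auto simp: wp_def eval_eq split: if_splits)
next
  assume ?r
  then show ?l unfolding wp_def
    by (cases "val inp s e = 0") (force simp: eval_eq intro: exec.If_True exec.If_False)+
qed

text \<open>The potential \<open>\<Phi>\<close> pays for the time of the loop; since every iteration costs at least one
  unit, it also bounds the number of iterations.\<close>

lemma wp_While:
  assumes init: "I s"
    and safe: "\<And>s. I s \<Longrightarrow> safe W m inp s b"
    and step: "\<And>s. I s \<Longrightarrow> val inp s b \<noteq> 0 \<Longrightarrow>
      wp W m inp c s (\<lambda>t s'. I s' \<and> t + (1 + cost b) + \<Phi> s' \<le> \<Phi> s)"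
    and final: "\<And>t s'. I s' \<Longrightarrow> val inp s' b = 0 \<Longrightarrow> t + \<Phi> s' \<le> \<Phi> s + (1 + cost b) \<Longrightarrow> Q t s'"
  shows "wp W m inp (While b c) s Q"
proof -
  have "\<exists>t s'. exec W m inp (While b c) s t s' \<and> I s' \<and> val inp s' b = 0 \<and>
      t + \<Phi> s' \<le> \<Phi> s + (1 + cost b)" if "I s" for s
    using that
  proof (induction "\<Phi> s" arbitrary: s rule: less_induct)
    case less
    show ?case
    proof (cases "val inp s b = 0")
      case True
      then have "exec W m inp (While b c) s (1 + cost b) s"
        using safe[OF less.prems] by (intro exec.While_False) (simp add: eval_eq)
      then show ?thesis using less.prems True by fastforce
    next
      case False
      obtain t1 s1 where s1: "exec W m inp c s t1 s1" "I s1" "t1 + (1 + cost b) + \<Phi> s1 \<le> \<Phi> s"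
        using step[OF less.prems False] by (auto simp: wp_def)
      have lt: "\<Phi> s1 < \<Phi> s" using s1(3) by linarith
      obtain t2 s2 where s2: "exec W m inp (While b c) s1 t2 s2" "I s2" "val inp s2 b = 0"
          "t2 + \<Phi> s2 \<le> \<Phi> s1 + (1 + cost b)"
        using less.hyps[OF lt s1(2)] by blast
      have "exec W m inp (While b c) s (1 + cost b + t1 + t2) s2"
        using safe[OF less.prems] False s1(1) s2(1) by (intro exec.While_True) (auto simp: eval_eq)
      moreover have "(1 + cost b + t1 + t2) + \<Phi> s2 \<le> \<Phi> s + (1 + cost b)"
        using s1(3) s2(4) by linarith
      ultimately show ?thesis using s2 by blast
    qed
  qed
  then show ?thesis using init final unfolding wp_def by blast
qed

text \<open>
  The working memory is used as 16 interleaved arrays (columns): cell \<open>i\<close> of column \<open>j\<close> is cell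
  \<open>16 * i + j\<close> of the memory. Columns 0, 1 and 2 stay unused, since the simplifier would rewrite
  the sum. The others hold, indexed by the input (first group) or by the run (second group):
  3 the position reached by a comparison, 4 the character just read, 5 the first run not yet
  completely written, 12 the head, 13 the end, 14 whether the input is still a candidate;
  6 tagged character, 7 length, 8 start in the transform, 9 the sorting permutation,
  10 scratch space for sorting, 11 start in the sorted order.
\<close>

abbreviation "addr j e \<equiv> Bin Plus (Bin Times (Const 16) e) (Const j)"
abbreviation "ld j e \<equiv> Mem (addr j e)"
abbreviation "st j e v \<equiv> Store (addr j e) v"

definition col :: "ram_state \<Rightarrow> nat \<Rightarrow> nat \<Rightarrow> nat" where
  "col s j = (\<lambda>i. mem s (16 * i + j))"

text \<open>The variant of \<open>col\<close> for a bare memory function, so that rewriting can push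
  a column through nested memory updates.\<close>

definition colf :: "(nat \<Rightarrow> nat) \<Rightarrow> nat \<Rightarrow> nat \<Rightarrow> nat" where
  "colf f j = (\<lambda>i. f (16 * i + j))"

lemma mem_col [simp]: "mem s (16 * i + j) = col s j i"
  by (simp add: col_def)

lemma colf_mem [simp]: "colf (mem s) j = col s j"
  by (simp add: colf_def)

lemma col_update [simp]: "col (s\<lparr>reg := r\<rparr>) j = col s j" "col (s\<lparr>outp := out\<rparr>) j = col s j"
  "col (s\<lparr>mem := f\<rparr>) j = colf f j"
  by (simp_all add: col_def colf_def del: mem_col)

text \<open>Columns are residue classes modulo 16, so a store into one leaves the others
  alone.\<close>

lemma colf_upd [simp]:
  assumes "j < 16" "j' < 16"
  shows "colf (f(16 * i + j := v)) j' = (if j = j' then (colf f j)(i := v) else colf f j')"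
proof -
  have "(16 * i + j) mod 16 = j" "(16 * i + j) div 16 = i"
    "(16 * i' + j') mod 16 = j'" "(16 * i' + j') div 16 = i'" for i'
    using assms by simp_all
  then have "16 * i' + j' = 16 * i + j \<longleftrightarrow> i' = i \<and> j' = j" for i' by metis
  then show ?thesis by (auto simp: colf_def fun_eq_iff)
qed

fun asg :: "com \<Rightarrow> vname set" where
  "asg (Assign x e) = {x}"
| "asg (Seq c1 c2) = asg c1 \<union> asg c2"
| "asg (If e c1 c2) = asg c1 \<union> asg c2"
| "asg (While e c) = asg c"
| "asg _ = {}"

text \<open>A store whose address is not visibly of the form \<open>addr j e\<close> counts as
  touching everything; the condition \<open>stcols c \<subseteq> {..<16}\<close> then rejects
  it.\<close>

fun stcols :: "com \<Rightarrow> nat set" where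
  "stcols (Store (Bin Plus (Bin Times (Const n) e) (Const j)) v) = (if n = 16 then {j} else UNIV)"
| "stcols (Store e v) = UNIV"
| "stcols (Seq c1 c2) = stcols c1 \<union> stcols c2"
| "stcols (If e c1 c2) = stcols c1 \<union> stcols c2"
| "stcols (While e c) = stcols c"
| "stcols _ = {}"

fun noout :: "com \<Rightarrow> bool" where
  "noout (Output e) = False"
| "noout (Seq c1 c2) \<longleftrightarrow> noout c1 \<and> noout c2"
| "noout (If e c1 c2) \<longleftrightarrow> noout c1 \<and> noout c2"
| "noout (While e c) \<longleftrightarrow> noout c"
| "noout _ = True"

lemma exec_asg: "exec W m inp c s t s' \<Longrightarrow> x \<notin> asg c \<Longrightarrow> reg s' x = reg s x"
  by (induction rule: exec.induct) auto

lemma exec_noout: "exec W m inp c s t s' \<Longrightarrow> noout c \<Longrightarrow> outp s' = outp s"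
  by (induction rule: exec.induct) auto

lemma exec_stcols: "exec W m inp c s t s' \<Longrightarrow> stcols c \<subseteq> {..<16} \<Longrightarrow> j < 16 \<Longrightarrow> j \<notin> stcols c \<Longrightarrow>
  col s' j = col s j"
proof (induction rule: exec.induct)
  case (Store s e1 a e2 b)
  have *: "UNIV \<subseteq> {..<16::nat} \<longleftrightarrow> False" by (auto dest: subsetD[of _ _ 16])
  obtain e j' where e1: "e1 = addr j' e" and j': "j' < 16" "j \<noteq> j'"
    using Store.prems by (cases "Store e1 e2" rule: stcols.cases) (auto simp: * split: if_splits)
  have "a = 16 * val inp s e + j'" using Store.hyps(1) unfolding e1
    by (auto simp: eval_eq split: if_splits)
  then show ?case using j' Store.prems by simp
qed auto

lemma wp_frame: "wp W m inp c s Q \<Longrightarrow> stcols c \<subseteq> {..<16} \<Longrightarrow>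
  wp W m inp c s (\<lambda>t s'. Q t s' \<and> (\<forall>x. x \<notin> asg c \<longrightarrow> reg s' x = reg s x) \<and>
    (\<forall>j<16. j \<notin> stcols c \<longrightarrow> col s' j = col s j) \<and> (noout c \<longrightarrow> outp s' = outp s))"
  unfolding wp_def by (elim ex_forward conjE) (auto intro: exec_asg exec_noout exec_stcols)

text \<open>The rule for calling a verified subprogram: its specification is combined with what its
  syntax shows to be unchanged, so specifications need not list unaffected registers and
  columns.\<close>

lemma wp_call:
  assumes "wp W m inp c s Q" "stcols c \<subseteq> {..<16}"
    and "\<And>t s'. Q t s' \<Longrightarrow> (\<And>x. x \<notin> asg c \<Longrightarrow> reg s' x = reg s x) \<Longrightarrow>
      (\<And>j. j < 16 \<Longrightarrow> j \<notin> stcols c \<Longrightarrow> col s' j = col s j) \<Longrightarrow> (noout c \<Longrightarrow> outp s' = outp s) \<Longrightarrow>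
      Q' t s'"
  shows "wp W m inp c s Q'"
  using wp_frame[OF assms(1,2)] by (rule wp_mono) (blast intro: assms(3))

text \<open>Measures the progress of the binary searches: halving a distance removes one
  bit.\<close>

lemma floorlog_half: "0 < d \<Longrightarrow> d' \<le> d div 2 \<Longrightarrow> floorlog 2 d' + 1 \<le> floorlog 2 d"
  using floorlog_mono[of d' "d div 2" 2] compute_floorlog[of 2 d] by simp

section \<open>One step of the inverse LF mapping by binary search in the run table\<close>

notation Seq (infixr ";;" 60)

text \<open>The position is passed and returned in \<open>''y''\<close>. Column 11 is searched for
  the sorted run that contains it; inside a run the mapping is a shift, and \<open>Mod\<close>
  strips the tag from the character left in \<open>''c''\<close>.\<close>

definition fl_step :: com where
  "fl_step =
     Assign ''l'' (Const 0);; Assign ''h'' (Var ''R'');;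
     While (Bin Less (Const 1) (Bin Minus (Var ''h'') (Var ''l'')))
       (Assign ''u'' (Bin Div (Bin Plus (Var ''l'') (Var ''h'')) (Const 2));;
        If (Bin Less (Var ''y'') (ld 11 (Var ''u''))) (Assign ''h'' (Var ''u''))
          (Assign ''l'' (Var ''u'')));;
     Assign ''x'' (ld 9 (Var ''l''));;
     Assign ''c'' (Bin Mod (ld 6 (Var ''x'')) (Var ''S''));;
     Assign ''y'' (Bin Plus (ld 8 (Var ''x'')) (Bin Minus (Var ''y'') (ld 11 (Var ''l''))))"

lemma fl_step_frame [simp]: "asg fl_step = {''l'', ''h'', ''u'', ''x'', ''c'', ''y''}"
  "stcols fl_step = {}" "noout fl_step"
  by (auto simp: fl_step_def)

text \<open>The linear bound covers memory and input addresses, sums of positions and the radix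
  weight, which stays below \<open>2 * (k * \<sigma>)\<close>; the quadratic one covers the cutoff
  depth.\<close>

locale ram_bounds =
  fixes W k \<sigma> N R :: nat
  assumes k_le_R: "k \<le> R" and R_le_N: "R \<le> N" and k_pos: "1 \<le> k" and sigma_pos: "1 \<le> \<sigma>"
    and W_lin: "32 * N + 2 * (k * \<sigma>) + 100 < W" and W_sq: "N * N < W"

text \<open>\<open>K\<close>, \<open>Len\<close> and \<open>Lst\<close> are the tagged character,
  length and start of a run in input order; \<open>Prm\<close> sorts the runs by tagged character,
  and \<open>FS\<close> gives their starts in that order. \<open>J\<close> is the inverse LF
  mapping, a shift on each sorted run, and \<open>C\<close> the untagged transform.\<close>

locale fl_table = ram_bounds W k \<sigma> N R
  for W k \<sigma> N R :: nat +
  fixes inp :: "nat list" and C J K Len Lst Prm FS :: "nat \<Rightarrow> nat"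
  assumes K_less: "g < R \<Longrightarrow> K g < k * \<sigma>"
    and Prm_less: "g < R \<Longrightarrow> Prm g < R"
    and Len_pos: "g < R \<Longrightarrow> 0 < Len g"
    and Lst_le: "g < R \<Longrightarrow> Lst g + Len g \<le> N"
    and FS_0: "FS 0 = 0"
    and FS_Suc: "g < R \<Longrightarrow> FS (Suc g) = FS g + Len (Prm g)"
    and FS_R: "FS R = N"
    and J_eq: "g < R \<Longrightarrow> FS g \<le> y \<Longrightarrow> y < FS (Suc g) \<Longrightarrow> J y = Lst (Prm g) + (y - FS g)"
    and C_eq: "g < R \<Longrightarrow> Lst g \<le> y \<Longrightarrow> y < Lst g + Len g \<Longrightarrow> C y = K g mod \<sigma>"
begin

lemma sigma_le: "\<sigma> \<le> k * \<sigma>"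
  using k_pos by simp

abbreviation "WP \<equiv> wp W (16 * R) inp"

definition tab :: "ram_state \<Rightarrow> bool" where
  "tab s \<longleftrightarrow> reg s ''S'' = \<sigma> \<and> reg s ''R'' = R \<and> reg s ''N'' = N \<and> reg s ''D'' = N * N \<and>
     (\<forall>g<R. col s 6 g = K g \<and> col s 7 g = Len g \<and> col s 8 g = Lst g \<and> col s 9 g = Prm g \<and>
       col s 11 g = FS g)"

lemma FS_le: "g \<le> R \<Longrightarrow> FS g \<le> N"
proof (induction g rule: inc_induct)
  case base show ?case by (simp add: FS_R)
next
  case (step n) then show ?case using FS_Suc[of n] by simp
qed

lemma fl_step_correct:
  assumes tab: "tab s" and y: "reg s ''y'' = y" "y < N"
  shows "WP fl_step s (\<lambda>t s'. t \<le> 60 + 30 * floorlog 2 R \<and> reg s' ''c'' = C (J y) \<and> reg s' ''y'' = J y)"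
proof -
  let ?I = "\<lambda>s. tab s \<and> reg s ''y'' = y \<and> reg s ''l'' < reg s ''h'' \<and> reg s ''h'' \<le> R \<and>
    FS (reg s ''l'') \<le> y \<and> y < FS (reg s ''h'')"
  show ?thesis unfolding fl_step_def
    apply simp
    apply (intro conjI)
    subgoal using W_lin by simp
    subgoal using W_lin R_le_N tab by (simp add: tab_def)
    subgoal
      \<comment> \<open>Subtracting 1 makes the measure vanish as soon as a single candidate run is
        left.\<close>
      apply (rule wp_While[where I = ?I and \<Phi> = "\<lambda>s. 30 * floorlog 2 (reg s ''h'' - reg s ''l'' - 1)"])
      subgoal using tab y k_pos k_le_R by (simp add: tab_def FS_0 FS_R)
      subgoal using W_lin R_le_N by (auto simp: tab_def)
      subgoal premises prems for s
      proof -
        note I = prems(1) and gt = prems(2)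
        define l h where "l = reg s ''l''" and "h = reg s ''h''"
        define mid where "mid = (l + h) div 2"
        have lh: "l < mid" "mid < h" "l < h" using gt by (auto simp: l_def h_def mid_def split: if_splits)
        have 1: "floorlog 2 (mid - l - 1) + 1 \<le> floorlog 2 (h - l - 1)"
          "floorlog 2 (h - mid - 1) + 1 \<le> floorlog 2 (h - l - 1)"
          using lh by (intro floorlog_half; unfold mid_def; linarith)+
        show ?thesis using I lh 1 gt W_lin R_le_N FS_le[of mid] y
          apply (auto simp: l_def[symmetric] h_def[symmetric] mid_def[symmetric] tab_def)
          done
      qed
      subgoal premises prems for t s'
      proof -
        define l where "l = reg s' ''l''"
        have *: "tab s'" "reg s' ''y'' = y" "l < reg s' ''h''" "reg s' ''h'' \<le> R" "FS l \<le> y" "y < FS (reg s' ''h'')"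
          using prems(1) by (auto simp: l_def)
        have h: "reg s' ''h'' = Suc l" using prems(2) *(3) by (simp add: l_def split: if_splits)
        have tab': "tab s'" and lR: "l < R" and FS: "FS l \<le> y" "y < FS (Suc l)" and y': "reg s' ''y'' = y"
          using * h by auto
        have bds: "Prm l < R" "Lst (Prm l) + Len (Prm l) \<le> N" "K (Prm l) < k * \<sigma>" "FS (Suc l) = FS l + Len (Prm l)"
          using lR Prm_less Lst_le K_less FS_Suc by auto
        have J: "J y = Lst (Prm l) + (y - FS l)" using J_eq[OF lR FS] .
        have C: "C (J y) = K (Prm l) mod \<sigma>"
          using J bds FS by (intro C_eq) auto
        have "K (Prm l) mod \<sigma> < W" using sigma_pos sigma_le W_lin mod_less_divisor[of \<sigma> "K (Prm l)"] by linarith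
        moreover have "\<sigma> < W" using sigma_le W_lin by linarith
        moreover have "floorlog 2 (R - Suc 0) \<le> floorlog 2 R" by (simp add: floorlog_mono)
        moreover have "reg s ''R'' = R" using tab by (simp add: tab_def)
        ultimately show ?thesis using prems(3) tab' lR FS y' bds J C R_le_N W_lin y
          apply (auto simp: tab_def l_def[symmetric])
          done
      qed
      done
    done
qed

end

section \<open>Finding the smallest current context\<close>

text \<open>The loops over the inputs run downwards, so that the last candidate stored in \<open>w\<close> is the one
  with the smallest index. This fixes how ties are broken.\<close>

definition fm_init :: "nat \<Rightarrow> com" where
  "fm_init k =
     Assign ''w'' (Const 0);; Assign ''t'' (Const 0);; Assign ''i'' (Const k);;
     While (Bin Less (Const 0) (Var ''i''))
       (Assign ''i'' (Bin Minus (Var ''i'') (Const 1));;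
        st 3 (Var ''i'') (ld 12 (Var ''i''));;
        If (Bin Less (ld 12 (Var ''i'')) (ld 13 (Var ''i'')))
          (st 14 (Var ''i'') (Const 1);; Assign ''t'' (Bin Plus (Var ''t'') (Const 1));;
           Assign ''w'' (Var ''i''))
          (st 14 (Var ''i'') (Const 0)))"

text \<open>\<open>''n''\<close> starts as the alphabet size, above every character, and ends as the
  least character read in this round.\<close>

definition fm_read :: "nat \<Rightarrow> com" where
  "fm_read k =
     Assign ''n'' (Var ''S'');; Assign ''i'' (Const k);;
     While (Bin Less (Const 0) (Var ''i''))
       (Assign ''i'' (Bin Minus (Var ''i'') (Const 1));;
        If (ld 14 (Var ''i''))
          (Assign ''y'' (ld 3 (Var ''i''));; fl_step;;
           st 3 (Var ''i'') (Var ''y'');; st 4 (Var ''i'') (Var ''c'');;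
           If (Bin Less (Var ''c'') (Var ''n'')) (Assign ''n'' (Var ''c'')) Skip)
          Skip)"

definition fm_filter :: "nat \<Rightarrow> com" where
  "fm_filter k =
     Assign ''t'' (Const 0);; Assign ''i'' (Const k);;
     While (Bin Less (Const 0) (Var ''i''))
       (Assign ''i'' (Bin Minus (Var ''i'') (Const 1));;
        If (ld 14 (Var ''i''))
          (If (Bin Equal (ld 4 (Var ''i'')) (Var ''n''))
            (Assign ''t'' (Bin Plus (Var ''t'') (Const 1));; Assign ''w'' (Var ''i''))
            (st 14 (Var ''i'') (Const 0)))
          Skip)"

text \<open>\<open>Times\<close> acts as the conjunction of two tests: more than one candidate is
  left, and the depth is below the cutoff held in \<open>''D''\<close>.\<close>

definition findmin :: "nat \<Rightarrow> com" where
  "findmin k =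
     fm_init k;; Assign ''d'' (Const 0);;
     While (Bin Times (Bin Less (Const 1) (Var ''t'')) (Bin Less (Var ''d'') (Var ''D'')))
       (fm_read k;; fm_filter k;; Assign ''d'' (Bin Plus (Var ''d'') (Const 1)))"

lemma fm_frame [simp]:
  "asg (fm_init k) = {''w'', ''t'', ''i''}" "stcols (fm_init k) = {14, 3}" "noout (fm_init k)"
  "asg (fm_read k) = {''n'', ''i'', ''y'', ''c'', ''l'', ''h'', ''u'', ''x''}"
  "stcols (fm_read k) = {3, 4}" "noout (fm_read k)"
  "asg (fm_filter k) = {''w'', ''t'', ''i''}" "stcols (fm_filter k) = {14}" "noout (fm_filter k)"
  by (auto simp: fm_init_def fm_read_def fm_filter_def)

lemma findmin_frame [simp]:
  "asg (findmin k) = {''w'', ''t'', ''i'', ''d'', ''n'', ''y'', ''c'', ''l'', ''h'', ''u'', ''x''}"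
  "stcols (findmin k) = {14, 3, 4}" "noout (findmin k)"
  by (auto simp: findmin_def)

section \<open>Elimination of candidates and the cost of one comparison\<close>

locale merge_table = fl_table +
  fixes Q :: "nat \<Rightarrow> nat \<Rightarrow> nat" and en :: "nat \<Rightarrow> nat"
  assumes J_less: "y < N \<Longrightarrow> J y < N"
    and Q_0: "y < N \<Longrightarrow> Q y 0 = C (J y)"
    and Q_Suc: "y < N \<Longrightarrow> Q y (Suc j) = Q (J y) j"
    and Q_less: "y < N \<Longrightarrow> Q y j < \<sigma>"
    and Q_agree: "y < N \<Longrightarrow> y' < N \<Longrightarrow> (\<And>j. j < N * N \<Longrightarrow> Q y j = Q y' j) \<Longrightarrow> Q y = Q y'"
    and en_le: "i < k \<Longrightarrow> en i \<le> N"
begin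

text \<open>The inputs whose current context is least in its first \<open>d\<close> characters. Here
  \<open>p i\<close> is the head of input \<open>i\<close>, \<open>en i\<close> the end of its rows,
  and \<open>Q y\<close> the context of row \<open>y\<close>.\<close>

primrec act :: "(nat \<Rightarrow> nat) \<Rightarrow> nat \<Rightarrow> nat set" where
  "act p 0 = {i. i < k \<and> p i < en i}"
| "act p (Suc d) = {i \<in> act p d. \<forall>j \<in> act p d. Q (p i) d \<le> Q (p j) d}"

lemma act_sub: "act p d \<subseteq> {i. i < k \<and> p i < en i}"
  by (induction d) auto

lemma act_less: "i \<in> act p d \<Longrightarrow> i < k" and act_pos_less: "i \<in> act p d \<Longrightarrow> p i < N"
  using act_sub[of p d] en_le by force+

lemma finite_act [simp]: "finite (act p d)"
  by (rule finite_subset[OF act_sub]) simp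

definition flags :: "ram_state \<Rightarrow> nat set \<Rightarrow> bool" where
  "flags s A \<longleftrightarrow> (\<forall>i<k. col s 14 i = of_bool (i \<in> A))"

definition heads :: "ram_state \<Rightarrow> (nat \<Rightarrow> nat) \<Rightarrow> bool" where
  "heads s p \<longleftrightarrow> (\<forall>i<k. col s 12 i = p i \<and> col s 13 i = en i \<and> p i \<le> N)"

text \<open>State of a downward loop that has handled the inputs from \<open>i\<close> on. An index
  found later is smaller and overwrites \<open>w\<close>, hence the minimum.\<close>

definition tally :: "nat set \<Rightarrow> nat \<Rightarrow> nat \<Rightarrow> nat \<Rightarrow> bool" where
  "tally A i t w \<longleftrightarrow> t = card (A \<inter> {i..<k}) \<and> (A \<inter> {i..<k} \<noteq> {} \<longrightarrow> w = Min (A \<inter> {i..<k}))"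

lemma tally_k: "tally A k 0 w"
  by (simp add: tally_def)

lemma tally_step:
  assumes "0 < i" "i \<le> k" "tally A i t w"
  shows "i - 1 \<in> A \<Longrightarrow> tally A (i - 1) (Suc t) (i - 1)" and "i - 1 \<notin> A \<Longrightarrow> tally A (i - 1) t w"
proof -
  assume A: "i - 1 \<in> A"
  have *: "A \<inter> {i - 1..<k} = insert (i - 1) (A \<inter> {i..<k})" using assms(1,2) A by auto
  have "Min (insert (i - 1) (A \<inter> {i..<k})) = i - 1" by (rule Min_eqI) auto
  moreover have "i - 1 \<notin> A \<inter> {i..<k}" using assms(1) by auto
  ultimately show "tally A (i - 1) (Suc t) (i - 1)" using assms unfolding tally_def * by simp
next
  assume A: "i - 1 \<notin> A"
  then have "x = i - 1 \<Longrightarrow> x \<notin> A" for x by blast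
  then have *: "A \<inter> {i - 1..<k} = A \<inter> {i..<k}" using assms(1) by auto (metis Suc_leI Suc_pred le_neq_implies_less)
  then show "tally A (i - 1) t w" using assms(3) unfolding tally_def * by simp
qed

lemma tally_card: "tally A i t w \<Longrightarrow> t \<le> k"
  unfolding tally_def using card_mono[of "{i..<k}" "A \<inter> {i..<k}"] by auto

lemma fm_init_correct:
  assumes hd: "heads s p"
  shows "WP (fm_init k) s (\<lambda>t s'. t \<le> 60 + 80 * k \<and> flags s' (act p 0) \<and> (\<forall>i<k. col s' 3 i = p i) \<and>
    tally (act p 0) 0 (reg s' ''t'') (reg s' ''w''))"
proof -
  let ?I = "\<lambda>s. reg s ''i'' \<le> k \<and> reg s ''w'' \<le> k \<and> heads s p \<and>
    (\<forall>j. reg s ''i'' \<le> j \<and> j < k \<longrightarrow> col s 14 j = of_bool (j \<in> act p 0) \<and> col s 3 j = p j) \<and>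
    tally (act p 0) (reg s ''i'') (reg s ''t'') (reg s ''w'')"
  show ?thesis unfolding fm_init_def
    apply simp
    apply (intro conjI)
    subgoal using W_lin by simp
    subgoal using W_lin k_le_R R_le_N by simp
    subgoal
      apply (rule wp_While[where I = ?I and \<Phi> = "\<lambda>s. 80 * reg s ''i''"])
      subgoal using hd by (simp add: tally_k heads_def)
      subgoal using W_lin k_le_R R_le_N by auto
      subgoal premises prems for s
      proof -
        define i where "i = reg s ''i'' - 1"
        have i: "reg s ''i'' = Suc i" "i < k" using prems by (auto simp: i_def split: if_splits)
        have tl: "tally (act p 0) (Suc i) (reg s ''t'') (reg s ''w'')" using prems(1) i by simp
        have "tally (act p 0) i (Suc (reg s ''t'')) i" if "i \<in> act p 0"
          using tally_step(1)[OF _ _ tl] i that by simp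
        moreover have "tally (act p 0) i (reg s ''t'') (reg s ''w'')" if "i \<notin> act p 0"
          using tally_step(2)[OF _ _ tl] i that by simp
        moreover have "reg s ''t'' \<le> k" using tally_card[OF tl] .
        moreover have "p i \<le> N" "en i \<le> N" "col s 12 i = p i" "col s 13 i = en i"
          using prems(1) i en_le by (auto simp: heads_def)
        ultimately show ?thesis using prems(1) i W_lin k_le_R R_le_N
          by (auto simp: heads_def le_Suc_eq)
      qed
      subgoal premises prems for t s'
      proof -
        have "reg s' ''i'' = 0" using prems by (simp split: if_splits)
        then show ?thesis using prems by (auto simp: flags_def)
      qed
      done
    done
qed


lemma C_less: "y < N \<Longrightarrow> C (J y) < \<sigma>"
  using Q_0[of y] Q_less[of y 0] by simp

lemma fm_read_correct:
  assumes tab: "tab s" and fl: "flags s A" and A: "\<And>i. i \<in> A \<Longrightarrow> i < k \<and> z i < N \<and> col s 3 i = z i"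
  shows "WP (fm_read k) s (\<lambda>t s'. t \<le> 60 + (140 + 30 * floorlog 2 R) * k \<and>
    (\<forall>i\<in>A. col s' 3 i = J (z i) \<and> col s' 4 i = C (J (z i)) \<and> reg s' ''n'' \<le> C (J (z i))) \<and>
    (A \<noteq> {} \<longrightarrow> (\<exists>i\<in>A. reg s' ''n'' = C (J (z i)))))"
proof -
  \<comment> \<open>Characters are below \<open>\<sigma>\<close>, so \<open>''n''\<close> equals
    \<open>\<sigma>\<close> only as long as no candidate has been read; this distinguishes the
    initial value from a minimum.\<close>
  let ?I = "\<lambda>s. reg s ''i'' \<le> k \<and> reg s ''n'' \<le> \<sigma> \<and> tab s \<and> flags s A \<and>
    (\<forall>i\<in>A. if i < reg s ''i'' then col s 3 i = z i else
       col s 3 i = J (z i) \<and> col s 4 i = C (J (z i)) \<and> reg s ''n'' \<le> C (J (z i))) \<and>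
    (reg s ''n'' = \<sigma> \<longrightarrow> A \<inter> {reg s ''i''..<k} = {}) \<and>
    (reg s ''n'' \<noteq> \<sigma> \<longrightarrow> (\<exists>i\<in>A. reg s ''n'' = C (J (z i))))"
  have sW: "\<sigma> < W" using sigma_le W_lin by linarith
  show ?thesis unfolding fm_read_def
    apply simp
    apply (intro conjI)
    subgoal using sW tab by (simp add: tab_def)
    subgoal using W_lin k_le_R R_le_N by simp
    subgoal
      apply (rule wp_While[where I = ?I and \<Phi> = "\<lambda>s. (140 + 30 * floorlog 2 R) * reg s ''i''"])
      subgoal using tab fl A by (auto simp: tab_def flags_def)
      subgoal using W_lin k_le_R R_le_N by auto
      subgoal premises prems for s
      proof -
        define i where "i = reg s ''i'' - 1"
        have i: "reg s ''i'' = Suc i" "i < k" using prems by (auto simp: i_def split: if_splits)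
        have fl: "col s 14 i = of_bool (i \<in> A)" using prems(1) i by (simp add: flags_def)
        show ?thesis
        proof (cases "i \<in> A")
          case False
          then have "j \<in> A \<Longrightarrow> j < i \<longleftrightarrow> j < Suc i" for j by (cases "j = i") auto
          moreover have "A \<inter> {i..<k} = A \<inter> {Suc i..<k}" using False by (auto simp: Suc_le_eq le_less)
          ultimately show ?thesis using prems(1) i W_lin k_le_R R_le_N fl False
            by (auto simp: tab_def flags_def)
        next
          case True
          have zi: "z i < N" "col s 3 i = z i" using prems(1) A[OF True] i True by (auto split: if_splits)
          have J: "J (z i) < N" "C (J (z i)) < \<sigma>" using zi by (auto simp: J_less C_less)
          have tb: "tab s" using prems(1) by simp
          have Aeq: "A \<inter> {i..<k} = insert i (A \<inter> {Suc i..<k})" using True i by auto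
          have fl': "flags s A" and n: "reg s ''n'' \<le> \<sigma>" and n': "reg s ''n'' \<noteq> \<sigma> \<Longrightarrow> \<exists>i\<in>A. reg s ''n'' = C (J (z i))"
              "reg s ''n'' = \<sigma> \<Longrightarrow> A \<inter> {Suc i..<k} = {}"
            using prems(1) i by auto
          have lt: "j < i \<Longrightarrow> j \<in> A \<Longrightarrow> col s 3 j = z j" and ge: "j \<in> A \<Longrightarrow> i < j \<Longrightarrow>
              col s 3 j = J (z j) \<and> col s 4 j = C (J (z j)) \<and> reg s ''n'' \<le> C (J (z j))" for j
            using prems(1) i by (auto split: if_splits)
          have ub: "reg s ''n'' \<le> C (J (z j))" if "j \<in> A" "\<not> j < i" "j \<noteq> i" for j
            using ge[of j] that by auto
          have ub': "v \<le> C (J (z j))" if "v < reg s ''n''" "j \<in> A" "\<not> j < i" "j \<noteq> i" for v j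
            using ub[of j] that by simp
          show ?thesis using i W_lin k_le_R R_le_N fl True zi
            apply simp
            apply (rule wp_call[OF fl_step_correct[where y="z i"]])
            subgoal using tb by (simp add: tab_def)
            subgoal by simp
            subgoal by simp
            subgoal by simp
            subgoal premises q for t1 s1
            proof -
              have rs: "reg s1 ''i'' = i" "reg s1 ''n'' = reg s ''n''" "reg s1 ''S'' = reg s ''S''"
                "reg s1 ''R'' = reg s ''R''" "reg s1 ''N'' = reg s ''N''" "reg s1 ''D'' = reg s ''D''"
                using q(11) by simp_all
              have cs: "j < 16 \<Longrightarrow> col s1 j = col s j" for j using q(12) by simp
              show ?thesis using q(10) rs cs J fl' tb n W_lin k_le_R R_le_N i True sW
                apply (simp add: tab_def flags_def Aeq)
                apply (intro conjI impI ballI)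
                apply (use n' lt ge ub ub' in auto)
                done
            qed
            done
        qed
      qed
      subgoal premises prems for t s'
      proof -
        have "reg s' ''i'' = 0" using prems by (simp split: if_splits)
        moreover have "A \<inter> {0..<k} = A" using A by auto
        ultimately show ?thesis using prems by auto
      qed
      done
    done
qed

lemma fm_filter_correct:
  assumes fl: "flags s A" and A: "\<And>i. i \<in> A \<Longrightarrow> i < k \<and> col s 4 i < \<sigma>" and n: "reg s ''n'' \<le> \<sigma>"
    and w: "reg s ''w'' \<le> k"
  shows "WP (fm_filter k) s (\<lambda>t s'. t \<le> 60 + 80 * k \<and> flags s' {i\<in>A. col s 4 i = reg s ''n''} \<and>
    tally {i\<in>A. col s 4 i = reg s ''n''} 0 (reg s' ''t'') (reg s' ''w''))"
proof -
  define n where "n = reg s ''n''"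
  define ch where "ch = col s 4"
  define A' where "A' = {i\<in>A. ch i = n}"
  let ?I = "\<lambda>s. reg s ''i'' \<le> k \<and> reg s ''w'' \<le> k \<and> reg s ''n'' = n \<and> col s 4 = ch \<and>
    (\<forall>j<k. col s 14 j = of_bool (if j < reg s ''i'' then j \<in> A else j \<in> A')) \<and>
    tally A' (reg s ''i'') (reg s ''t'') (reg s ''w'')"
  have sW: "\<sigma> < W" "n < W" using sigma_le W_lin n unfolding n_def by linarith+
  show ?thesis unfolding fm_filter_def n_def[symmetric] ch_def[symmetric] A'_def[symmetric]
    apply simp
    apply (intro conjI)
    subgoal using W_lin by simp
    subgoal using W_lin k_le_R R_le_N by simp
    subgoal
      apply (rule wp_While[where I = ?I and \<Phi> = "\<lambda>s. 80 * reg s ''i''"])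
      subgoal using fl A w by (auto simp: flags_def ch_def n_def tally_k)
      subgoal using W_lin k_le_R R_le_N by auto
      subgoal premises prems for s
      proof -
        define i where "i = reg s ''i'' - 1"
        have i: "reg s ''i'' = Suc i" "i < k" using prems by (auto simp: i_def split: if_splits)
        have tl: "tally A' (Suc i) (reg s ''t'') (reg s ''w'')" using prems(1) i by simp
        have "tally A' i (Suc (reg s ''t'')) i" if "i \<in> A'"
          using tally_step(1)[OF _ _ tl] i that by simp
        moreover have "tally A' i (reg s ''t'') (reg s ''w'')" if "i \<notin> A'"
          using tally_step(2)[OF _ _ tl] i that by simp
        moreover have "reg s ''t'' \<le> k" using tally_card[OF tl] .
        moreover have "i \<in> A' \<longleftrightarrow> i \<in> A \<and> ch i = n" by (simp add: A'_def)
        moreover have "i \<in> A \<Longrightarrow> ch i < W" using A[of i] sW by (simp add: ch_def)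
        ultimately show ?thesis using prems(1) i W_lin k_le_R R_le_N sW
          by (auto simp: less_Suc_eq)
      qed
      subgoal premises prems for t s'
      proof -
        have "reg s' ''i'' = 0" using prems by (simp split: if_splits)
        then show ?thesis using prems by (auto simp: flags_def)
      qed
      done
    done
qed


text \<open>Each round keeps only the candidates with the least next character, so the survivors
  share it.\<close>

lemma act_agree: "i \<in> act p d \<Longrightarrow> j \<in> act p d \<Longrightarrow> l < d \<Longrightarrow> Q (p i) l = Q (p j) l"
proof (induction d)
  case (Suc d)
  show ?case
  proof (cases "l = d")
    case True
    then show ?thesis using Suc.prems by (auto intro: order_antisym)
  next
    case False
    then show ?thesis using Suc by auto
  qed
qed simp

text \<open>In the round that drops \<open>j\<close>, some candidate shows a smaller character while
  all candidates agree before it, and the survivor \<open>i\<close> shows a character at most as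
  large as that one.\<close>

lemma act_eliminated:
  "i \<in> act p d \<Longrightarrow> j \<in> act p 0 \<Longrightarrow> j \<notin> act p d \<Longrightarrow> less_fun (Q (p i)) (Q (p j))"
proof (induction d)
  case (Suc d)
  show ?case
  proof (cases "j \<in> act p d")
    case False
    then show ?thesis using Suc by auto
  next
    case True
    then obtain j' where j': "j' \<in> act p d" "Q (p j') d < Q (p j) d"
      using Suc.prems by (auto simp: not_le)
    have "Q (p i) d \<le> Q (p j') d" using Suc.prems(1) j' by auto
    then have "Q (p i) d < Q (p j) d" using j'(2) by simp
    moreover have "Q (p i) l = Q (p j) l" if "l < d" for l
      using act_agree[OF _ True that] Suc.prems(1) by simp
    ultimately show ?thesis by (intro less_funI exI[of _ d]) simp
  qed
qed simp

lemma act_nonempty: "act p 0 \<noteq> {} \<Longrightarrow> act p d \<noteq> {}"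
proof (induction d)
  case (Suc d)
  define m where "m = Min ((\<lambda>i. Q (p i) d) ` act p d)"
  have "m \<in> (\<lambda>i. Q (p i) d) ` act p d" unfolding m_def using Suc by (intro Min_in) auto
  then obtain i where "i \<in> act p d" "Q (p i) d = m" by blast
  then have "i \<in> act p (Suc d)" by (auto simp: m_def)
  then show ?case by blast
qed simp

text \<open>The input to be picked. Ties go to the smaller index, which is what the downward loops
  leave in \<open>''w''\<close>.\<close>

definition mini :: "(nat \<Rightarrow> nat) \<Rightarrow> nat \<Rightarrow> bool" where
  "mini p w \<longleftrightarrow> w \<in> act p 0 \<and>
     (\<forall>j \<in> act p 0. j \<noteq> w \<longrightarrow> less_fun (Q (p w)) (Q (p j)) \<or> Q (p w) = Q (p j) \<and> w < j)"

lemma mini_unique: "mini p w \<Longrightarrow> mini p w' \<Longrightarrow> w = w'"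
  unfolding mini_def by (metis less_fun_asym less_fun_irrefl order_less_asym)

text \<open>Equal contexts get the cutoff of the comparisons instead of \<open>\<infinity>\<close>.\<close>

definition clcp :: "(nat \<Rightarrow> nat) \<Rightarrow> (nat \<Rightarrow> nat) \<Rightarrow> nat" where
  "clcp f g = (if f = g then N * N else LEAST j. f j \<noteq> g j)"

text \<open>Candidates agree on everything read so far, so a rival with a smaller next character
  would have a smaller context altogether.\<close>

lemma mini_act: "mini p w \<Longrightarrow> w \<in> act p d"
proof (induction d)
  case (Suc d)
  have "Q (p w) d \<le> Q (p j) d" if j: "j \<in> act p d" for j
  proof (rule ccontr)
    assume *: "\<not> Q (p w) d \<le> Q (p j) d"
    then have "less_fun (Q (p j)) (Q (p w))"
      using act_agree[OF j] Suc by (intro less_funI exI[of _ d]) simp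
    moreover have "j \<in> act p 0" using act_sub[of p d] j by auto
    then have "j = w \<or> less_fun (Q (p w)) (Q (p j)) \<or> Q (p w) = Q (p j)"
      using Suc.prems unfolding mini_def by blast
    ultimately show False using * less_fun_asym[of "Q (p j)" "Q (p w)"] less_fun_irrefl by auto
  qed
  then show ?case using Suc by simp
qed (simp add: mini_def)

text \<open>Bounds the number of rounds. Two candidates at depth \<open>d\<close> mean that the
  winner shares \<open>d\<close> characters with another head; if the two contexts are equal, the
  value \<open>N * N\<close> of \<open>clcp\<close> exceeds \<open>d\<close> as well.\<close>

lemma act_clcp:
  assumes "mini p w" "\<And>j. j \<in> act p 0 \<Longrightarrow> j \<noteq> w \<Longrightarrow> clcp (Q (p w)) (Q (p j)) < B"
    and card: "1 < card (act p d)" and d: "d < N * N"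
  shows "d < B"
proof -
  have "act p d \<noteq> {w}" using card by auto
  then obtain j where j: "j \<in> act p d" "j \<noteq> w" using mini_act[OF assms(1), of d] by blast
  have "d \<le> clcp (Q (p w)) (Q (p j))"
  proof (cases "Q (p w) = Q (p j)")
    case False
    then obtain l where "Q (p w) l \<noteq> Q (p j) l" by auto
    then have "Q (p w) (LEAST l. Q (p w) l \<noteq> Q (p j) l) \<noteq> Q (p j) (LEAST l. Q (p w) l \<noteq> Q (p j) l)"
      by (rule LeastI)
    then show ?thesis using act_agree[OF mini_act[OF assms(1)] j(1)] False
      unfolding clcp_def by (simp add: not_less[symmetric]) blast
  qed (use d in \<open>simp add: clcp_def\<close>)
  moreover have "j \<in> act p 0" using act_sub[of p d] j by auto
  ultimately show ?thesis using assms(2) j by fastforce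
qed

text \<open>Both exits of the loop yield the minimum: either one candidate is left, or the cutoff is
  reached, all survivors have equal contexts, and \<open>w\<close> is the least of their
  indices.\<close>

lemma tally_mini:
  assumes ne: "act p 0 \<noteq> {}" and tl: "tally (act p d) 0 t w" and fin: "t \<le> 1 \<or> N * N \<le> d"
  shows "mini p w"
proof -
  have int: "act p d \<inter> {0..<k} = act p d" using act_less by auto
  have t: "t = card (act p d)" and w: "w = Min (act p d)"
    using tl act_nonempty[OF ne, of d] by (auto simp: tally_def int)
  have wA: "w \<in> act p d" unfolding w using act_nonempty[OF ne] by (intro Min_in) auto
  moreover have "act p d \<subseteq> act p 0" using act_sub[of p d] by auto
  moreover have "less_fun (Q (p w)) (Q (p j)) \<or> Q (p w) = Q (p j) \<and> w < j"
    if j: "j \<in> act p 0" "j \<noteq> w" for j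
  proof (cases "j \<in> act p d")
    case False
    then show ?thesis using act_eliminated[OF wA j(1)] by blast
  next
    case True
    have "card {w, j} \<le> card (act p d)" using True wA by (intro card_mono) auto
    then have "N * N \<le> d" using fin j(2) t by simp
    then have "Q (p w) = Q (p j)"
      using act_agree[OF wA True] act_pos_less[OF wA] act_pos_less[OF True] by (intro Q_agree) auto
    moreover have "w \<le> j" unfolding w using True by simp
    ultimately show ?thesis using j by simp
  qed
  ultimately show ?thesis unfolding mini_def by blast
qed

text \<open>Read off from the elimination itself, carried on for \<open>N * N\<close>
  rounds.\<close>

lemma mini_exists: "act p 0 \<noteq> {} \<Longrightarrow> \<exists>w. mini p w"
  using tally_mini[of p "N * N" "card (act p (N * N) \<inter> {0..<k})" "Min (act p (N * N) \<inter> {0..<k})"]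
  by (auto simp: tally_def)

lemma J_pow_less: "y < N \<Longrightarrow> (J ^^ d) y < N"
  by (induction d) (auto simp: J_less)

lemma Q_eq: "y < N \<Longrightarrow> Q y d = C (J ((J ^^ d) y))"
  by (induction d arbitrary: y) (simp_all add: Q_0 Q_Suc J_less funpow_swap1)

lemma act_Suc_eq:
  assumes "i0 \<in> act p d" "n = Q (p i0) d" "\<And>i. i \<in> act p d \<Longrightarrow> n \<le> Q (p i) d"
  shows "act p (Suc d) = {i \<in> act p d. Q (p i) d = n}"
  using assms by (auto intro: order_antisym)

text \<open>Cost of one elimination round, dominated by \<open>k\<close> binary searches among
  \<open>R\<close> runs; large enough for the initialisation too.\<close>

definition FC :: nat where
  "FC = 500 + k * (500 + 30 * floorlog 2 R)"

text \<open>At most \<open>B\<close> rounds take place, and the additional 1 pays for the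
  initialisation. \<open>B\<close> stays a parameter because the LCPs that bound a comparison depend
  on where in the merged order it takes place.\<close>

lemma findmin_correct:
  assumes tab: "tab s" and hd: "heads s p" and ne: "act p 0 \<noteq> {}" and mini: "mini p w"
    and B: "\<And>j. j \<in> act p 0 \<Longrightarrow> j \<noteq> w \<Longrightarrow> clcp (Q (p w)) (Q (p j)) < B"
  shows "WP (findmin k) s (\<lambda>t s'. t \<le> FC * (B + 1) \<and> reg s' ''w'' = w)"
proof -
  let ?I = "\<lambda>s. tab s \<and> flags s (act p (reg s ''d'')) \<and> reg s ''d'' \<le> N * N \<and> reg s ''w'' \<le> k \<and>
    (\<forall>i \<in> act p (reg s ''d''). col s 3 i = (J ^^ reg s ''d'') (p i)) \<and>
    tally (act p (reg s ''d'')) 0 (reg s ''t'') (reg s ''w'') \<and> reg s ''d'' \<le> B"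
  have ps: "p i < N" if "i \<in> act p d" for i d using act_pos_less that .
  have FC1: "(60 + (140 + 30 * floorlog 2 R) * k) + (60 + 80 * k) + 100 \<le> FC"
    and FC2: "(60 + 80 * k) + 100 \<le> FC"
    unfolding FC_def by (simp_all add: algebra_simps)
  have CQ: "C (J ((J ^^ d) (p i))) = Q (p i) d" if "i \<in> act p d" for i d
    using Q_eq ps that by simp
  have step: "WP (fm_read k;; fm_filter k;; Assign ''d'' (Bin Plus (Var ''d'') (Const (Suc 0)))) s
      (\<lambda>t s'. ?I s' \<and> t + 8 + FC * (B - reg s' ''d'') \<le> FC * (B - reg s ''d''))"
    if I: "?I s" and t1: "1 < reg s ''t''" and dD: "reg s ''d'' < N * N" for s
  proof -
    define d where "d = reg s ''d''"
    define z where "z = (\<lambda>i. (J ^^ d) (p i))"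
    have tb: "tab s" and fl: "flags s (act p d)" and w: "reg s ''w'' \<le> k"
      and cur: "\<And>i. i \<in> act p d \<Longrightarrow> i < k \<and> z i < N \<and> col s 3 i = z i"
      and tl: "tally (act p d) 0 (reg s ''t'') (reg s ''w'')"
      using I act_less[of _ p d] J_pow_less ps by (auto simp: d_def z_def)
    have "act p d \<inter> {0..<k} = act p d" using act_less by auto
    then have dB: "d < B" using act_clcp[OF mini B, of d] tl t1 dD by (simp add: tally_def d_def)
    have FCB: "FC * (B - d) = FC + FC * (B - Suc d)" using dB
      by (metis Suc_diff_Suc mult_Suc_right)
    show ?thesis
      apply (simp del: act.simps)
      apply (rule wp_call[OF fm_read_correct[OF tb fl cur]])
       apply assumption
      subgoal by simp
      subgoal premises q for t1 s1
      proof -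
        have regs: "x \<in> {''d'', ''w'', ''S'', ''R'', ''N'', ''D''} \<Longrightarrow> reg s1 x = reg s x" for x
          using q(2)[of x] by auto
        have cols: "j \<in> {6, 7, 8, 9, 11, 14} \<Longrightarrow> col s1 j = col s j" for j using q(3)[of j] by auto
        have tb1: "tab s1" using tb regs cols by (simp add: tab_def)
        have fl1: "flags s1 (act p d)" using fl cols by (simp add: flags_def)
        have cur1: "col s1 3 i = J (z i)" "col s1 4 i = Q (p i) d" "reg s1 ''n'' \<le> Q (p i) d"
          if "i \<in> act p d" for i using q(1) that CQ by (auto simp: z_def)
        obtain i0 where i0: "i0 \<in> act p d" "reg s1 ''n'' = Q (p i0) d"
          using q(1) act_nonempty[OF ne, of d] CQ by (auto simp: z_def)
        have Qs: "Q (p i) d < \<sigma>" if "i \<in> act p d" for i using Q_less ps that by blast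
        have A: "{i \<in> act p d. col s1 4 i = reg s1 ''n''} = act p (Suc d)"
          using act_Suc_eq[OF i0] cur1 by auto
        have "WP (fm_filter k) s1 (\<lambda>t s'. t \<le> 60 + 80 * k \<and> flags s' (act p (Suc d)) \<and>
            tally (act p (Suc d)) 0 (reg s' ''t'') (reg s' ''w''))"
          using fm_filter_correct[OF fl1, unfolded A] act_less cur1 Qs i0 w regs
          by (simp add: less_imp_le)
        then show ?thesis
          apply (rule wp_call)
          subgoal by simp
          subgoal premises r for t2 s2
          proof -
            have regs2: "x \<in> {''d'', ''S'', ''R'', ''N'', ''D''} \<Longrightarrow> reg s2 x = reg s x" for x
              using r(2)[of x] regs by auto
            have cols2: "j \<in> {6, 7, 8, 9, 11, 3} \<Longrightarrow> col s2 j = col s1 j" for j using r(3)[of j] by auto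
            have tb2: "tab s2" using tb1 regs regs2 cols2 by (simp add: tab_def)
            have tl2: "tally (act p (Suc d)) 0 (reg s2 ''t'') (reg s2 ''w'')" using r(1) by simp
            have w2: "reg s2 ''w'' < k"
            proof -
              have "act p (Suc d) \<inter> {0..<k} = act p (Suc d)" using act_less[of _ p "Suc d"] by auto
              then have "reg s2 ''w'' = Min (act p (Suc d))"
                using tl2 act_nonempty[OF ne, of "Suc d"] by (simp add: tally_def del: act.simps)
              then show ?thesis
                using act_less[OF Min_in[of "act p (Suc d)"]] act_nonempty[OF ne, of "Suc d"] by simp
            qed
            have cur2: "col s2 3 i = (J ^^ Suc d) (p i)" if "i \<in> act p (Suc d)" for i
              using that cur1(1)[of i] cols2 by (simp add: z_def)
            have d2: "reg s2 ''d'' = d" using regs2 by (simp add: d_def)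
            show ?thesis
              using d2 tb2 tl2 w2 cur2 r(1) q(1) dB dD FCB FC1 W_sq
              by (simp add: tab_def flags_def d_def[symmetric] del: act.simps)
          qed
          done
      qed
      done
  qed
  show ?thesis unfolding findmin_def
    apply (simp del: act.simps)
    apply (rule wp_call[OF fm_init_correct[OF hd]])
    subgoal by simp
    subgoal premises q for t0 s0
    proof -
      have regs: "x \<in> {''S'', ''R'', ''N'', ''D''} \<Longrightarrow> reg s0 x = reg s x" for x
        using q(2)[of x] by auto
      have cols: "j \<in> {6, 7, 8, 9, 11} \<Longrightarrow> col s0 j = col s j" for j using q(3)[of j] by auto
      have tb0: "tab s0" using tab regs cols by (simp add: tab_def)
      have tl: "tally (act p 0) 0 (reg s0 ''t'') (reg s0 ''w'')" using q(1) by simp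
      have w0: "reg s0 ''w'' < k"
      proof -
        have "act p 0 \<inter> {0..<k} = act p 0" using act_less[of _ p 0] by auto
        then have "reg s0 ''w'' = Min (act p 0)"
          using tl ne by (simp add: tally_def del: act.simps)
        then show ?thesis
          using act_less[OF Min_in[of "act p 0"]] ne by simp
      qed
      have c0: "col s0 3 i = p i" if "i \<in> act p 0" for i using q(1) that by simp
      show ?thesis
        apply (intro conjI)
        subgoal using W_lin by simp
        apply (rule wp_While[where I = ?I and \<Phi> = "\<lambda>s. FC * (B - reg s ''d'')"])
        subgoal using q(1) tb0 tl w0 c0 by (simp add: tab_def flags_def del: act.simps)
        subgoal premises I for s1
          using I W_lin W_sq tally_card[of "act p (reg s1 ''d'')" 0 "reg s1 ''t''" "reg s1 ''w''"] k_le_R R_le_N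
          by (auto simp: tab_def)
        subgoal premises I for s1
        proof -
          have "1 < reg s1 ''t''" "reg s1 ''d'' < N * N"
            using I(1,2) by (simp_all add: tab_def split: if_splits)
          from step[OF I(1) this] show ?thesis by (rule wp_mono) (simp del: act.simps)
        qed
        subgoal premises I for t1 s1
        proof -
          have "mini p (reg s1 ''w'')"
            using tally_mini[OF ne, of "reg s1 ''d''" "reg s1 ''t''"] I(1,2)
            by (simp add: tab_def not_less split: if_splits del: act.simps)
          then have "reg s1 ''w'' = w" using mini_unique mini by blast
          then show ?thesis using I(3) q(1) FC2 by simp
        qed
        done
    qed
    done
qed

end

section \<open>The merged order and its blocks\<close>

lemma less_fun_total: "less_fun f g \<or> f = g \<or> less_fun g f" for f g :: "nat \<Rightarrow> nat"
proof (cases "f = g")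
  case False
  then obtain j where "f j \<noteq> g j" by auto
  define l where "l = (LEAST j. f j \<noteq> g j)"
  have "f l \<noteq> g l" unfolding l_def using \<open>f j \<noteq> g j\<close> by (rule LeastI)
  moreover have "f m = g m" if "m < l" for m using not_less_Least that unfolding l_def by blast
  ultimately show ?thesis
    by (cases "f l < g l") (auto intro!: less_funI exI[of _ l])
qed simp

text \<open>At the first position below \<open>m\<close> where \<open>g\<close> left
  \<open>f\<close> it would also leave \<open>h\<close>, and one of the two order relations would
  fail. Hence a context between two others inherits their common prefix.\<close>

lemma less_fun_squeeze:
  fixes f g h :: "nat \<Rightarrow> nat"
  assumes "\<not> less_fun g f" "\<not> less_fun h g" "\<And>j. j < m \<Longrightarrow> f j = h j" "j < m"
  shows "g j = f j"
  using \<open>j < m\<close>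
proof (induction j rule: less_induct)
  case (less j)
  have eq: "g i = f i" "f i = h i" if "i < j" for i using less that assms(3) by auto
  have "\<not> g j < f j" using assms(1) eq less_funI[of g f] by blast
  moreover have "\<not> f j < g j" using assms(2) eq less_funI[of h g] assms(3)[OF less.prems] by metis
  ultimately show ?case by simp
qed

text \<open>Rows of all inputs are numbered consecutively: input \<open>i\<close> owns the rows
  \<open>st i\<close>, ..., \<open>en i - 1\<close>, which are sorted by context, and
  \<open>src\<close> maps a row to its input.\<close>

locale merge_sources = merge_table +
  fixes st :: "nat \<Rightarrow> nat" and src :: "nat \<Rightarrow> nat"
  assumes st_le_en: "i < k \<Longrightarrow> st i \<le> en i"
    and en_le_st: "i < j \<Longrightarrow> j < k \<Longrightarrow> en i \<le> st j"
    and src: "y < N \<Longrightarrow> src y < k \<and> st (src y) \<le> y \<and> y < en (src y)"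
    and Q_sorted: "i < k \<Longrightarrow> st i \<le> y \<Longrightarrow> y < y' \<Longrightarrow> y' < en i \<Longrightarrow> \<not> less_fun (Q y') (Q y)"
begin

lemma src_eq: "i < k \<Longrightarrow> st i \<le> y \<Longrightarrow> y < en i \<Longrightarrow> src y = i"
  using src[of y] en_le_st[of i "src y"] en_le_st[of "src y" i] en_le[of i]
  by (cases "src y" i rule: linorder_cases) auto

text \<open>The order that the merge produces. Breaking ties by row number agrees with breaking them
  by input index, as inputs with smaller index own smaller rows.\<close>

definition rel :: "nat \<Rightarrow> nat \<Rightarrow> bool" where
  "rel y y' \<longleftrightarrow> less_fun (Q y) (Q y') \<or> Q y = Q y' \<and> y < y'"

lemma rel_trans: "rel x y \<Longrightarrow> rel y z \<Longrightarrow> rel x z"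
  unfolding rel_def by (metis less_fun_trans order_less_trans)

lemma rel_asym: "rel x y \<Longrightarrow> \<not> rel y x"
  unfolding rel_def by (metis less_fun_asym less_fun_irrefl order_less_asym)

lemma rel_total: "x \<noteq> y \<Longrightarrow> rel x y \<or> rel y x"
  unfolding rel_def using less_fun_total[of "Q x" "Q y"] by auto

lemma rel_not_less: "rel x y \<Longrightarrow> \<not> less_fun (Q y) (Q x)"
  unfolding rel_def by (metis less_fun_asym less_fun_irrefl)

lemma rel_source: "i < k \<Longrightarrow> st i \<le> y \<Longrightarrow> y < y' \<Longrightarrow> y' < en i \<Longrightarrow> rel y y'"
  using Q_sorted[of i y y'] less_fun_total[of "Q y" "Q y'"] by (auto simp: rel_def)

text \<open>The merged order. Counting the smaller rows turns the strict total order
  \<open>rel\<close> into a numeric key.\<close>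

definition Z :: "nat list" where
  "Z = sort_key (\<lambda>y. card {x. x < N \<and> rel x y}) [0..<N]"

lemma length_Z [simp]: "length Z = N" and set_Z [simp]: "set Z = {..<N}" and distinct_Z: "distinct Z"
  by (auto simp: Z_def)

lemma Z_rel: "t < u \<Longrightarrow> u < N \<Longrightarrow> rel (Z ! t) (Z ! u)"
proof -
  assume tu: "t < u" "u < N"
  let ?r = "\<lambda>y. card {x. x < N \<and> rel x y}"
  have "sorted (map ?r Z)" unfolding Z_def by simp
  then have le: "?r (Z ! t) \<le> ?r (Z ! u)" using tu by (auto simp: sorted_iff_nth_mono)
  have ne: "Z ! t \<noteq> Z ! u" using tu distinct_Z by (simp add: nth_eq_iff_index_eq)
  have "\<not> rel (Z ! u) (Z ! t)"
  proof
    assume r: "rel (Z ! u) (Z ! t)"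
    have "Z ! u < N" using tu nth_mem[of u Z] by simp
    then have "{x. x < N \<and> rel x (Z ! u)} \<subset> {x. x < N \<and> rel x (Z ! t)}"
      using r rel_trans[OF _ r] rel_asym[of "Z ! u" "Z ! u"] by auto
    then have "?r (Z ! u) < ?r (Z ! t)" by (intro psubset_card_mono) auto
    then show False using le by simp
  qed
  then show ?thesis using rel_total[OF ne] by blast
qed

lemma Z_less: "t < N \<Longrightarrow> Z ! t < N"
  using nth_mem[of t Z] by simp

text \<open>State of the merge after \<open>t\<close> rows: the heads \<open>p\<close> cut off
  exactly the first \<open>t\<close> rows of the merged order.\<close>

definition valid :: "(nat \<Rightarrow> nat) \<Rightarrow> nat \<Rightarrow> bool" where
  "valid p t \<longleftrightarrow> t \<le> N \<and> (\<forall>i<k. st i \<le> p i \<and> p i \<le> en i) \<and>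
     set (take t Z) = {y. \<exists>i<k. st i \<le> y \<and> y < p i}"

lemma heads_mono: "valid p t \<Longrightarrow> i < j \<Longrightarrow> i \<in> act p 0 \<Longrightarrow> j \<in> act p 0 \<Longrightarrow> p i < p j"
  unfolding valid_def using en_le_st[of i j] by fastforce

lemma mini_iff: "valid p t \<Longrightarrow>
    mini p w \<longleftrightarrow> w \<in> act p 0 \<and> (\<forall>j \<in> act p 0. j \<noteq> w \<longrightarrow> rel (p w) (p j))"
  unfolding mini_def rel_def using heads_mono[of p t]
  by (metis linorder_neqE_nat order_less_asym)

lemma valid_init: "valid st 0"
  using st_le_en by (auto simp: valid_def)

lemma valid_remaining: "valid p t \<Longrightarrow> t \<le> u \<Longrightarrow> u < N \<Longrightarrow> p (src (Z ! u)) \<le> Z ! u"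
proof (rule ccontr)
  assume v: "valid p t" and u: "t \<le> u" "u < N" and "\<not> p (src (Z ! u)) \<le> Z ! u"
  then have "Z ! u \<in> set (take t Z)" using src[OF Z_less[OF u(2)]] by (auto simp: valid_def)
  then obtain i where "i < t" "Z ! i = Z ! u" using u by (auto simp: in_set_conv_nth)
  then show False using u distinct_Z nth_eq_iff_index_eq[of Z i u] by auto
qed

lemma remaining_pos:
  assumes v: "valid p t" and i: "i < k" "p i \<le> y" "y < en i"
  shows "\<exists>u. t \<le> u \<and> u < N \<and> Z ! u = y" "src y = i"
proof -
  have y: "st i \<le> y" "y < N" using v i en_le[of i] by (auto simp: valid_def intro: order_trans)
  show sy: "src y = i" using src_eq i y by simp
  have "y \<notin> set (take t Z)"
  proof
    assume "y \<in> set (take t Z)"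
    then obtain j where "j < k" "st j \<le> y" "y < p j" "p j \<le> en j" using v by (auto simp: valid_def)
    moreover from this have "j = i" using src_eq[of j y] sy by simp
    ultimately show False using i by simp
  qed
  moreover have "y \<in> set Z" using y by simp
  moreover have "y \<in> set (take t Z)" if "u < t" "u < N" "Z ! u = y" for u
    using that by (auto simp: in_set_conv_nth)
  ultimately obtain u where "u < N" "Z ! u = y" "\<not> u < t"
    using length_Z by (metis in_set_conv_nth)
  then show "\<exists>u. t \<le> u \<and> u < N \<and> Z ! u = y" by (intro exI[of _ u]) auto
qed

text \<open>Correctness of a merge step. The row \<open>Z ! t\<close> lies at or after the head of
  its own input, and the winning head precedes all other heads; since the winning head is itself
  still to be output, it is \<open>Z ! t\<close>.\<close>

lemma mini_next:
  assumes v: "valid p t" and m: "mini p a"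
  shows "t < N" "Z ! t = p a" "valid (p(a := Suc (p a))) (Suc t)"
proof -
  have a: "a \<in> act p 0" and min: "\<And>j. j \<in> act p 0 \<Longrightarrow> j \<noteq> a \<Longrightarrow> rel (p a) (p j)"
    using m mini_iff[OF v] by auto
  obtain u where u: "t \<le> u" "u < N" "Z ! u = p a" using remaining_pos(1)[OF v, of a "p a"] a by auto
  show t: "t < N" using u by simp
  define i where "i = src (Z ! t)"
  have i: "i < k" "st i \<le> Z ! t" "Z ! t < en i" "p i \<le> Z ! t"
    using src[OF Z_less[OF t]] valid_remaining[OF v _ t] by (auto simp: i_def)
  then have "i \<in> act p 0" by simp
  then have "i = a \<or> rel (p a) (p i)" using min by blast
  moreover have "p i = Z ! t \<or> rel (p i) (Z ! t)"
    using rel_source[of i "p i" "Z ! t"] i v by (auto simp: valid_def le_less)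
  ultimately have "p a = Z ! t \<or> rel (p a) (Z ! t)" using rel_trans by auto
  then show eq: "Z ! t = p a" using u Z_rel[of t u] rel_asym by (cases "t = u") auto
  have "set (take (Suc t) Z) = insert (p a) {y. \<exists>i<k. st i \<le> y \<and> y < p i}"
    using t v eq by (simp add: take_Suc_conv_app_nth valid_def)
  also have "\<dots> = {y. \<exists>i<k. st i \<le> y \<and> y < (p(a := Suc (p a))) i}"
    using a v act_less[OF a] by (auto simp: valid_def less_Suc_eq split: if_splits)
  finally show "valid (p(a := Suc (p a))) (Suc t)" using t v a by (auto simp: valid_def)
qed

text \<open>For a row \<open>x\<close> of input \<open>a\<close> at or after its head: the merge
  outputs \<open>x\<close> before it switches to another input.\<close>

definition inblock :: "(nat \<Rightarrow> nat) \<Rightarrow> nat \<Rightarrow> nat \<Rightarrow> bool" where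
  "inblock p a x \<longleftrightarrow> (\<forall>j \<in> act p 0. j \<noteq> a \<longrightarrow> rel x (p j))"

text \<open>Describes a probe, in which the head of \<open>a\<close> is moved to \<open>x\<close>
  and the other heads stay. Heads still increase with the input index, so ties remain consistent
  with \<open>rel\<close>.\<close>

lemma mini_upd_iff: 
  assumes v: "valid p t" and a: "a < k" and x: "p a \<le> x" "x < en a"
  shows "mini (p(a := x)) w \<longleftrightarrow> w \<in> act p 0 \<union> {a} \<and>
    (\<forall>j \<in> act p 0 \<union> {a}. j \<noteq> w \<longrightarrow> rel ((p(a := x)) w) ((p(a := x)) j))"
proof -
  have act: "act (p(a := x)) 0 = act p 0 \<union> {a}" using a x by auto
  have mono: "i < j \<Longrightarrow> i \<in> act (p(a := x)) 0 \<Longrightarrow> j \<in> act (p(a := x)) 0 \<Longrightarrow> (p(a := x)) i < (p(a := x)) j" for i j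
    using v x a en_le_st[of i j] unfolding valid_def act by (fastforce split: if_splits)
  show ?thesis unfolding act[symmetric] mini_def rel_def using mono
    by (metis linorder_neqE_nat order_less_asym)
qed

lemma mini_upd_self:
  "valid p t \<Longrightarrow> a < k \<Longrightarrow> p a \<le> x \<Longrightarrow> x < en a \<Longrightarrow> mini (p(a := x)) a \<longleftrightarrow> inblock p a x"
  by (auto simp: mini_upd_iff inblock_def)

text \<open>The monotonicity that justifies a binary search for the end of a block.\<close>

lemma inblock_down:
  assumes "valid p t" "inblock p a x" "p a \<le> y" "y \<le> x" "x < en a" "a < k"
  shows "inblock p a y"
proof -
  have "y = x \<or> rel y x" using rel_source[of a y x] assms by (cases "y = x") (auto simp: valid_def)
  then show ?thesis using assms(2) rel_trans unfolding inblock_def by blast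
qed

text \<open>As long as the head of \<open>a\<close> precedes all other heads,
  \<open>mini_next\<close> outputs it, row by row.\<close>

lemma block:
  assumes v: "valid p t" and a: "a < k" and h: "p a \<le> h" "h \<le> en a"
    and blk: "\<And>x. p a \<le> x \<Longrightarrow> x < h \<Longrightarrow> inblock p a x"
  shows "valid (p(a := h)) (t + (h - p a)) \<and> take (t + (h - p a)) Z = take t Z @ [p a..<h]"
  using h blk
proof (induction h rule: dec_induct)
  case base then show ?case using v by simp
next
  case (step h)
  have v': "valid (p(a := h)) (t + (h - p a))" and tk: "take (t + (h - p a)) Z = take t Z @ [p a..<h]"
    using step.IH step.prems by (auto simp del: fun_upd_apply)
  have "mini (p(a := h)) a"
    using step.prems step.hyps a by (subst mini_upd_self[OF v]) auto
  from mini_next[OF v' this]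
  have "Z ! (t + (h - p a)) = h" "t + (h - p a) < N" "valid (p(a := Suc h)) (Suc (t + (h - p a)))"
    by auto
  moreover have "Suc h - p a = Suc (h - p a)" using step.hyps by simp
  ultimately show ?case using tk step.hyps by (simp add: take_Suc_conv_app_nth del: fun_upd_apply)
qed

section \<open>Boundaries, their weights and the potential of the merge\<close>

definition bd :: "nat set" where
  "bd = {b. 0 < b \<and> b < N \<and> src (Z ! (b - 1)) \<noteq> src (Z ! b)}"

definition nb :: "nat \<Rightarrow> nat" where
  "nb t = (if t < N then LEAST b. b \<in> insert N bd \<and> t < b else N)"

definition wt :: "nat \<Rightarrow> nat" where
  "wt b = (if b < N then Suc (clcp (Q (Z ! (b - 1))) (Q (Z ! b))) else 1)"

definition pot :: "nat \<Rightarrow> nat" where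
  "pot t = (\<Sum>b \<in> {b \<in> insert N bd. t < b}. wt b)"

text \<open>Bounds the comparisons made for the block that starts at \<open>t\<close>: those won by
  its input through the weight of its end, those lost through the weight of the end of the next
  block. Over all blocks each weight occurs at most twice, which \<open>pot_bcost\<close> expresses
  as a telescoping sum.\<close>

definition bcost :: "nat \<Rightarrow> nat" where
  "bcost t = wt (nb t) + (if nb t < N then wt (nb (nb t)) else 0)"

lemma finite_bd [simp]: "finite bd"
  by (rule finite_subset[of _ "{..N}"]) (auto simp: bd_def)

lemma nb: "t < N \<Longrightarrow> nb t \<in> insert N bd \<and> t < nb t \<and> (\<forall>b \<in> insert N bd. t < b \<longrightarrow> nb t \<le> b)"
  using LeastI[of "\<lambda>b. b \<in> insert N bd \<and> t < b" N] Least_le[of "\<lambda>b. b \<in> insert N bd \<and> t < b"]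
  by (auto simp: nb_def simp del: insert_iff)

lemma nb_le: "nb t \<le> N"
  using nb[of t] by (cases "t < N") (auto simp: nb_def bd_def)

lemma pot_nb: "t < N \<Longrightarrow> pot t = wt (nb t) + pot (nb t)"
proof -
  assume t: "t < N"
  have "{b \<in> insert N bd. t < b} = insert (nb t) {b \<in> insert N bd. nb t < b}"
    using nb[OF t] by (auto simp del: insert_iff simp: le_less)
  then show ?thesis unfolding pot_def by (simp del: insert_iff)
qed

lemma pot_N: "pot N = 0" and nb_N [simp]: "nb N = N"
proof -
  have "{b \<in> insert N bd. N < b} = {}" by (auto simp: bd_def)
  then show "pot N = 0" by (simp only: pot_def) simp
qed (simp add: nb_def)

lemma pot_bcost: "t < N \<Longrightarrow> pot t + pot (nb t) = bcost t + (pot (nb t) + pot (nb (nb t)))"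
  using pot_nb[of t] pot_nb[of "nb t"] nb_le[of t] by (auto simp: bcost_def pot_N le_less)

lemma bcost_pos: "0 < bcost t"
  by (auto simp: bcost_def wt_def)

text \<open>The contexts satisfy \<open>x \<le> y \<le> y' \<le> z\<close>, so the inner pair
  inherits the common prefix of the outer one. The cutoff value for equal contexts does no harm,
  because distinct contexts already differ below it.\<close>

lemma clcp_mono:
  assumes y: "x < N" "y < N" "y' < N" "z < N" and le: "\<not> less_fun (Q y) (Q x)"
    "\<not> less_fun (Q y') (Q y)" "\<not> less_fun (Q z) (Q y')" "\<not> less_fun (Q z) (Q y)" "\<not> less_fun (Q y') (Q x)"
  shows "clcp (Q x) (Q z) \<le> clcp (Q y) (Q y')"
proof -
  have *: "Q y l = Q x l \<and> Q y' l = Q x l" if "\<And>j. j < m \<Longrightarrow> Q x j = Q z j" "l < m" for l m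
    using less_fun_squeeze[OF le(1,4) that] less_fun_squeeze[OF le(5,3) that] by simp
  have ub: "clcp (Q u) (Q v) \<le> N * N" if uv: "u < N" "v < N" for u v
  proof (cases "Q u = Q v")
    case False
    then obtain j where "j < N * N" "Q u j \<noteq> Q v j" using Q_agree[of u v] uv by metis
    then show ?thesis using Least_le[of "\<lambda>j. Q u j \<noteq> Q v j" j] by (simp add: clcp_def)
  qed (simp add: clcp_def)
  show ?thesis
  proof (cases "Q y = Q y'")
    case True
    then show ?thesis using ub[OF y(1,4)] by (simp add: clcp_def)
  next
    case False
    define l where "l = (LEAST j. Q y j \<noteq> Q y' j)"
    have "\<exists>j. Q y j \<noteq> Q y' j" using False by (simp add: fun_eq_iff)
    then have l: "Q y l \<noteq> Q y' l" unfolding l_def by (rule LeastI_ex)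
    have "\<not> (\<forall>j<Suc l. Q x j = Q z j)"
    proof
      assume "\<forall>j<Suc l. Q x j = Q z j"
      then have "Q y l = Q x l \<and> Q y' l = Q x l" by (intro *[of "Suc l" l]) simp_all
      then show False using l by simp
    qed
    then obtain j where j: "j < Suc l" "Q x j \<noteq> Q z j" by auto
    then have "(LEAST j. Q x j \<noteq> Q z j) \<le> l" using Least_le[of "\<lambda>j. Q x j \<noteq> Q z j" j] by simp
    then show ?thesis using j(2) False unfolding clcp_def l_def by auto
  qed
qed

lemma Z_not_less: "t \<le> u \<Longrightarrow> u < N \<Longrightarrow> \<not> less_fun (Q (Z ! u)) (Q (Z ! t))"
  using Z_rel[of t u] rel_not_less less_fun_irrefl by (cases "t = u") auto

text \<open>Rows of different inputs are separated by a boundary, so the next boundary after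
  \<open>t\<close> lies between them, and \<open>clcp_mono\<close> compares them with the two rows
  adjacent to it.\<close>

lemma clcp_bound:
  assumes "t < u" "u < N" "src (Z ! t) \<noteq> src (Z ! u)"
  shows "clcp (Q (Z ! t)) (Q (Z ! u)) < wt (nb t)"
proof -
  have "\<exists>b \<in> bd. t < b \<and> b \<le> u"
  proof (rule ccontr)
    assume no: "\<not> (\<exists>b \<in> bd. t < b \<and> b \<le> u)"
    have "src (Z ! v) = src (Z ! t)" if "t \<le> v" "v \<le> u" for v
      using that
    proof (induction v rule: dec_induct)
      case (step v)
      then have "Suc v \<notin> bd" using no by auto
      then have "src (Z ! v) = src (Z ! Suc v)" using step.prems assms(2) by (simp add: bd_def)
      then show ?case using step.IH step.prems by simp
    qed simp
    from this[of u] show False using assms by simp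
  qed
  then obtain b where b: "b \<in> bd" "t < b" "b \<le> u" by blast
  have nbt: "t < nb t" "nb t \<le> u" "nb t < N" using nb[of t] b assms by fastforce+
  have "clcp (Q (Z ! t)) (Q (Z ! u)) \<le> clcp (Q (Z ! (nb t - 1))) (Q (Z ! nb t))"
    using nbt assms by (intro clcp_mono Z_less Z_not_less) auto
  then show ?thesis using nbt by (simp add: wt_def)
qed

section \<open>A single block, consisting of the rows \<open>p a\<close>, ..., \<open>h - 1\<close>
  of input \<open>a\<close>\<close>

context
  fixes p t a h
  assumes v: "valid p t" and a: "a < k" and h: "p a < h" "h \<le> en a"
    and blk: "\<And>x. p a \<le> x \<Longrightarrow> x < h \<Longrightarrow> inblock p a x"
    and nblk: "h < en a \<Longrightarrow> \<not> inblock p a h"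
begin

lemma valid_block: "valid (p(a := h)) (t + (h - p a))"
  and take_block: "take (t + (h - p a)) Z = take t Z @ [p a..<h]"
  using block[OF v a, of h] h blk by auto

lemma block_end_le: "t + (h - p a) \<le> N"
  using valid_block by (simp add: valid_def)

lemma Z_block: "p a \<le> x \<Longrightarrow> x < h \<Longrightarrow> Z ! (t + (x - p a)) = x"
proof -
  assume x: "p a \<le> x" "x < h"
  have "Z ! (t + (x - p a)) = take (t + (h - p a)) Z ! (t + (x - p a))" using x by simp
  also have "\<dots> = x" unfolding take_block using x block_end_le by (auto simp: nth_append)
  finally show ?thesis .
qed

lemma block_beaten: "h < en a \<Longrightarrow> \<exists>j \<in> act p 0. j \<noteq> a \<and> rel (p j) h"
proof -
  assume "h < en a"
  then obtain j where j: "j \<in> act p 0" "j \<noteq> a" "\<not> rel h (p j)" using nblk by (auto simp: inblock_def)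
  have "src h = a" using remaining_pos(2)[OF v a, of h] \<open>h < en a\<close> h by simp
  moreover have "src (p j) = j" using remaining_pos(2)[OF v, of j "p j"] j by simp
  ultimately have "h \<noteq> p j" using j by auto
  then show ?thesis using j rel_total by blast
qed

text \<open>If the next row came from \<open>a\<close>, it would be row \<open>h\<close> or a later
  one, yet some other head precedes row \<open>h\<close> and is still to be output.\<close>

lemma src_block_end: "t + (h - p a) < N \<Longrightarrow> src (Z ! (t + (h - p a))) \<noteq> a"
proof
  assume lt: "t + (h - p a) < N" and s: "src (Z ! (t + (h - p a))) = a"
  define t1 where "t1 = t + (h - p a)"
  have "h \<le> Z ! t1" "Z ! t1 < en a"
    using valid_remaining[OF valid_block _ lt] s src[OF Z_less[OF lt]] by (auto simp: t1_def)
  then have hen: "h < en a" by simp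
  obtain j where j: "j \<in> act p 0" "j \<noteq> a" "rel (p j) h" using block_beaten[OF hen] by blast
  have "h = Z ! t1 \<or> rel h (Z ! t1)"
    using rel_source[of a h "Z ! t1"] \<open>h \<le> Z ! t1\<close> \<open>Z ! t1 < en a\<close> a h v by (auto simp: valid_def le_less intro: less_imp_le order_trans)
  then have r: "rel (p j) (Z ! t1)" using j rel_trans by auto
  obtain u where "t1 \<le> u" "u < N" "Z ! u = p j"
    using remaining_pos(1)[OF valid_block, of j "p j"] j by (auto simp: t1_def)
  then show False using r Z_rel[of t1 u] rel_asym by (cases "t1 = u") auto
qed

lemma nb_block: "t \<le> t' \<Longrightarrow> t' < t + (h - p a) \<Longrightarrow> nb t' = t + (h - p a)"
proof -
  assume t': "t \<le> t'" "t' < t + (h - p a)"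
  define t1 where "t1 = t + (h - p a)"
  have srcs: "src (Z ! s) = a" if "t \<le> s" "s < t1" for s
  proof -
    define x where "x = p a + (s - t)"
    have x: "p a \<le> x" "x < h" "t + (x - p a) = s" using that h unfolding x_def t1_def by linarith+
    have "Z ! s = x" using Z_block[OF x(1,2)] x(3) by simp
    then show ?thesis using remaining_pos(2)[OF v a x(1)] x(2) h(2) by simp
  qed
  have t1: "t1 \<in> insert N bd"
  proof (cases "t1 < N")
    case True
    have "src (Z ! (t1 - 1)) = a" using t' by (intro srcs) (simp_all add: t1_def)
    then show ?thesis using src_block_end True t' by (auto simp: bd_def t1_def[symmetric])
  qed (use block_end_le in \<open>simp add: t1_def\<close>)
  have no: "b \<notin> insert N bd" if "t < b" "b < t1" for b
    using that block_end_le srcs[of b] srcs[of "b - 1"] by (auto simp: bd_def t1_def[symmetric])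
  have "nb t' = t1"
  proof (rule order_antisym)
    show "nb t' \<le> t1" using nb[of t'] t1 t' block_end_le by (auto simp: t1_def)
    show "t1 \<le> nb t'" using nb[of t'] no[of "nb t'"] t' block_end_le
      by (auto simp: t1_def[symmetric] not_less[symmetric] simp del: insert_iff)
  qed
  then show ?thesis by (simp add: t1_def)
qed

text \<open>Core of the time bound. If \<open>a\<close> wins the probe, \<open>x\<close> lies inside
  the block and all other heads behind its end, so the weight of that end is a bound. If
  \<open>a\<close> loses, the winner is the first row of the next block and its rivals lie behind it
  in other inputs, so the end of the next block gives the bound.\<close>

lemma probe_bound:
  assumes x: "p a \<le> x" "x < en a" and w: "mini (p(a := x)) w"
    and j: "j \<in> act (p(a := x)) 0" "j \<noteq> w"
  shows "clcp (Q ((p(a := x)) w)) (Q ((p(a := x)) j)) < bcost t"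
proof -
  define t1 where "t1 = t + (h - p a)"
  define p' where "p' = p(a := x)"
  have tN: "t < N" using block_end_le h by simp
  have nbt: "nb t = t1" using nb_block[of t] h by (simp add: t1_def)
  have wmin: "\<And>j. j < k \<Longrightarrow> p' j < en j \<Longrightarrow> j \<noteq> w \<Longrightarrow> rel (p' w) (p' j)" and wk: "w < k" "p' w < en w"
    using w x a unfolding mini_upd_iff[OF v a x] p'_def by auto
  have j': "j < k" "p' j < en j" using j by (auto simp: p'_def)
  have pj: "(p(a := h)) i \<le> p' i" if "i \<noteq> a \<or> h \<le> x" for i using that by (auto simp: p'_def)
  show ?thesis unfolding p'_def[symmetric]
  proof (cases "w = a")
    case True
    have "inblock p a x" using w mini_upd_self[OF v a x] True by simp
    then have xh: "x < h" using inblock_down[OF v, of a x h] nblk x a h by force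
    have "j \<noteq> a" using j True by simp
    then obtain u where u: "t1 \<le> u" "u < N" "Z ! u = p' j" and srcj: "src (p' j) = j"
      using remaining_pos[OF valid_block, of j "p' j"] j' pj[of j] \<open>j \<noteq> a\<close> by (auto simp: t1_def)
    have "clcp (Q (Z ! (t + (x - p a)))) (Q (Z ! u)) < wt (nb (t + (x - p a)))"
    proof (rule clcp_bound)
      show "t + (x - p a) < u" using u xh x unfolding t1_def by linarith
      show "src (Z ! (t + (x - p a))) \<noteq> src (Z ! u)"
        using Z_block[OF x(1) xh] remaining_pos(2)[OF v a x] u srcj \<open>j \<noteq> a\<close> by simp
    qed (rule u)
    moreover have "nb (t + (x - p a)) = nb t"
      using nb_block[of "t + (x - p a)"] nbt x xh h unfolding t1_def by linarith
    ultimately show "clcp (Q (p' w)) (Q (p' j)) < bcost t"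
      using Z_block[OF x(1) xh] u True by (simp add: bcost_def p'_def)
  next
    case False
    have wp: "w \<in> act p 0" "p' w = p w" using wk False by (auto simp: p'_def)
    have "rel (p w) x" using wmin[of a] a x False by (auto simp: p'_def)
    then have "\<not> inblock p a x" using wp False rel_asym unfolding inblock_def by blast
    then have hx: "h \<le> x" using blk x by force
    then have hen: "h < en a" using x by simp
    obtain j0 where j0: "j0 \<in> act p 0" "j0 \<noteq> a" "rel (p j0) h" using block_beaten[OF hen] by blast
    have "j0 = w \<or> rel (p w) (p j0)" using wmin[of j0] j0 wp by (auto simp: p'_def)
    then have wh: "rel (p w) h" using j0 rel_trans by auto
    have wp': "rel (p w) (p j)" if "j < k" "p j < en j" "j \<noteq> w" "j \<noteq> a" for j
      using wmin[of j] wp that by (simp add: p'_def)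
    \<comment> \<open>Moving the head of \<open>a\<close> back from \<open>x\<close> to
      \<open>h\<close> keeps the winner, since it already precedes row \<open>h\<close>. This
      identifies it with the row right after the block.\<close>
    have "mini (p(a := h)) w"
      unfolding mini_upd_iff[OF v a less_imp_le[OF h(1)] hen]
      using wp wh wp' False by auto
    from mini_next[OF valid_block this]
    have t1: "t1 < N" "Z ! t1 = p w" using False by (auto simp: t1_def)
    obtain u where u: "t1 \<le> u" "u < N" "Z ! u = p' j" and srcj: "src (p' j) = j"
      using remaining_pos[OF valid_block, of j "p' j"] j' pj[of j] hx by (auto simp: t1_def)
    have srcw: "src (p w) = w" using remaining_pos(2)[OF v, of w "p w"] wp by simp
    have "clcp (Q (Z ! t1)) (Q (Z ! u)) < wt (nb t1)"
    proof (rule clcp_bound)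
      show "src (Z ! t1) \<noteq> src (Z ! u)" using t1 u srcj srcw j by simp
      then show "t1 < u" using u(1) by (cases "t1 = u") auto
    qed (rule u)
    then show "clcp (Q (p' w)) (Q (p' j)) < bcost t"
      using t1 u wp nbt by (simp add: bcost_def)
  qed
qed

end

end

section \<open>Run-length encoding and the merging loop\<close>

definition expand :: "('a \<times> nat) list \<Rightarrow> 'a list" where
  "expand rs = concat (map (\<lambda>(a, n). replicate n a) rs)"

lemma expand_simps [simp]: "expand [] = []" "expand ((a, n) # rs) = replicate n a @ expand rs"
  "expand (rs @ rs') = expand rs @ expand rs'"
  by (simp_all add: expand_def)

text \<open>Non-empty runs with distinct neighbouring characters determine the encoding. This
  replaces induction over \<open>rle\<close> when runs are appended at the end.\<close>

lemma rle_expand: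
  "distinct_adj (map fst rs) \<Longrightarrow> \<forall>r \<in> set rs. 0 < snd r \<Longrightarrow> rle (expand rs) = rs"
proof (induction rs)
  case (Cons r rs)
  obtain a n where r: "r = (a, Suc n)" using Cons.prems by (cases r; cases "snd r") auto
  have "takeWhile (\<lambda>y. y = a) (expand rs) = [] \<and> dropWhile (\<lambda>y. y = a) (expand rs) = expand rs"
  proof (cases rs)
    case (Cons r' rs')
    then obtain b n' where "r' = (b, Suc n')" using Cons.prems \<open>rs = r' # rs'\<close>
      by (cases r'; cases "snd r'") auto
    then show ?thesis using Cons.prems Cons r by (auto simp: distinct_adj_Cons)
  qed simp
  then have "takeWhile (\<lambda>y. y = a) (replicate n a @ expand rs) = replicate n a"
    "dropWhile (\<lambda>y. y = a) (replicate n a @ expand rs) = expand rs"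
    by (auto simp: takeWhile_append dropWhile_append)
  moreover have "rle (expand rs) = rs" using Cons by (auto simp: distinct_adj_Cons split: list.splits)
  ultimately show ?case by (simp add: r)
qed simp

lemma takeWhile_eq_replicate:
  "takeWhile (\<lambda>y. y = x) xs = replicate (length (takeWhile (\<lambda>y. y = x) xs)) x"
  by (induction xs) auto

lemma expand_rle: "expand (rle xs) = xs"
proof (induction xs rule: rle.induct)
  case (2 x xs)
  show ?case using 2 takeWhile_eq_replicate[of x xs]
    by (metis expand_simps(2) replicate_Suc append_Cons rle.simps(2) takeWhile_dropWhile_id)
qed simp

lemma rle_pos: "r \<in> set (rle xs) \<Longrightarrow> 0 < snd r"
  by (induction xs rule: rle.induct) auto

lemma distinct_adj_rle: "distinct_adj (map fst (rle xs))"
proof (induction xs rule: rle.induct)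
  case (2 x xs)
  show ?case
  proof (cases "dropWhile (\<lambda>y. y = x) xs")
    case (Cons y ys)
    then have "y \<noteq> x" using hd_dropWhile[of "\<lambda>y. y = x" xs] by auto
    then show ?thesis using 2 Cons by simp
  next
    case Nil
    then show ?thesis by (simp del: dropWhile_eq_Nil_conv)
  qed
qed simp

text \<open>The run still being extended; it can be output only once a different character follows.
  Length 0 stands for the state before the first character.\<close>

definition pend :: "'a \<Rightarrow> nat \<Rightarrow> ('a \<times> nat) list" where
  "pend a n = (if n = 0 then [] else [(a, n)])"

text \<open>Neighbouring pieces with equal characters, even from different blocks, have to end up in
  one run. The case \<open>n = 0\<close> occurs only at the start, where \<open>a\<close> is an
  arbitrary initial value and not the last character.\<close>

lemma rle_append:
  assumes rle: "rle X = rs @ pend a n" and n: "n = 0 \<longrightarrow> X = []" and n': "0 < n'"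
  shows "rle (X @ replicate n' a) = rs @ pend a (n + n')"
    and "b \<noteq> a \<Longrightarrow> rle (X @ replicate n' b) = (rs @ pend a n) @ pend b n'"
proof -
  have X: "X = expand rs @ expand (pend a n)" using expand_rle[of X] unfolding rle by simp
  have adj: "distinct_adj (map fst (rs @ pend a n))" and pos: "\<forall>r \<in> set (rs @ pend a n). 0 < snd r"
    using distinct_adj_rle[of X] rle_pos[of _ X] unfolding rle by auto
  have "n = 0 \<longrightarrow> rs = []" using n rle by auto
  then have adj': "distinct_adj (map fst (rs @ pend a (n + n')))"
    using adj n' by (cases "n = 0") (auto simp: pend_def)
  have "X @ replicate n' a = expand (rs @ pend a (n + n'))"
    unfolding X by (auto simp: pend_def replicate_add)
  moreover have "rle (expand (rs @ pend a (n + n'))) = rs @ pend a (n + n')"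
    using adj' pos by (intro rle_expand) (auto simp: pend_def n')
  ultimately show "rle (X @ replicate n' a) = rs @ pend a (n + n')" by simp
  assume b: "b \<noteq> a"
  have "X @ replicate n' b = expand ((rs @ pend a n) @ pend b n')"
    unfolding X using n' by (simp add: pend_def)
  moreover have "distinct_adj (map fst ((rs @ pend a n) @ pend b n'))"
    using adj b n' \<open>n = 0 \<longrightarrow> rs = []\<close> by (auto simp: pend_def distinct_adj_append_iff)
  then have "rle (expand ((rs @ pend a n) @ pend b n')) = (rs @ pend a n) @ pend b n'"
    using pos n' by (intro rle_expand) (auto simp: pend_def)
  ultimately show "rle (X @ replicate n' b) = (rs @ pend a n) @ pend b n'" by simp
qed

text \<open>Row \<open>f\<close> belongs to the block, while row \<open>g\<close> does not or is the
  end of the input. A probe overwrites the head of \<open>a\<close> with the middle row; the head is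
  restored at the end.\<close>

definition bsearch :: "nat \<Rightarrow> com" where
  "bsearch k =
     Assign ''f'' (Var ''b'');; Assign ''g'' (ld 13 (Var ''a''));;
     While (Bin Less (Const 1) (Bin Minus (Var ''g'') (Var ''f'')))
       (Assign ''m'' (Bin Div (Bin Plus (Var ''f'') (Var ''g'')) (Const 2));;
        st 12 (Var ''a'') (Var ''m'');; findmin k;;
        If (Bin Equal (Var ''w'') (Var ''a'')) (Assign ''f'' (Var ''m'')) (Assign ''g'' (Var ''m'')));;
     st 12 (Var ''a'') (Var ''b'')"

definition flush :: com where
  "flush = If (Var ''q'') (Output (Var ''o'');; Output (Var ''q'')) Skip"

definition append_run :: com where
  "append_run =
     If (Bin Equal (Var ''v'') (Var ''o''))
       (Assign ''q'' (Bin Plus (Var ''q'') (Bin Minus (Var ''z'') (Var ''b''))))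
       (flush;; Assign ''o'' (Var ''v'');; Assign ''q'' (Bin Minus (Var ''z'') (Var ''b'')));;
     Assign ''b'' (Var ''z'')"

text \<open>Copies a block run by run. A run cut by the end of the block stays current and is
  continued by the next block of the same input.\<close>

definition emit :: com where
  "emit =
     While (Bin Less (Var ''b'') (Var ''g''))
       (Assign ''e'' (ld 5 (Var ''a''));;
        Assign ''z'' (Bin Plus (ld 8 (Var ''e'')) (ld 7 (Var ''e'')));;
        Assign ''v'' (Bin Mod (ld 6 (Var ''e'')) (Var ''S''));;
        If (Bin Less (Var ''g'') (Var ''z'')) (Assign ''z'' (Var ''g''))
          (st 5 (Var ''a'') (Bin Plus (Var ''e'') (Const 1)));;
        append_run)"

definition merge_loop :: "nat \<Rightarrow> com" where
  "merge_loop k =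
     While (Bin Less (Var ''r'') (Var ''N''))
       (findmin k;; Assign ''a'' (Var ''w'');; Assign ''b'' (ld 12 (Var ''a''));; bsearch k;;
        Assign ''r'' (Bin Plus (Var ''r'') (Bin Minus (Var ''g'') (Var ''b'')));;
        st 12 (Var ''a'') (Var ''g'');; emit)"

lemma bsearch_frame [simp]:
  "asg (bsearch k) = {''f'', ''g'', ''m''} \<union> asg (findmin k)"
  "stcols (bsearch k) = {12} \<union> stcols (findmin k)" "noout (bsearch k)"
  by (auto simp: bsearch_def)

lemma append_run_frame [simp]: "asg append_run = {''q'', ''o'', ''b''}" "stcols append_run = {}"
  by (auto simp: append_run_def flush_def)

lemma emit_frame [simp]:
  "asg emit = {''e'', ''z'', ''v'', ''q'', ''o'', ''b''}" "stcols emit = {5}"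
  by (auto simp: emit_def)

section \<open>Correctness and cost of the search for block ends, the output and the merging
  loop\<close>

locale merge_runs = merge_sources +
  assumes Lst_Suc: "g < R \<Longrightarrow> Lst g + Len g < N \<Longrightarrow> Suc g < R \<and> Lst (Suc g) = Lst g + Len g"
begin

lemma tab_cong:
  assumes "tab s" "\<And>x. x \<in> {''S'', ''R'', ''N'', ''D''} \<Longrightarrow> reg s' x = reg s x"
    "\<And>j. j \<in> {6, 7, 8, 9, 11} \<Longrightarrow> col s' j = col s j"
  shows "tab s'"
  using assms by (simp add: tab_def)

lemma bsearch_correct:
  assumes tab: "tab s" and hd: "heads s p" and v: "valid p t" and mini: "mini p a"
    and ab: "reg s ''a'' = a" "reg s ''b'' = p a"
    and a: "a < k" and h: "p a < h" "h \<le> en a"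
    and blk: "\<And>x. p a \<le> x \<Longrightarrow> x < h \<Longrightarrow> inblock p a x"
    and nblk: "h < en a \<Longrightarrow> \<not> inblock p a h"
  shows "WP (bsearch k) s (\<lambda>T s'. T \<le> 60 + (FC * (bcost t + 1) + 60) * floorlog 2 N \<and>
    reg s' ''g'' = h \<and> heads s' p)"
proof -
  have probe: "clcp (Q ((p(a := x)) w)) (Q ((p(a := x)) j)) < bcost t"
    if "p a \<le> x" "x < en a" "mini (p(a := x)) w" "j \<in> act (p(a := x)) 0" "j \<noteq> w" for x w j
    using probe_bound[OF v a h, of x w j] blk nblk that by blast
  have enN: "en a \<le> N" using en_le a by simp
  let ?I = "\<lambda>s. tab s \<and> reg s ''a'' = a \<and> reg s ''b'' = p a \<and> p a \<le> reg s ''f'' \<and> reg s ''f'' < h \<and>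
    h \<le> reg s ''g'' \<and> reg s ''g'' \<le> en a \<and> (\<forall>i<k. col s 13 i = en i \<and> (i \<noteq> a \<longrightarrow> col s 12 i = p i) \<and> p i \<le> N)"
  have aW: "16 * a + 20 < W" "16 * a + 14 < 16 * R" "en a < W" using a k_le_R R_le_N W_lin enN by linarith+
  have hc: "col s 13 a = en a" using hd a by (simp add: heads_def)
  show ?thesis unfolding bsearch_def
    apply (insert ab hc aW h, simp del: One_nat_def, (erule thin_rl)+)
    subgoal
      apply (rule wp_While[where I = ?I and
            \<Phi> = "\<lambda>s. (FC * (bcost t + 1) + 60) * floorlog 2 (reg s ''g'' - reg s ''f'' - 1)"])
      subgoal using tab hd ab h a by (auto simp: heads_def tab_def)
      subgoal using aW enN W_lin by auto
      subgoal premises prems for s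
      proof -
        define f g where "f = reg s ''f''" and "g = reg s ''g''"
        define m where "m = (f + g) div 2"
        have I: "tab s" "reg s ''a'' = a" "reg s ''b'' = p a" "p a \<le> f" "f < h" "h \<le> g" "g \<le> en a"
          "\<And>i. i < k \<Longrightarrow> col s 13 i = en i \<and> (i \<noteq> a \<longrightarrow> col s 12 i = p i) \<and> p i \<le> N"
          using prems(1) by (auto simp: f_def g_def)
        have fg: "f < m" "m < g" using prems(2) by (auto simp: f_def g_def m_def split: if_splits)
        have fl: "floorlog 2 (m - f - 1) + 1 \<le> floorlog 2 (g - f - 1)"
          "floorlog 2 (g - m - 1) + 1 \<le> floorlog 2 (g - f - 1)"
          using fg by (intro floorlog_half; unfold m_def; linarith)+
        have pm: "p a \<le> m" "m < en a" using I fg by auto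
        have "a \<in> act (p(a := m)) 0" using pm a by simp
        then have ne: "act (p(a := m)) 0 \<noteq> {}" by blast
        obtain w where w: "mini (p(a := m)) w" using mini_exists[OF ne] by blast
        \<comment> \<open>Membership in the block is downward closed, so the winner of the probe
          tells on which side of the block end \<open>m\<close> lies.\<close>
        have wa: "w = a \<longleftrightarrow> m < h"
        proof -
          have "w = a \<longleftrightarrow> mini (p(a := m)) a" using w mini_unique by blast
          also have "\<dots> \<longleftrightarrow> inblock p a m" using mini_upd_self[OF v a pm] .
          also have "\<dots> \<longleftrightarrow> m < h"
            using blk[of m] pm nblk inblock_down[OF v, of a m h] h a by (meson le_less_trans less_imp_le not_le)
          finally show ?thesis .
        qed
        have mult: "(FC * (bcost t + 1) + 60) * x + (FC * (bcost t + 1) + 60) \<le>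
            (FC * (bcost t + 1) + 60) * y" if "x + 1 \<le> y" for x y
          using mult_le_mono2[OF that, of "FC * (bcost t + 1) + 60"] by (simp add: algebra_simps)
        have wk: "w < k" using w act_less unfolding mini_def by blast
        let ?s = "s\<lparr>reg := (reg s)(''m'' := m), mem := (mem s)(16 * a + 12 := m)\<rparr>"
        have tb: "tab ?s" using I(1) by (auto intro: tab_cong)
        have hd': "heads ?s (p(a := m))" using I pm a enN by (auto simp: heads_def)
        have fc: "WP (findmin k) ?s (\<lambda>t' s'. t' \<le> FC * (bcost t + 1) \<and> reg s' ''w'' = w)"
          by (rule findmin_correct[OF tb hd' ne w probe[OF pm w]])
        show ?thesis
          using I(2-7) aW enN fg W_lin pm
          apply (simp add: f_def[symmetric] g_def[symmetric] m_def[symmetric] del: One_nat_def)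
          apply (rule wp_call[OF fc])
          subgoal by simp
          subgoal premises q for t1 s1
          proof -
            have regs: "x \<notin> asg (findmin k) \<Longrightarrow> reg s1 x = reg ?s x" for x using q by blast
            have cols: "j < 16 \<Longrightarrow> j \<notin> {14, 3, 4} \<Longrightarrow> col s1 j = col ?s j" for j using q by (simp del: fun_upd_apply)
            have r: "reg s1 ''a'' = a" "reg s1 ''b'' = p a" "reg s1 ''f'' = f" "reg s1 ''g'' = g" "reg s1 ''m'' = m"
              using I regs by (simp_all add: f_def g_def)
            have tb1: "tab s1" by (rule tab_cong[OF tb]) (auto simp: regs cols)
            have c: "\<forall>i<k. col s1 13 i = en i \<and> (i \<noteq> a \<longrightarrow> col s1 12 i = p i) \<and> p i \<le> N"
              using I(8) by (simp add: cols)
            have t1: "t1 \<le> FC * (bcost t + 1)" and w1: "reg s1 ''w'' = w" using q by auto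
            show ?thesis
              using r tb1 c t1 w1 wa wk k_le_R R_le_N W_lin fg aW pm I mult[OF fl(1)] mult[OF fl(2)]
              by (simp add: tab_def del: One_nat_def)
          qed
          done
      qed
      subgoal premises prems for T s'
      proof -
        have I: "tab s'" "reg s' ''a'' = a" "reg s' ''b'' = p a"
          "reg s' ''f'' < h" "h \<le> reg s' ''g''" "reg s' ''g'' \<le> en a"
          "\<forall>i<k. col s' 13 i = en i \<and> (i \<noteq> a \<longrightarrow> col s' 12 i = p i) \<and> p i \<le> N"
          using prems(1) by auto
        have g: "reg s' ''g'' = h" using I prems(2) by (simp split: if_splits)
        have "floorlog 2 (en a - p a - 1) \<le> floorlog 2 N" using enN by (intro floorlog_mono) simp
        then have "(FC * (bcost t + 1) + 60) * floorlog 2 (en a - p a - 1) \<le> (FC * (bcost t + 1) + 60) * floorlog 2 N"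
          by simp
        moreover have "T \<le> (FC * (bcost t + 1) + 60) * floorlog 2 (en a - p a - 1) + 6"
          using prems(3) ab hc by simp
        ultimately have "T + 41 \<le> 60 + (FC * (bcost t + 1) + 60) * floorlog 2 N" by linarith
        then show ?thesis using I g aW ab h hd a
          by (auto simp: heads_def)
      qed
      done
    done
qed


text \<open>Column 5 holds the run that contains the head of each input. For an exhausted input this
  may be the first run of the following input; at position \<open>N\<close> only the bound by
  \<open>R\<close> is left.\<close>

definition runs :: "ram_state \<Rightarrow> (nat \<Rightarrow> nat) \<Rightarrow> bool" where
  "runs s p \<longleftrightarrow> (\<forall>i<k. col s 5 i \<le> R \<and> (p i < N \<longrightarrow> col s 5 i < R \<and>
     Lst (col s 5 i) \<le> p i \<and> p i < Lst (col s 5 i) + Len (col s 5 i)))"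

definition written :: "ram_state \<Rightarrow> nat list \<Rightarrow> bool" where
  "written s X \<longleftrightarrow> (\<exists>rs. outp s = encode_runs rs \<and> rle X = rs @ pend (reg s ''o'') (reg s ''q'')) \<and>
     (reg s ''q'' = 0 \<longrightarrow> X = []) \<and> reg s ''q'' \<le> length X \<and> reg s ''o'' < \<sigma>"

text \<open>Potential that pays for completed runs. It starts at no more than \<open>k * R\<close>,
  which is linear in \<open>R\<close> for constant \<open>k\<close>.\<close>

definition remruns :: "ram_state \<Rightarrow> nat" where
  "remruns s = (\<Sum>i<k. R - col s 5 i)"

lemma remruns_Suc:
  assumes "a < k" "col s 5 a < R" "col s' 5 = (col s 5)(a := Suc (col s 5 a))"
  shows "Suc (remruns s') = remruns s"
proof -
  have "remruns s = (R - col s 5 a) + (\<Sum>i \<in> {..<k} - {a}. R - col s 5 i)"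
    unfolding remruns_def using assms(1) by (simp add: sum.remove)
  moreover have "remruns s' = (R - Suc (col s 5 a)) + (\<Sum>i \<in> {..<k} - {a}. R - col s 5 i)"
    unfolding remruns_def using assms(1,3) by (simp add: sum.remove)
  ultimately show ?thesis using assms(2) by simp
qed

lemma sigma_less_W: "\<sigma> < W"
  using sigma_le W_lin by linarith

lemma C_less_sigma: "g < R \<Longrightarrow> K g mod \<sigma> < \<sigma>"
  using sigma_pos by simp

lemma encode_snoc: "encode_runs (rs @ [(a, n)]) = encode_runs rs @ [a, n]"
  by (simp add: encode_runs_def)

lemma flush_correct:
  assumes w: "written s X" and N: "length X \<le> N"
  shows "WP flush s (\<lambda>t s'. t \<le> 10 \<and> outp s' = encode_runs (rle X) \<and> reg s' = reg s \<and> mem s' = mem s)"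
proof -
  obtain rs where rs: "outp s = encode_runs rs" "rle X = rs @ pend (reg s ''o'') (reg s ''q'')"
    using w by (auto simp: written_def)
  have "reg s ''q'' < W" "reg s ''o'' < W" using w N W_lin sigma_less_W by (auto simp: written_def)
  then show ?thesis unfolding flush_def using rs by (simp add: pend_def encode_snoc)
qed

lemma append_run_correct:
  assumes wr: "written s X" and v: "reg s ''v'' = a" "a < \<sigma>" and z: "reg s ''z'' = b + n" "reg s ''b'' = b"
    and n: "0 < n" "length X + n \<le> N" "b + n \<le> N"
  shows "WP append_run s (\<lambda>t s'. t \<le> 40 \<and> reg s' ''b'' = b + n \<and> written s' (X @ replicate n a))"
proof -
  obtain rs where rs: "outp s = encode_runs rs" "rle X = rs @ pend (reg s ''o'') (reg s ''q'')"
    and q: "reg s ''q'' = 0 \<longrightarrow> X = []" "reg s ''q'' \<le> length X" "reg s ''o'' < \<sigma>"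
    using wr by (auto simp: written_def)
  have W: "a < W" "reg s ''o'' < W" "reg s ''q'' + n < W" "b + n < W" "b < W" "n < W" "reg s ''q'' < W"
    using q v sigma_less_W n W_lin by linarith+
  show ?thesis
  proof (cases "a = reg s ''o''")
    case True
    then show ?thesis unfolding append_run_def
      using v z W rs(1) q n rle_append(1)[OF rs(2) q(1) n(1)] by (auto simp: written_def)
  next
    case False
    have "encode_runs (rs @ pend (reg s ''o'') (reg s ''q'')) =
        (if reg s ''q'' = 0 then outp s else outp s @ [reg s ''o'', reg s ''q''])"
      using rs by (simp add: pend_def encode_snoc)
    then show ?thesis unfolding append_run_def flush_def
      using v z W rs(1) q n False rle_append(2)[OF rs(2) q(1) n(1) False] by (auto simp: written_def)
  qed
qed

text \<open>Every iteration completes a run of the input, which lowers \<open>remruns\<close>, or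
  reaches the end of the block, which happens once and is covered by the constant.\<close>

lemma emit_correct:
  assumes tab: "tab s" and rn: "runs s (p(a := b))" and ab: "reg s ''a'' = a" "reg s ''b'' = b" "reg s ''g'' = g"
    and a: "a < k" and g: "b \<le> g" "g \<le> N" and wr: "written s X" and len: "length X + (g - b) \<le> N"
  shows "WP emit s (\<lambda>t s'. t + 100 * remruns s' \<le> 150 + 100 * remruns s \<and> runs s' (p(a := g)) \<and>
    written s' (X @ map C [b..<g]))"
proof -
  let ?I = "\<lambda>s. tab s \<and> reg s ''a'' = a \<and> reg s ''g'' = g \<and> b \<le> reg s ''b'' \<and> reg s ''b'' \<le> g \<and>
    runs s (p(a := reg s ''b'')) \<and> written s (X @ map C [b..<reg s ''b''])"
  have aW: "16 * a + 20 < W" "16 * a + 14 < 16 * R" using a k_le_R R_le_N W_lin by linarith+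
  show ?thesis unfolding emit_def
    apply (rule wp_While[where I = ?I and \<Phi> = "\<lambda>s. 100 * remruns s + (if reg s ''b'' < g then 100 else 0)"])
    subgoal using tab rn ab g wr by simp
    subgoal using g W_lin by auto
    subgoal premises prems for s
    proof -
      define b' where "b' = reg s ''b''"
      define e where "e = col s 5 a"
      define z where "z = Lst e + Len e"
      define zz where "zz = min g z"
      define X' where "X' = X @ map C [b..<b']"
      have I: "tab s" "reg s ''a'' = a" "reg s ''g'' = g" "b \<le> b'" "b' < g" "runs s (p(a := b'))" "written s X'"
        using prems by (auto simp: b'_def X'_def split: if_splits)
      have e: "e < R" "Lst e \<le> b'" "b' < z"
        using I(6) a I(5) g by (auto simp: runs_def e_def z_def)
      have zz: "b' < zz" "zz \<le> g" "zz \<le> z" using I e by (auto simp: zz_def)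
      have C: "map C [b'..<zz] = replicate (zz - b') (K e mod \<sigma>)"
        using zz e by (auto intro!: nth_equalityI simp: C_eq[of e] z_def)
      have X: "X @ map C [b..<zz] = X' @ replicate (zz - b') (K e mod \<sigma>)"
        unfolding C[symmetric] X'_def using zz I(4)
        by (metis append.assoc map_append less_imp_le upt_add_eq_append le_add_diff_inverse)
      have lenX: "length X' + (zz - b') \<le> N" using len zz I(4) unfolding X'_def by simp
      have bds: "e \<le> N" "z \<le> N" "K e < k * \<sigma>" "K e mod \<sigma> < \<sigma>" "b' < W" "g < W" "\<sigma> < W"
        using e Lst_le[of e] K_less[of e] C_less_sigma R_le_N W_lin g I sigma_less_W by (auto simp: z_def)
      have cols: "col s 5 a = e" "col s 7 e = Len e" "col s 8 e = Lst e" "col s 6 e = K e" "reg s ''S'' = \<sigma>"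
        using I e by (auto simp: tab_def e_def)
      have rn: "runs s' (p(a := zz))" if "col s' 5 = (if g < z then col s 5 else (col s 5)(a := e + 1))" for s'
      proof (cases "g < z")
        case True
        then show ?thesis using I(5,6) e that a by (auto simp: runs_def zz_def z_def e_def)
      next
        case False
        have "z < N \<Longrightarrow> Suc e < R \<and> Lst (Suc e) = z \<and> 0 < Len (Suc e)"
          using Lst_Suc[OF e(1)] Len_pos[of "Suc e"] by (auto simp: z_def)
        then show ?thesis using I(6) e that a False by (auto simp: runs_def zz_def min_def)
      qed
      define s1 where "s1 = s\<lparr>reg := (reg s)(''e'' := e, ''z'' := zz, ''v'' := K e mod \<sigma>),
        mem := (if g < z then mem s else (mem s)(16 * a + 5 := e + 1))\<rparr>"
      have W': "16 * e + 14 < 16 * R" "16 * e + 20 < W" "Lst e < W" "Len e < W" "z < W"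
        using bds W_lin e R_le_N by (simp_all add: z_def)
      have ap: "WP append_run s1 (\<lambda>t s'. t \<le> 40 \<and> reg s' ''b'' = b' + (zz - b') \<and>
          written s' (X' @ replicate (zz - b') (K e mod \<sigma>)))"
      proof (rule append_run_correct)
        show "written s1 X'" using I(7) by (simp add: written_def s1_def)
      qed (use zz bds lenX g in \<open>simp_all add: s1_def b'_def\<close>)
      have pre: "WP append_run s1 (\<lambda>t s'. ?I s' \<and> t + 60 +
          (100 * remruns s' + (if reg s' ''b'' < g then 100 else 0)) \<le> 100 * remruns s + 100)"
      proof (rule wp_call[OF ap], goal_cases)
        case (2 t s')
        have regs: "x \<notin> {''q'', ''o'', ''b''} \<Longrightarrow> reg s' x = reg s1 x" for x using 2(2) by simp
        have cols: "j < 16 \<Longrightarrow> col s' j = (if j = 5 \<and> \<not> g < z then (col s 5)(a := e + 1) else col s j)" for j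
          using 2(3)[of j] by (auto simp: s1_def)
        have b'': "reg s' ''b'' = zz" using 2(1) zz by simp
        have "tab s'" by (rule tab_cong[OF I(1)]) (auto simp: regs cols s1_def)
        moreover have "runs s' (p(a := zz))" by (rule rn) (simp add: cols)
        moreover have "written s' (X @ map C [b..<zz])" using 2(1) X by simp
        moreover have "100 * remruns s' + (if zz < g then 100 else 0) \<le> 100 * remruns s"
        proof (cases "g < z")
          case True
          then show ?thesis by (simp add: remruns_def cols zz_def)
        next
          case False
          then have "Suc (remruns s') = remruns s"
            using a e by (intro remruns_Suc[of a]) (simp_all add: cols e_def)
          then show ?thesis by simp
        qed
        ultimately show ?case using b'' 2(1) zz I by (simp add: regs s1_def)
      qed simp
      show ?thesis
      proof (cases "g < z")
        case True
        then have s1: "s1 = s\<lparr>reg := (reg s)(''e'' := e, ''v'' := K e mod \<sigma>, ''z'' := g)\<rparr>"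
          by (simp add: s1_def zz_def fun_upd_twist[of "''v''" "''z''"])
        show ?thesis
          apply (insert I(2,3,5) cols bds W' aW True W_lin)
          apply (simp add: b'_def[symmetric] z_def[symmetric] del: One_nat_def)
          apply (rule wp_mono[OF pre[unfolded s1]])
          apply (auto split: if_splits)
          done
      next
        case False
        then have s1: "s1 = s\<lparr>reg := (reg s)(''e'' := e, ''z'' := z, ''v'' := K e mod \<sigma>),
            mem := (mem s)(16 * a + 5 := e + 1)\<rparr>"
          by (simp add: s1_def zz_def)
        show ?thesis
          apply (insert I(2,3,5) cols bds W' aW False W_lin)
          apply (simp add: b'_def[symmetric] z_def[symmetric] del: One_nat_def)
          apply (rule wp_mono[OF pre[unfolded s1]])
          apply (auto split: if_splits)
          done
      qed
    qed
    subgoal premises prems for T s'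
    proof -
      have "reg s' ''b'' = g" using prems(1,2) by (simp split: if_splits)
      then show ?thesis using prems(1,3) ab by (simp split: if_splits)
    qed
    done
qed


text \<open>Cost per unit of \<open>bcost\<close>. A block takes one comparison to find its input
  and at most \<open>floorlog 2 N\<close> to find its end, each costing at most
  \<open>FC * (bcost t + 1)\<close>; as \<open>bcost t\<close> is positive, the additive terms are
  absorbed.\<close>

definition PC :: nat where
  "PC = 2 * FC * (1 + floorlog 2 N) + 60 * floorlog 2 N + 500"

lemma PC_bound: "0 < c \<Longrightarrow>
  FC * (c + 1) + (60 + (FC * (c + 1) + 60) * floorlog 2 N) + 400 \<le> PC * c"
proof -
  assume c: "0 < c"
  then obtain c' where c': "c = Suc c'" by (cases c) auto
  have "FC * (c + 1) \<le> 2 * FC * c" unfolding c' by simp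
  then have "FC * (c + 1) * (1 + floorlog 2 N) \<le> 2 * FC * c * (1 + floorlog 2 N)" by (rule mult_le_mono1)
  moreover have "60 * floorlog 2 N + 500 \<le> (60 * floorlog 2 N + 500) * c" using c by simp
  moreover have "PC * c = 2 * FC * c * (1 + floorlog 2 N) + (60 * floorlog 2 N + 500) * c"
    unfolding PC_def by (simp add: algebra_simps)
  moreover have "FC * (c + 1) + (60 + (FC * (c + 1) + 60) * floorlog 2 N) + 400 =
      FC * (c + 1) * (1 + floorlog 2 N) + (60 * floorlog 2 N + 460)"
    by (simp add: algebra_simps)
  ultimately show ?thesis by linarith
qed

lemma block_end_exists:
  assumes v: "valid p t" and m: "mini p a"
  obtains h where "p a < h" "h \<le> en a" "\<And>x. p a \<le> x \<Longrightarrow> x < h \<Longrightarrow> inblock p a x"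
    "h < en a \<Longrightarrow> \<not> inblock p a h"
proof -
  have a: "a < k" "p a < en a" using m act_sub[of p 0] by (auto simp: mini_def)
  define h where "h = (LEAST x. p a \<le> x \<and> (x = en a \<or> \<not> inblock p a x))"
  have "p a \<le> en a \<and> (en a = en a \<or> \<not> inblock p a (en a))" using a by simp
  from LeastI[of "\<lambda>x. p a \<le> x \<and> (x = en a \<or> \<not> inblock p a x)", OF this]
    Least_le[of "\<lambda>x. p a \<le> x \<and> (x = en a \<or> \<not> inblock p a x)", OF this]
  have h: "p a \<le> h" "h = en a \<or> \<not> inblock p a h" "h \<le> en a" unfolding h_def by auto
  have less: "inblock p a x" if "p a \<le> x" "x < h" for x
    using not_less_Least[of x "\<lambda>x. p a \<le> x \<and> (x = en a \<or> \<not> inblock p a x)"] that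
    by (auto simp: h_def)
  have "inblock p a (p a)" using mini_upd_self[OF v a(1), of "p a"] a m by simp
  then have "p a \<noteq> h" using h a by auto
  then show ?thesis using that[of h] h less by auto
qed

text \<open>One iteration outputs one block. The position moves from \<open>t\<close> to
  \<open>nb t\<close>, which releases \<open>PC * bcost t\<close> of the potential, and
  \<open>remruns\<close> pays for the output.\<close>

lemma merge_loop_correct:
  assumes tab: "tab s" and hd: "heads s st" and rn: "runs s st" and r: "reg s ''r'' = 0"
    and wr: "written s []"
  shows "WP (merge_loop k) s (\<lambda>t s'. t \<le> PC * (pot 0 + pot (nb 0)) + 100 * (k * R) + 10 \<and>
    written s' (map C Z))"
proof -
  let ?I = "\<lambda>s. \<exists>p. tab s \<and> heads s p \<and> valid p (reg s ''r'') \<and> runs s p \<and>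
    written s (map C (take (reg s ''r'') Z))"
  show ?thesis unfolding merge_loop_def
    apply (rule wp_While[where I = ?I and
        \<Phi> = "\<lambda>s. PC * (pot (reg s ''r'') + pot (nb (reg s ''r''))) + 100 * remruns s"])
    subgoal using tab hd rn r wr valid_init by (intro exI[of _ st]) auto
    subgoal using W_lin by (auto simp: tab_def valid_def)
    subgoal premises prems for s
    proof -
      define t where "t = reg s ''r''"
      obtain p where tb: "tab s" and hd: "heads s p" and v: "valid p t" and rn: "runs s p"
        and wr: "written s (map C (take t Z))" using prems(1) by (auto simp: t_def)
      have tN: "t < N" using prems(2) tb by (simp add: t_def tab_def split: if_splits)
      have "src (Z ! t) \<in> act p 0"
        using src[OF Z_less[OF tN]] valid_remaining[OF v _ tN] by auto
      then have ne: "act p 0 \<noteq> {}" by blast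
      obtain a where m: "mini p a" using mini_exists[OF ne] by blast
      have a: "a < k" "p a < en a" using m act_sub[of p 0] by (auto simp: mini_def)
      obtain h where h: "p a < h" "h \<le> en a" "\<And>x. p a \<le> x \<Longrightarrow> x < h \<Longrightarrow> inblock p a x"
        "h < en a \<Longrightarrow> \<not> inblock p a h" using block_end_exists[OF v m] by blast
      have vb: "valid (p(a := h)) (t + (h - p a))" and tk: "take (t + (h - p a)) Z = take t Z @ [p a..<h]"
        using block[OF v a(1), of h] h by (auto simp del: fun_upd_apply)
      have t1N: "t + (h - p a) \<le> N" using vb by (simp add: valid_def)
      have nbt: "nb t = t + (h - p a)" using nb_block[OF v a(1) h, of t] h(1) by simp
      have fc: "WP (findmin k) s (\<lambda>T s'. T \<le> FC * (bcost t + 1) \<and> reg s' ''w'' = a)"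
        using probe_bound[OF v a(1) h order_refl a(2)] m
        by (intro findmin_correct[OF tb hd ne m]) simp
      have pot: "PC * (pot t + pot (nb t)) = PC * bcost t + PC * (pot (nb t) + pot (nb (nb t)))"
        using pot_bcost[OF tN] by (simp add: add_mult_distrib2)
      have aW: "a < W" "16 * a + 20 < W" "16 * a + 14 < 16 * R" "en a < W" "h < W" "p a < W" "h \<le> N"
        using a h k_le_R R_le_N W_lin en_le[OF a(1)] by linarith+
      have len: "length (take t Z) = t" using tN by simp
      show ?thesis
        apply (simp del: One_nat_def)
        apply (rule wp_call[OF fc])
        subgoal by simp
        subgoal premises q for T1 s1
        proof -
          have regs1: "x \<notin> asg (findmin k) \<Longrightarrow> reg s1 x = reg s x" for x using q by blast
          have cols1: "j < 16 \<Longrightarrow> j \<notin> {14, 3, 4} \<Longrightarrow> col s1 j = col s j" for j using q by simp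
          have out1: "outp s1 = outp s" using q by simp
          have T1: "T1 \<le> FC * (bcost t + 1)" and w1: "reg s1 ''w'' = a" using q by auto
          let ?s1 = "s1\<lparr>reg := (reg s1)(''a'' := a, ''b'' := p a)\<rparr>"
          have tb1: "tab ?s1" by (rule tab_cong[OF tb]) (auto simp: regs1 cols1)
          have hd1: "heads ?s1 p" using hd by (simp add: heads_def cols1)
          have c12: "col s1 12 a = p a" using hd a by (simp add: heads_def cols1)
          have bs: "WP (bsearch k) ?s1 (\<lambda>T s'. T \<le> 60 + (FC * (bcost t + 1) + 60) * floorlog 2 N \<and>
              reg s' ''g'' = h \<and> heads s' p)"
            by (rule bsearch_correct[OF tb1 hd1 v m _ _ a(1) h]) simp_all
          show ?thesis
            apply (insert w1 c12 aW)
            apply (simp del: One_nat_def)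
            apply (rule wp_call[OF bs])
            subgoal by simp
            subgoal premises r for T2 s2
            proof -
              have regs2: "x \<notin> {''f'', ''g'', ''m''} \<union> asg (findmin k) \<Longrightarrow> reg s2 x = reg ?s1 x" for x
                using r by (simp del: fun_upd_apply findmin_frame)
              have cols2: "j < 16 \<Longrightarrow> j \<notin> {12, 14, 3, 4} \<Longrightarrow> col s2 j = col s1 j" for j using r by simp
              have out2: "outp s2 = outp s" using r out1 by simp
              have T2: "T2 \<le> 60 + (FC * (bcost t + 1) + 60) * floorlog 2 N" and g2: "reg s2 ''g'' = h"
                and hd2: "heads s2 p" using r by auto
              have r2: "reg s2 ''a'' = a" "reg s2 ''b'' = p a" "reg s2 ''r'' = t" "reg s2 ''o'' = reg s ''o''"
                "reg s2 ''q'' = reg s ''q''"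
                using regs2 regs1 by (simp_all add: t_def)
              let ?s2 = "s2\<lparr>reg := (reg s2)(''r'' := t + (h - p a)), mem := (mem s2)(16 * a + 12 := h)\<rparr>"
              have tb2: "tab ?s2" by (rule tab_cong[OF tb]) (auto simp: regs1 regs2 cols1 cols2)
              have rn2: "runs ?s2 (p(a := p a))" using rn by (simp add: runs_def cols1 cols2)
              have wr2: "written ?s2 (map C (take t Z))" using wr r2 out2 by (simp add: written_def)
              have hd2': "heads ?s2 (p(a := h))" using hd2 aW en_le a by (auto simp: heads_def)
              have rem2: "remruns ?s2 = remruns s" by (simp add: remruns_def cols1 cols2)
              have em: "WP emit ?s2 (\<lambda>t s'. t + 100 * remruns s' \<le> 150 + 100 * remruns ?s2 \<and>
                  runs s' (p(a := h)) \<and> written s' (map C (take t' Z) @ map C [p a..<h]))" if "t' = t" for t'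
                unfolding that using r2 g2 a h aW t1N len
                by (intro emit_correct[OF tb2 rn2 _ _ _ _ _ _ wr2]) simp_all
              show ?thesis
                apply (insert r2 g2 aW W_lin t1N)
                apply (simp del: One_nat_def)
                apply (rule wp_call[OF em[OF refl]])
                subgoal by simp
                subgoal premises u for T3 s3
                proof -
                  have regs3: "x \<notin> asg emit \<Longrightarrow> reg s3 x = reg ?s2 x" for x using u by blast
                  have cols3: "j < 16 \<Longrightarrow> j \<noteq> 5 \<Longrightarrow> col s3 j = col ?s2 j" for j
                    using u by (simp del: fun_upd_apply colf_upd)
                  have T3: "T3 + 100 * remruns s3 \<le> 150 + 100 * remruns s"
                    and rn3: "runs s3 (p(a := h))"
                    and wr3: "written s3 (map C (take t Z) @ map C [p a..<h])"
                    using u rem2 by auto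
                  have r3: "reg s3 ''r'' = nb t" using regs3 nbt by simp
                  have tb3: "tab s3" by (rule tab_cong[OF tb2]) (auto simp: regs3 cols3)
                  have hd3: "heads s3 (p(a := h))" using hd2' by (simp add: heads_def cols3)
                  have wr3': "written s3 (map C (take (nb t) Z))" using wr3 by (simp add: nbt tk)
                  have vb': "valid (p(a := h)) (nb t)" using vb nbt by simp
                  have I: "\<exists>p. tab s3 \<and> heads s3 p \<and> valid p (nb t) \<and> runs s3 p \<and>
                      written s3 (map C (take (nb t) Z))"
                    using tb3 hd3 vb' rn3 wr3' by blast
                  show ?thesis
                    using I T1 T2 T3 PC_bound[OF bcost_pos, of t] r3 pot
                    by (simp add: t_def[symmetric])
                qed
                done
            qed
            done
        qed
        done
    qed
    subgoal premises prems for T s'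
    proof -
      obtain p where tb: "tab s'" and v: "valid p (reg s' ''r'')"
        and wr: "written s' (map C (take (reg s' ''r'') Z))" using prems(1) by auto
      have "reg s' ''r'' = N" using prems(2) tb v by (simp add: tab_def valid_def split: if_splits)
      moreover have "remruns s \<le> k * R" unfolding remruns_def
        using sum_mono[of "{..<k}" "\<lambda>i. R - col s 5 i" "\<lambda>_. R"] by simp
      ultimately show ?thesis using prems(3) wr r by simp
    qed
    done
qed

end

section \<open>Building the run table\<close>

text \<open>Runs of all inputs are numbered consecutively by \<open>''g''\<close>. If run
  \<open>g\<close> belongs to input \<open>i\<close>, its character is entry
  \<open>i + (2 * g + 2)\<close>: before it stand the alphabet size, \<open>i + 1\<close> run counts
  and \<open>g\<close> pairs.\<close>

definition parse :: "nat \<Rightarrow> com" where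
  "parse k =
     Assign ''S'' (Inp (Const 0));; Assign ''i'' (Const 0);; Assign ''g'' (Const 0);;
     Assign ''n'' (Const 0);;
     While (Bin Less (Var ''i'') (Const k))
       (st 12 (Var ''i'') (Var ''n'');; st 5 (Var ''i'') (Var ''g'');;
        Assign ''r'' (Bin Plus (Var ''g'') (Inp (Bin Plus (Var ''i'') (Bin Plus (Bin Times (Const 2) (Var ''g'')) (Const 1)))));;
        While (Bin Less (Var ''g'') (Var ''r''))
          (Assign ''c'' (Inp (Bin Plus (Var ''i'') (Bin Plus (Bin Times (Const 2) (Var ''g'')) (Const 2))));;
           Assign ''l'' (Inp (Bin Plus (Var ''i'') (Bin Plus (Bin Times (Const 2) (Var ''g'')) (Const 3))));;
           st 6 (Var ''g'') (Bin Plus (Bin Times (Var ''i'') (Var ''S'')) (Var ''c''));;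
           st 7 (Var ''g'') (Var ''l'');; st 8 (Var ''g'') (Var ''n'');; st 9 (Var ''g'') (Var ''g'');;
           Assign ''n'' (Bin Plus (Var ''n'') (Var ''l''));;
           Assign ''g'' (Bin Plus (Var ''g'') (Const 1)));;
        st 13 (Var ''i'') (Var ''n'');;
        Assign ''i'' (Bin Plus (Var ''i'') (Const 1)));;
     Assign ''R'' (Var ''g'');; Assign ''N'' (Var ''n'');;
     Assign ''D'' (Bin Times (Var ''n'') (Var ''n''))"

definition sel :: "nat \<Rightarrow> com" where
  "sel v =
     Assign ''g'' (Const 0);;
     While (Bin Less (Var ''g'') (Var ''R''))
       (Assign ''x'' (ld 9 (Var ''g''));;
        If (Bin Equal (Bin Mod (Bin Div (ld 6 (Var ''x'')) (Var ''u'')) (Const 2)) (Const v))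
          (st 10 (Var ''j'') (Var ''x'');; Assign ''j'' (Bin Plus (Var ''j'') (Const 1))) Skip;;
        Assign ''g'' (Bin Plus (Var ''g'') (Const 1)))"

definition copy_back :: com where
  "copy_back =
     Assign ''g'' (Const 0);;
     While (Bin Less (Var ''g'') (Var ''R''))
       (st 9 (Var ''g'') (ld 10 (Var ''g''));; Assign ''g'' (Bin Plus (Var ''g'') (Const 1)))"

text \<open>One stable pass per bit of the tagged character. Stability is essential: runs with the
  same tagged character have to keep their order in the inverse LF mapping.\<close>

definition radix_sort :: "nat \<Rightarrow> com" where
  "radix_sort k =
     Assign ''u'' (Const 1);;
     While (Bin Less (Var ''u'') (Bin Times (Const k) (Var ''S'')))
       (Assign ''j'' (Const 0);; sel 0;; sel 1;; copy_back;;
        Assign ''u'' (Bin Times (Const 2) (Var ''u'')))"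

definition prefix_sums :: com where
  "prefix_sums =
     Assign ''g'' (Const 0);; Assign ''n'' (Const 0);;
     While (Bin Less (Var ''g'') (Var ''R''))
       (st 11 (Var ''g'') (Var ''n'');;
        Assign ''n'' (Bin Plus (Var ''n'') (ld 7 (ld 9 (Var ''g''))));;
        Assign ''g'' (Bin Plus (Var ''g'') (Const 1)))"

lemma sort_frame [simp]:
  "asg (sel v) = {''g'', ''x'', ''j''}" "stcols (sel v) = {10}" "noout (sel v)"
  "asg copy_back = {''g''}" "stcols copy_back = {9}" "noout copy_back"
  "asg (radix_sort k) = {''u'', ''j'', ''g'', ''x''}" "stcols (radix_sort k) = {9, 10}"
  "noout (radix_sort k)"
  "asg prefix_sums = {''g'', ''n''}" "stcols prefix_sums = {11}" "noout prefix_sums"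
  by (auto simp: sel_def copy_back_def radix_sort_def prefix_sums_def)

lemma parse_frame [simp]: "noout (parse k)"
  by (simp add: parse_def)

section \<open>Binary radix passes as stable sorting\<close>

lemma sort_key_cong_set:
  fixes f g :: "'a \<Rightarrow> nat"
  assumes eq: "\<And>x. x \<in> set xs \<Longrightarrow> f x = g x"
  shows "sort_key f xs = sort_key g xs"
proof (rule properties_for_sort_key)
  have fg: "map f (sort_key g xs) = map g (sort_key g xs)" using eq by simp
  show "sorted (map f (sort_key g xs))" unfolding fg by simp
  fix k assume k: "k \<in> set (sort_key g xs)"
  have "filter (\<lambda>x. f k = f x) (sort_key g xs) = filter (\<lambda>x. g x = g k) (sort_key g xs)"
    using eq k by (intro filter_cong) auto
  also have "\<dots> = filter (\<lambda>x. f k = f x) xs"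
    unfolding sort_key_stable using eq k by (intro filter_cong) auto
  finally show "filter (\<lambda>x. f k = f x) (sort_key g xs) = filter (\<lambda>x. f k = f x) xs" .
qed simp

text \<open>The key modulo \<open>2 * b\<close> is \<open>b\<close> times the next bit plus the key
  modulo \<open>b\<close>. Splitting by that bit keeps the previous order within both halves, hence
  amounts to a stable sort by the longer key.\<close>

lemma sort_key_radix_pass:
  fixes f :: "'a \<Rightarrow> nat"
  assumes xs: "xs = sort_key (\<lambda>x. f x mod b) ys" and b: "0 < b"
  shows "filter (\<lambda>x. f x div b mod 2 = 0) xs @ filter (\<lambda>x. f x div b mod 2 = 1) xs =
    sort_key (\<lambda>x. f x mod (2 * b)) ys"
proof (rule properties_for_sort_key[symmetric])
  have split: "f x mod (2 * b) = b * (f x div b mod 2) + f x mod b" for x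
    by (metis mod_mult2_eq mult.commute)
  have par: "f x div b mod 2 = 0 \<or> f x div b mod 2 = 1" for x by arith
  have lt: "f x mod b < b" for x using b by simp
  show "mset (filter (\<lambda>x. f x div b mod 2 = 0) xs @ filter (\<lambda>x. f x div b mod 2 = 1) xs) = mset ys"
  proof -
    have "filter_mset (\<lambda>x. f x div b mod 2 = 1) (mset xs) = filter_mset (\<lambda>x. f x div b mod 2 \<noteq> 0) (mset xs)"
      using par by (intro filter_mset_cong) auto
    then show ?thesis by (simp add: xs flip: multiset_partition)
  qed
  have sx: "sorted (map (\<lambda>x. f x mod b) xs)" unfolding xs by simp
  have *: "sorted (map (\<lambda>x. f x mod (2 * b)) (filter (\<lambda>x. f x div b mod 2 = v) xs))" for v
  proof -
    have eq: "map (\<lambda>x. f x mod (2 * b)) (filter (\<lambda>x. f x div b mod 2 = v) xs) =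
        map (\<lambda>n. b * v + n) (map (\<lambda>x. f x mod b) (filter (\<lambda>x. f x div b mod 2 = v) xs))"
      by (auto simp: split)
    show ?thesis unfolding eq 
      using sorted_filter[OF sx, of "\<lambda>x. f x div b mod 2 = v"] by (simp add: sorted_map sorted_wrt_map)
  qed
  show "sorted (map (\<lambda>x. f x mod (2 * b)) (filter (\<lambda>x. f x div b mod 2 = 0) xs @ filter (\<lambda>x. f x div b mod 2 = 1) xs))"
    using *[of 0] *[of 1] by (auto simp: sorted_append split intro!: order.trans[OF less_imp_le[OF lt]])
  fix a assume "a \<in> set (filter (\<lambda>x. f x div b mod 2 = 0) xs @ filter (\<lambda>x. f x div b mod 2 = 1) xs)"
  have fxs: "filter (\<lambda>x. f a mod b = f x mod b) xs = filter (\<lambda>x. f a mod b = f x mod b) ys"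
    using sort_key_stable[of "\<lambda>x. f x mod b" "f a mod b" ys] unfolding xs by (simp add: eq_commute)
  have eq: "f a mod (2 * b) = f x mod (2 * b) \<longleftrightarrow>
      f a mod b = f x mod b \<and> f x div b mod 2 = f a div b mod 2" for x
  proof
    assume e: "f a mod (2 * b) = f x mod (2 * b)"
    have "f a mod (2 * b) div b = f a div b mod 2" "f x mod (2 * b) div b = f x div b mod 2"
      using b by (simp_all add: split)
    moreover have "f a mod (2 * b) mod b = f a mod b" "f x mod (2 * b) mod b = f x mod b"
      by (simp_all add: mod_mod_cancel)
    ultimately show "f a mod b = f x mod b \<and> f x div b mod 2 = f a div b mod 2" using e by metis
  qed (simp add: split)
  have "filter (\<lambda>x. f a mod (2 * b) = f x mod (2 * b))
      (filter (\<lambda>x. f x div b mod 2 = 0) xs @ filter (\<lambda>x. f x div b mod 2 = 1) xs) =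
    filter (\<lambda>x. f x div b mod 2 = f a div b mod 2) (filter (\<lambda>x. f a mod b = f x mod b) xs)"
    using par[of a] unfolding eq by (elim disjE) (simp_all cong: conj_cong add: conj_commute)
  also have "\<dots> = filter (\<lambda>x. f a mod (2 * b) = f x mod (2 * b)) ys"
    unfolding fxs eq by (simp add: conj_commute)
  finally show "filter (\<lambda>x. f a mod (2 * b) = f x mod (2 * b))
      (filter (\<lambda>x. f x div b mod 2 = 0) xs @ filter (\<lambda>x. f x div b mod 2 = 1) xs) =
    filter (\<lambda>x. f a mod (2 * b) = f x mod (2 * b)) ys" .
qed


section \<open>Correctness of parsing, sorting and prefix sums\<close>

locale run_table = ram_bounds W k \<sigma> N R for W k \<sigma> N R :: nat +
  fixes inp :: "nat list" and goff ch K Len :: "nat \<Rightarrow> nat"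
  assumes goff_0: "goff 0 = 0" and goff_k: "goff k = R" and goff_mono: "i < k \<Longrightarrow> goff i \<le> goff (Suc i)"
    and length_inp: "length inp = 1 + k + 2 * R"
    and inp_0: "inp ! 0 = \<sigma>"
    and inp_count: "i < k \<Longrightarrow> inp ! (i + (2 * goff i + 1)) = goff (Suc i) - goff i"
    and inp_run: "i < k \<Longrightarrow> goff i \<le> g \<Longrightarrow> g < goff (Suc i) \<Longrightarrow>
      inp ! (i + (2 * g + 2)) = ch g \<and> inp ! (i + (2 * g + 3)) = Len g \<and> K g = i * \<sigma> + ch g"
    and ch_less: "g < R \<Longrightarrow> ch g < \<sigma>"
    and Len_sum: "(\<Sum>g<R. Len g) = N"
begin

abbreviation "WP \<equiv> wp W (16 * R) inp"

definition Lst :: "nat \<Rightarrow> nat" where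
  "Lst g = (\<Sum>g'<g. Len g')"

lemma Lst_mono: "g \<le> g' \<Longrightarrow> Lst g \<le> Lst g'"
  unfolding Lst_def by (rule sum_mono2) auto

lemma Lst_simps: "Lst 0 = 0" "Lst (Suc g) = Lst g + Len g" "Lst R = N"
  by (simp_all add: Lst_def Len_sum)

lemma goff_le: "i \<le> k \<Longrightarrow> goff i \<le> R"
proof (induction i rule: inc_induct)
  case (step i) then show ?case using goff_mono[of i] by simp
qed (simp add: goff_k)

lemma Lst_le_N: "g \<le> R \<Longrightarrow> Lst g \<le> N"
  using Lst_mono[of g R] Lst_simps by simp

definition parsed :: "ram_state \<Rightarrow> bool" where
  "parsed s \<longleftrightarrow> reg s ''S'' = \<sigma> \<and> reg s ''R'' = R \<and> reg s ''N'' = N \<and> reg s ''D'' = N * N \<and>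
     (\<forall>g<R. col s 6 g = K g \<and> col s 7 g = Len g \<and> col s 8 g = Lst g) \<and>
     (\<forall>i<k. col s 12 i = Lst (goff i) \<and> col s 13 i = Lst (goff (Suc i)) \<and> col s 5 i = goff i)"

lemma parse_correct:
  "WP (parse k) s (\<lambda>t s'. t \<le> 50 + 100 * k + 100 * R \<and> parsed s' \<and> (\<forall>g<R. col s' 9 g = g))"
proof -
  let ?I = "\<lambda>s. reg s ''i'' \<le> k \<and> reg s ''g'' = goff (reg s ''i'') \<and> reg s ''n'' = Lst (reg s ''g'') \<and>
    reg s ''S'' = \<sigma> \<and>
    (\<forall>g<reg s ''g''. col s 6 g = K g \<and> col s 7 g = Len g \<and> col s 8 g = Lst g \<and> col s 9 g = g) \<and>
    (\<forall>i<reg s ''i''. col s 12 i = Lst (goff i) \<and> col s 13 i = Lst (goff (Suc i)) \<and> col s 5 i = goff i)"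
  have sW: "\<sigma> < W" "0 < W" "k < W" "Suc 0 < W" using sigma_pos k_pos W_lin k_le_R R_le_N mult_le_mono1[OF k_pos, of \<sigma>] by linarith+
  show ?thesis unfolding parse_def
    apply (insert sW inp_0 length_inp)
    apply (simp del: One_nat_def) apply ((erule thin_rl)+)
    apply (rule wp_While[where I = ?I and \<Phi> = "\<lambda>s. 100 * (k - reg s ''i'') + 100 * (R - reg s ''g'')"])
    subgoal by (simp add: goff_0 Lst_simps)
    subgoal using W_lin k_le_R R_le_N by auto
    subgoal premises prems for s
    proof -
      define i where "i = reg s ''i''"
      define g0 where "g0 = goff i"
      define r where "r = goff (Suc i)"
      have i: "i < k" "reg s ''i'' = i" "reg s ''g'' = g0" "reg s ''n'' = Lst g0" "reg s ''S'' = \<sigma>"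
        using prems by (auto simp: i_def g0_def split: if_splits)
      have I6: "\<forall>g<g0. col s 6 g = K g \<and> col s 7 g = Len g \<and> col s 8 g = Lst g \<and> col s 9 g = g"
        and I12: "\<forall>j<i. col s 12 j = Lst (goff j) \<and> col s 13 j = Lst (goff (Suc j)) \<and> col s 5 j = goff j"
        using prems(1) unfolding i(2,3) by blast+
      have gr: "g0 \<le> r" "r \<le> R" using goff_mono[OF i(1)] goff_le[of "Suc i"] i(1) by (simp_all add: g0_def r_def)
      have rd: "inp ! (i + (2 * g0 + 1)) = r - g0" using inp_count[OF i(1)] by (simp add: g0_def r_def)
      have LN: "Lst g0 \<le> N" using gr by (intro Lst_le_N) simp
      have aW: "16 * i + 20 < W" "16 * i + 14 < 16 * R" "g0 < W" "Lst g0 < W" "i + (2 * g0 + 1) < W"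
        "r - g0 < W" "r < W" "i + (2 * g0 + 1) < length inp"
        using i gr LN k_le_R R_le_N W_lin length_inp by linarith+
      let ?J = "\<lambda>s'. reg s' ''i'' = i \<and> reg s' ''r'' = r \<and> g0 \<le> reg s' ''g'' \<and> reg s' ''g'' \<le> r \<and>
        reg s' ''n'' = Lst (reg s' ''g'') \<and> reg s' ''S'' = \<sigma> \<and>
        (\<forall>g<reg s' ''g''. col s' 6 g = K g \<and> col s' 7 g = Len g \<and> col s' 8 g = Lst g \<and> col s' 9 g = g) \<and>
        (\<forall>j<Suc i. col s' 12 j = Lst (goff j) \<and> col s' 5 j = goff j) \<and>
        (\<forall>j<i. col s' 13 j = Lst (goff (Suc j)))"
      show ?thesis
        apply (insert i aW rd gr)
        apply (simp del: One_nat_def, (erule thin_rl)+)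
        apply (rule wp_While[where I = ?J and \<Phi> = "\<lambda>s. 80 * (r - reg s ''g'')"])
        subgoal using i gr I6 I12 by (simp add: less_Suc_eq g0_def)
        subgoal using aW gr R_le_N W_lin by auto
        subgoal premises p for s'
        proof -
          define g where "g = reg s' ''g''"
          have g: "g < r" "reg s' ''g'' = g" "reg s' ''i'' = i" "g0 \<le> g" "reg s' ''n'' = Lst g" "reg s' ''S'' = \<sigma>"
            "reg s' ''r'' = r"
            using p by (auto simp: g_def split: if_splits)
          have run: "inp ! (i + (2 * g + 2)) = ch g" "inp ! (i + (2 * g + 3)) = Len g" "K g = i * \<sigma> + ch g"
            using inp_run[of i g] i g by (auto simp: g0_def r_def)
          have L: "Lst (Suc g) \<le> N" "Lst g + Len g = Lst (Suc g)" using gr g Lst_le_N[of "Suc g"] Lst_simps by auto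
          have ks: "i * \<sigma> + \<sigma> \<le> k * \<sigma>" using mult_le_mono1[of "Suc i" k \<sigma>] i(1) by simp
          have bW: "i + (2 * g + 3) < W" "i + (2 * g + 3) < length inp" "16 * g + 20 < W" "16 * g + 14 < 16 * R"
            "ch g < W" "Len g < W" "i * \<sigma> + ch g < W" "Lst g < W" "Lst g + Len g < W" "i * \<sigma> < W" "r < W"
            using i g gr L ks ch_less[of g] k_le_R R_le_N W_lin length_inp by linarith+
          show ?thesis
            using p(1) g run bW L aW sW(1)
            by (auto simp: less_Suc_eq g_def[symmetric])
        qed
        subgoal premises p for t s'
        proof -
          have "reg s' ''g'' = r" using p(1,2) by (simp split: if_splits)
          then show ?thesis using p(1,3) i aW gr sW LN Lst_le_N[of r] W_lin k_le_R R_le_N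
            by (auto simp: less_Suc_eq g0_def r_def)
        qed
        done
    qed
    subgoal premises prems for t s'
    proof -
      have "reg s' ''i'' = k" using prems(1,2) by (simp split: if_splits)
      then show ?thesis using prems(1,3) goff_k Lst_simps W_lin W_sq R_le_N goff_0
        by (auto simp: parsed_def)
    qed
    done
qed


definition keyed :: "ram_state \<Rightarrow> bool" where
  "keyed s \<longleftrightarrow> reg s ''S'' = \<sigma> \<and> reg s ''R'' = R \<and>
     (\<forall>g<R. col s 6 g = K g \<and> col s 7 g = Len g)"

lemma K_less: "g < R \<Longrightarrow> K g < k * \<sigma>"
proof -
  assume g: "g < R"
  have "\<exists>i<k. goff i \<le> g \<and> g < goff (Suc i)"
  proof (rule ccontr)
    assume no: "\<not> (\<exists>i<k. goff i \<le> g \<and> g < goff (Suc i))"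
    have "goff i \<le> g" if "i \<le> k" for i
      using that no by (induction i) (auto simp: goff_0 not_less)
    then show False using goff_k g by fastforce
  qed
  then obtain i where i: "i < k" "goff i \<le> g" "g < goff (Suc i)" by blast
  have "i * \<sigma> + \<sigma> \<le> k * \<sigma>" using mult_le_mono1[of "Suc i" k \<sigma>] i(1) by simp
  then show ?thesis using inp_run[OF i] ch_less[OF g] by linarith
qed

lemma K_less_W: "g < R \<Longrightarrow> K g < W"
  using K_less[of g] W_lin by linarith

lemma sel_correct:
  assumes ks: "keyed s" and xs: "map (col s 9) [0..<R] = xs" "set xs \<subseteq> {..<R}"
    and ys: "map (col s 10) [0..<length ys] = ys" "reg s ''j'' = length ys"
    and u: "reg s ''u'' = b" "b < W" and v: "v < 2"
    and len: "length ys + length (filter (\<lambda>x. K x div b mod 2 = v) xs) \<le> R"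
  shows "WP (sel v) s (\<lambda>t s'. t \<le> 20 + 80 * R \<and>
    (let ys' = ys @ filter (\<lambda>x. K x div b mod 2 = v) xs in
      map (col s' 10) [0..<length ys'] = ys' \<and> reg s' ''j'' = length ys'))"
proof -
  let ?f = "\<lambda>g. filter (\<lambda>x. K x div b mod 2 = v) (take g xs)"
  let ?I = "\<lambda>s. keyed s \<and> map (col s 9) [0..<R] = xs \<and> reg s ''u'' = b \<and> reg s ''g'' \<le> R \<and>
    map (col s 10) [0..<reg s ''j''] = ys @ ?f (reg s ''g'')"
  have lxs: "length xs = R" using xs(1) by (metis length_map length_upt minus_nat.diff_0)
  show ?thesis unfolding sel_def
    apply (insert W_lin)
    apply (simp del: One_nat_def) apply ((erule thin_rl)+)
    apply (rule wp_While[where I = ?I and \<Phi> = "\<lambda>s. 80 * (R - reg s ''g'')"])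
    subgoal using ks xs ys u by (simp add: keyed_def)
    subgoal using W_lin R_le_N by (auto simp: keyed_def)
    subgoal premises p for s
    proof -
      define g where "g = reg s ''g''"
      define x where "x = xs ! g"
      define P where "P = (\<lambda>x. K x div b mod 2 = v)"
      have g: "g < R" "reg s ''R'' = R" using p by (auto simp: g_def keyed_def split: if_splits)
      have "map (col s 9) [0..<R] ! g = xs ! g" using p(1) by simp
      then have x9: "col s 9 g = x" using g(1) by (simp add: x_def)
      have "x \<in> set xs" using g(1) lxs by (simp add: x_def)
      then have x: "x < R" "col s 9 g = x" using xs(2) x9 by auto
      have Kx: "col s 6 x = K x" "K x < W" using p(1) x K_less_W by (auto simp: keyed_def)
      have tk: "take (Suc g) xs = take g xs @ [x]" using g lxs by (simp add: take_Suc_conv_app_nth x_def)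
      have phi: "80 * (R - g) = 80 + 80 * (R - Suc g)" using g(1) by simp
      have "map (col s 10) [0..<reg s ''j''] = ys @ ?f g" using p(1) by (simp add: g_def)
      from arg_cong[OF this, of length]
      have len_j: "reg s ''j'' = length ys + length (filter P (take g xs))" by (simp add: P_def)
      have j: "reg s ''j'' < R" if "P x"
      proof -
        have "length (filter P (take (Suc g) xs)) \<le> length (filter P xs)"
          by (metis append_take_drop_id filter_append le_add1 length_append)
        then show ?thesis using len_j len that unfolding tk P_def by simp
      qed
      have jR: "reg s ''j'' \<le> R"
      proof -
        have "length (filter P (take g xs)) \<le> length (filter P xs)"
          by (metis append_take_drop_id filter_append le_add1 length_append)
        then show ?thesis using len_j len unfolding P_def by simp
      qed
      have jW: "P x \<Longrightarrow> 16 * reg s ''j'' + 10 < 16 * R" "16 * reg s ''j'' + 10 < W" "reg s ''j'' + 1 < W"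
        "16 * g + 20 < W" "16 * g + 14 < 16 * R" "16 * x + 20 < W" "16 * x + 14 < 16 * R" "g + 1 < W"
        "P x \<Longrightarrow> reg s ''j'' < R"
        using j jR g x W_lin R_le_N by linarith+
      have dv: "K x div b < W" "K x div b mod 2 < W" "v < W" "2 < W"
        using Kx(2) W_lin v le_less_trans[OF div_le_dividend[of "K x" b] Kx(2)]
          le_less_trans[OF mod_less_eq_dividend[of "K x div b" 2]] by auto
      show ?thesis
      proof (cases "P x")
        case True
        then show ?thesis
          using p(1) g x Kx jW dv tk u(2) phi unfolding P_def
          by (simp add: g_def[symmetric] keyed_def)
      next
        case False
        then show ?thesis
          using p(1) g x Kx jW dv tk u(2) phi unfolding P_def
          by (simp add: g_def[symmetric] keyed_def)
      qed
    qed
    subgoal premises p for t s'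
    proof -
      have "reg s' ''g'' = R" using p(1,2) by (simp add: keyed_def split: if_splits)
      then have m: "map (col s' 10) [0..<reg s' ''j''] = ys @ ?f R"
        using p(1) by simp
      have "reg s' ''j'' = length (ys @ ?f R)" using arg_cong[OF m, of length] by simp
      then have "map (col s' 10) [0..<length (ys @ ?f R)] = ys @ ?f R" "reg s' ''j'' = length (ys @ ?f R)"
        using m by simp_all
      then show ?thesis using p(3) lxs by (simp add: Let_def)
    qed
    done
qed

lemma copy_back_correct:
  assumes R: "reg s ''R'' = R" and ys: "map (col s 10) [0..<R] = ys" "set ys \<subseteq> {..<R}"
  shows "WP copy_back s (\<lambda>t s'. t \<le> 20 + 40 * R \<and> map (col s' 9) [0..<R] = ys)"
proof -
  let ?I = "\<lambda>s. reg s ''R'' = R \<and> reg s ''g'' \<le> R \<and> map (col s 10) [0..<R] = ys \<and>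
    (\<forall>g<reg s ''g''. col s 9 g = ys ! g)"
  have lys: "length ys = R" using ys(1) by (metis length_map length_upt minus_nat.diff_0)
  show ?thesis unfolding copy_back_def
    apply (insert W_lin)
    apply (simp del: One_nat_def) apply ((erule thin_rl)+)
    apply (rule wp_While[where I = ?I and \<Phi> = "\<lambda>s. 40 * (R - reg s ''g'')"])
    subgoal using R ys by simp
    subgoal using W_lin R_le_N by auto
    subgoal premises p for s
    proof -
      define g where "g = reg s ''g''"
      have g: "g < R" using p by (auto simp: g_def split: if_splits)
      have "map (col s 10) [0..<R] ! g = ys ! g" using p(1) by simp
      then have x: "col s 10 g = ys ! g" using g by simp
      have "ys ! g \<in> set ys" using g lys by simp
      then have x: "ys ! g < R" "col s 10 g = ys ! g" using ys(2) x by auto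
      have W: "16 * g + 20 < W" "16 * g + 14 < 16 * R" "g + 1 < W" "ys ! g < W"
        using g x W_lin R_le_N by linarith+
      show ?thesis using p(1) g x W by (auto simp: g_def[symmetric] less_Suc_eq)
    qed
    subgoal premises p for t s'
    proof -
      have "reg s' ''g'' = R" using p(1,2) by (simp split: if_splits)
      then show ?thesis using p(1,3) lys by (auto intro!: nth_equalityI)
    qed
    done
qed

definition perm :: "nat list" where
  "perm = sort_key K [0..<R]"

definition Prm :: "nat \<Rightarrow> nat" where
  "Prm g = perm ! g"

lemma perm_simps [simp]: "length perm = R" "set perm = {..<R}"
  by (auto simp: perm_def)

text \<open>Column 9 is always the stable sorting permutation for the keys modulo
  \<open>''u''\<close>. Modulo 1 this is the identity, and from \<open>k * \<sigma>\<close> on the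
  modulus changes no key.\<close>

lemma radix_sort_correct:
  assumes ks: "keyed s" and 9: "\<forall>g<R. col s 9 g = g"
  shows "WP (radix_sort k) s (\<lambda>t s'. t \<le> 20 + (300 + 250 * R) * floorlog 2 (k * \<sigma>) \<and>
    (\<forall>g<R. col s' 9 g = Prm g))"
proof -
  define X where "X = (\<lambda>b. sort_key (\<lambda>g. K g mod b) [0..<R])"
  have X: "length (X b) = R" "set (X b) = {..<R}" for b by (auto simp: X_def)
  let ?I = "\<lambda>s. keyed s \<and> map (col s 9) [0..<R] = X (reg s ''u'') \<and> 0 < reg s ''u'' \<and>
    reg s ''u'' < 2 * (k * \<sigma>)"
  have ksp: "0 < k * \<sigma>" using k_pos sigma_pos by simp
  have kW: "k < W" "\<sigma> < W" using k_pos sigma_pos W_lin k_le_R R_le_N sigma_pos mult_le_mono1[OF k_pos, of \<sigma>] by linarith+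
  show ?thesis unfolding radix_sort_def
    apply (insert W_lin)
    apply (simp del: One_nat_def) apply ((erule thin_rl)+)
    apply (rule wp_While[where I = ?I and
        \<Phi> = "\<lambda>s. (300 + 250 * R) * (floorlog 2 (k * \<sigma>) + 1 - floorlog 2 (reg s ''u''))"])
    subgoal
    proof -
      have "X 1 = [0..<R]" unfolding X_def by (simp add: sort_key_const)
      moreover have "map (col s 9) [0..<R] = [0..<R]" using 9 by (auto intro!: nth_equalityI)
      moreover have "1 < 2 * (k * \<sigma>)" using ksp by linarith
      ultimately show ?thesis using ks by (simp add: keyed_def)
    qed
    subgoal using W_lin kW by (auto simp: keyed_def)
    subgoal premises p for s
    proof -
      define u where "u = reg s ''u''"
      have u: "0 < u" "u < k * \<sigma>" "keyed s" "map (col s 9) [0..<R] = X u"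
        using p by (auto simp: u_def keyed_def split: if_splits)
      define Y where "Y = (\<lambda>v. filter (\<lambda>x. K x div u mod 2 = v) (X u))"
      have Y: "Y 0 @ Y 1 = X (2 * u)"
        unfolding Y_def X_def by (rule sort_key_radix_pass[OF refl u(1)])
      have lenY: "length (Y 0) + length (Y 1) = R"
        using arg_cong[OF Y, of length] X(1) by simp
      have uW: "u < W" "2 * u < W" using u W_lin by linarith+
      have fl: "floorlog 2 (2 * u) = floorlog 2 u + 1" "floorlog 2 u \<le> floorlog 2 (k * \<sigma>)"
        using floorlog_power[of u 2 1] u floorlog_mono[of u "k * \<sigma>" 2] by (simp_all add: mult.commute)
      have phi: "(300 + 250 * R) * (floorlog 2 (k * \<sigma>) + 1 - floorlog 2 u) =
          (300 + 250 * R) + (300 + 250 * R) * (floorlog 2 (k * \<sigma>) + 1 - floorlog 2 (2 * u))"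
      proof -
        have "floorlog 2 (k * \<sigma>) + 1 - floorlog 2 u = Suc (floorlog 2 (k * \<sigma>) + 1 - floorlog 2 (2 * u))"
          using fl by simp
        then show ?thesis by simp
      qed
      have sel0: "WP (sel 0) (s\<lparr>reg := (reg s)(''j'' := 0)\<rparr>) (\<lambda>t s'. t \<le> 20 + 80 * R \<and>
          (let ys' = [] @ filter (\<lambda>x. K x div u mod 2 = 0) (X u) in
            map (col s' 10) [0..<length ys'] = ys' \<and> reg s' ''j'' = length ys'))"
        using u X lenY uW by (intro sel_correct) (auto simp: keyed_def u_def Y_def)
      show ?thesis
        apply (insert W_lin)
        apply (simp del: One_nat_def) apply ((erule thin_rl)+)
        apply (rule wp_call[OF sel0])
        subgoal by simp
        subgoal premises q for t1 s1
        proof -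
          have r1: "x \<notin> {''g'', ''x'', ''j''} \<Longrightarrow> reg s1 x = reg s x" for x using q(2)[of x] by simp
          have c1: "j < 16 \<Longrightarrow> j \<noteq> 10 \<Longrightarrow> col s1 j = col s j" for j using q(3)[of j] by simp
          have y1: "t1 \<le> 20 + 80 * R" "map (col s1 10) [0..<length (Y 0)] = Y 0" "reg s1 ''j'' = length (Y 0)"
            using q(1) by (simp_all add: Y_def Let_def)
          have k1: "keyed s1" using u(3) by (simp add: keyed_def r1 c1)
          have "WP (sel 1) s1 (\<lambda>t s'. t \<le> 20 + 80 * R \<and>
            (let ys' = Y 0 @ filter (\<lambda>x. K x div u mod 2 = 1) (X u) in
              map (col s' 10) [0..<length ys'] = ys' \<and> reg s' ''j'' = length ys'))"
            using k1 y1 u X lenY uW by (intro sel_correct) (auto simp: u_def Y_def r1 c1)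
          then have sel1: "WP (sel 1) s1 (\<lambda>t s'. t \<le> 20 + 80 * R \<and> map (col s' 10) [0..<R] = X (2 * u))"
            by (rule wp_mono) (use Y lenY in \<open>simp add: Y_def Let_def\<close>)
          show ?thesis
            apply (rule wp_call[OF sel1])
            subgoal by simp
            subgoal premises r for t2 s2
            proof -
              have r2: "x \<notin> {''g'', ''x'', ''j''} \<Longrightarrow> reg s2 x = reg s x" for x using r(2)[of x] r1 by simp
              have c2: "j < 16 \<Longrightarrow> j \<noteq> 10 \<Longrightarrow> col s2 j = col s j" for j using r(3)[of j] c1 by simp
              have cb: "WP copy_back s2 (\<lambda>t s'. t \<le> 20 + 40 * R \<and> map (col s' 9) [0..<R] = X (2 * u))"
                using u(3) r(1) X by (intro copy_back_correct) (auto simp: keyed_def r2)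
              show ?thesis
                apply (rule wp_call[OF cb])
                subgoal by simp
                subgoal premises w for t3 s3
                proof -
                  have r3: "x \<notin> {''g'', ''x'', ''j''} \<Longrightarrow> reg s3 x = reg s x" for x using w(2)[of x] r2 by simp
                  have c3: "j < 16 \<Longrightarrow> j \<notin> {9, 10} \<Longrightarrow> col s3 j = col s j" for j using w(3)[of j] c2 by simp
                  show ?thesis using u w(1) r(1) y1(1) phi uW W_lin
                    by (simp add: r3 c3 keyed_def u_def[symmetric])
                qed
                done
            qed
            done
        qed
        done
    qed
    subgoal premises p for t s'
    proof -
      have u: "k * \<sigma> \<le> reg s' ''u''" using p(1,2) by (simp add: keyed_def split: if_splits)
      have "X (reg s' ''u'') = perm"
      proof -
        have "K g mod reg s' ''u'' = K g" if "g < R" for g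
          using K_less[OF that] u by simp
        then show ?thesis unfolding X_def perm_def by (intro sort_key_cong_set) simp
      qed
      then have "map (col s' 9) [0..<R] = perm" using p(1) by simp
      then have "col s' 9 g = Prm g" if "g < R" for g
        using that by (metis Prm_def add_0 length_upt minus_nat.diff_0 nth_map nth_upt)
      moreover have "floorlog 2 (Suc 0) = 1" by (simp add: floorlog_def)
      ultimately show ?thesis using p(3) by simp
    qed
    done
qed

definition FS :: "nat \<Rightarrow> nat" where
  "FS g = (\<Sum>g'<g. Len (Prm g'))"

lemma Prm_less: "g < R \<Longrightarrow> Prm g < R"
  using nth_mem[of g perm] by (simp add: Prm_def)

lemma FS_simps: "FS 0 = 0" "FS (Suc g) = FS g + Len (Prm g)" "FS R = N"
proof -
  have "FS R = sum_list (map Len perm)"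
    by (simp add: FS_def Prm_def sum_list_sum_nth atLeast0LessThan)
  also have "\<dots> = sum_list (map Len [0..<R])"
    by (metis mset_map mset_sort perm_def sum_mset_sum_list)
  also have "\<dots> = N" using Len_sum by (simp add: interv_sum_list_conv_sum_set_nat atLeast0LessThan)
  finally show "FS R = N" .
qed (simp_all add: FS_def)

lemma FS_le_N: "g \<le> R \<Longrightarrow> FS g \<le> N"
proof (induction g rule: inc_induct)
  case (step g) then show ?case using FS_simps(2)[of g] by simp
qed (simp add: FS_simps)

lemma prefix_sums_correct:
  assumes ks: "keyed s" and 9: "\<forall>g<R. col s 9 g = Prm g"
  shows "WP prefix_sums s (\<lambda>t s'. t \<le> 20 + 40 * R \<and> (\<forall>g<R. col s' 11 g = FS g))"
proof -
  let ?I = "\<lambda>s. keyed s \<and> (\<forall>g<R. col s 9 g = Prm g) \<and> reg s ''g'' \<le> R \<and> reg s ''n'' = FS (reg s ''g'') \<and>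
    (\<forall>g<reg s ''g''. col s 11 g = FS g)"
  show ?thesis unfolding prefix_sums_def
    apply (insert W_lin)
    apply (simp del: One_nat_def) apply ((erule thin_rl)+)
    apply (rule wp_While[where I = ?I and \<Phi> = "\<lambda>s. 40 * (R - reg s ''g'')"])
    subgoal using ks 9 by (simp add: FS_simps keyed_def)
    subgoal using W_lin R_le_N by (auto simp: keyed_def)
    subgoal premises p for s
    proof -
      define g where "g = reg s ''g''"
      have g: "g < R" using p by (auto simp: g_def keyed_def split: if_splits)
      have x: "Prm g < R" "col s 9 g = Prm g" "col s 7 (Prm g) = Len (Prm g)"
        using p(1) g Prm_less[OF g] by (auto simp: keyed_def)
      have W: "16 * g + 20 < W" "16 * g + 14 < 16 * R" "g + 1 < W"
        "16 * Prm g + 20 < W" "16 * Prm g + 14 < 16 * R" "FS g + Len (Prm g) < W"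
        using g x FS_le_N[of "Suc g"] FS_simps(2)[of g] W_lin R_le_N by linarith+
      show ?thesis using p(1) g x W
        by (auto simp: g_def[symmetric] less_Suc_eq keyed_def FS_simps)
    qed
    subgoal premises p for t s'
    proof -
      have "reg s' ''g'' = R" using p(1,2) by (simp add: keyed_def split: if_splits)
      then show ?thesis using p(1,3) by auto
    qed
    done
qed

end

section \<open>Positions in concatenations, stable sorting and sorted lists of contexts\<close>

definition offs :: "(nat \<Rightarrow> 'a list) \<Rightarrow> nat \<Rightarrow> nat" where
  "offs f i = (\<Sum>j<i. length (f j))"

lemma offs_simps [simp]: "offs f 0 = 0" "offs f (Suc i) = offs f i + length (f i)"
  by (simp_all add: offs_def)

lemma offs_mono: "i \<le> j \<Longrightarrow> offs f i \<le> offs f j"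
  unfolding offs_def by (rule sum_mono2) auto

lemma length_concat_upt: "length (concat (map f [0..<k])) = offs f k"
  by (induction k) auto

lemma nth_concat_upt:
  "i < k \<Longrightarrow> r < length (f i) \<Longrightarrow> concat (map f [0..<k]) ! (offs f i + r) = f i ! r"
proof (induction k)
  case (Suc k)
  show ?case
  proof (cases "i = k")
    case True
    then show ?thesis using Suc.prems by (simp add: nth_append length_concat_upt)
  next
    case False
    then have "offs f (Suc i) \<le> offs f k" using Suc.prems by (intro offs_mono) simp
    then have "offs f i + r < length (concat (map f [0..<k]))"
      using Suc.prems unfolding length_concat_upt by simp
    then show ?thesis using Suc False by (simp add: nth_append)
  qed
qed simp

lemma offs_locate:
  assumes "y < offs f k"
  obtains i r where "i < k" "r < length (f i)" "y = offs f i + r"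
proof -
  define i where "i = (LEAST i. y < offs f (Suc i))"
  obtain k' where "k = Suc k'" using assms by (cases k) auto
  then have ex: "y < offs f (Suc k')" using assms by simp
  have i: "y < offs f (Suc i)" unfolding i_def by (rule LeastI[of _ k']) (rule ex)
  have "i \<le> k'" unfolding i_def by (rule Least_le) (rule ex)
  moreover have "offs f i \<le> y"
  proof (cases i)
    case (Suc j)
    have "\<not> y < offs f (Suc j)"
      by (rule not_less_Least) (simp add: i_def[symmetric] Suc del: offs_simps)
    then show ?thesis using Suc by simp
  qed simp
  ultimately show ?thesis using i \<open>k = Suc k'\<close> that[of i "y - offs f i"] by simp
qed

lemma concat_map_nth: "concat xss = concat (map ((!) xss) [0..<length xss])"
  by (simp add: map_nth)

text \<open>The reason why a table of \<open>R\<close> runs suffices: if the key is constant on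
  every piece, a stable sort of all elements merely rearranges the pieces, and does so like a stable
  sort of the pieces.\<close>

lemma sort_key_concat:
  fixes f :: "'a \<Rightarrow> nat" and K :: "'b \<Rightarrow> nat"
  assumes "\<And>g y. g \<in> set gs \<Longrightarrow> y \<in> set (h g) \<Longrightarrow> f y = K g"
  shows "sort_key f (concat (map h gs)) = concat (map h (sort_key K gs))"
proof (rule properties_for_sort_key)
  have "mset (concat (map h (sort_key K gs))) = sum_mset (image_mset (\<lambda>g. mset (h g)) (mset (sort_key K gs)))"
    by (simp add: mset_concat flip: sum_mset_sum_list mset_map) (simp add: comp_def)
  also have "\<dots> = mset (concat (map h gs))"
    by (simp add: mset_concat flip: sum_mset_sum_list mset_map) (simp add: comp_def)
  finally show "mset (concat (map h (sort_key K gs))) = mset (concat (map h gs))" .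
  have flt: "filter (\<lambda>x. v = f x) (concat (map h gs')) = concat (map h (filter (\<lambda>g. K g = v) gs'))"
    if "set gs' \<subseteq> set gs" for v gs'
    using that
  proof (induction gs')
    case (Cons g gs')
    have "filter (\<lambda>x. v = f x) (h g) = (if K g = v then h g else [])"
      using assms[of g] Cons.prems by (auto simp: filter_empty_conv filter_id_conv)
    then show ?case using Cons by simp
  qed simp
  show "filter (\<lambda>x. f k = f x) (concat (map h (sort_key K gs))) = filter (\<lambda>x. f k = f x) (concat (map h gs))" for k
    by (simp add: flt sort_key_stable)
  have "sorted (map f (concat (map h gs')))" if "sorted (map K gs')" "set gs' \<subseteq> set gs" for gs'
    using that
  proof (induction gs')
    case (Cons g gs')
    have eq: "y \<in> set (h g') \<Longrightarrow> f y = K g'" if "g' \<in> set (g # gs')" for g' y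
      using assms[of g' y] that Cons.prems by auto
    have "map f (h g) = replicate (length (h g)) (K g)"
      using eq[of g] by (intro replicate_eqI) auto
    then have "sorted (map f (h g))" by simp
    then show ?case using Cons eq by (fastforce simp: sorted_append)
  qed simp
  then show "sorted (map f (concat (map h (sort_key K gs))))" by simp
qed

lemma sorted_wrt_insort_key:
  fixes f :: "'a :: linorder \<Rightarrow> nat"
  shows "sorted_wrt (\<lambda>a b. f a < f b \<or> f a = f b \<and> a < b) ys \<Longrightarrow> (\<And>y. y \<in> set ys \<Longrightarrow> x < y) \<Longrightarrow>
    sorted_wrt (\<lambda>a b. f a < f b \<or> f a = f b \<and> a < b) (insort_key f x ys)"
  by (induction ys) (auto simp: set_insort_key)

lemma sorted_wrt_sort_key:
  fixes f :: "'a :: linorder \<Rightarrow> nat"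
  shows "sorted_wrt (<) xs \<Longrightarrow> sorted_wrt (\<lambda>a b. f a < f b \<or> f a = f b \<and> a < b) (sort_key f xs)"
  by (induction xs) (auto intro!: sorted_wrt_insort_key)

text \<open>Serves to compare two orders through their lists of contexts, which are insensitive to
  permutations of occurrences with equal contexts.\<close>

lemma sorted_wrt_unique:
  assumes antisym: "\<And>x y. le x y \<Longrightarrow> le y x \<Longrightarrow> x = y"
  shows "sorted_wrt le xs \<Longrightarrow> sorted_wrt le ys \<Longrightarrow> mset xs = mset ys \<Longrightarrow> xs = ys"
proof (induction xs arbitrary: ys)
  case (Cons x xs)
  obtain y ys' where ys: "ys = y # ys'" using Cons.prems by (cases ys) auto
  have "set (x # xs) = set (y # ys')" using Cons.prems(3) ys mset_eq_setD by metis
  then have "x = y \<or> le y x" "x = y \<or> le x y" using Cons.prems ys by auto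
  then have "x = y" using antisym by blast
  then show ?case using Cons ys by simp
qed simp

lemma not_less_fun_antisym: "\<not> less_fun g f \<Longrightarrow> \<not> less_fun f g \<Longrightarrow> f = g" for f g :: "nat \<Rightarrow> nat"
  using less_fun_total by blast

section \<open>The tagged transform and its inverse LF mapping\<close>

text \<open>The occurrence one step back in its circular string. The length is added before 1 is
  subtracted, so that truncated subtraction does no harm at position 0.\<close>

definition pred_occ :: "collection \<Rightarrow> nat \<times> nat \<Rightarrow> nat \<times> nat" where
  "pred_occ M x = (fst x, (snd x + length (M ! fst x) - 1) mod length (M ! fst x))"

lemma finite_occs [simp]: "finite (occs M)"
proof (rule finite_subset)
  show "occs M \<subseteq> (SIGMA q:{..<length M}. {..<length (M ! q)})" by (auto simp: occs_def)
qed auto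

lemma card_occs: "card (occs M) = total_length M"
proof -
  have "occs M = (SIGMA q:{..<length M}. {..<length (M ! q)})" by (auto simp: occs_def)
  then have "card (occs M) = (\<Sum>q<length M. length (M ! q))" by simp
  also have "\<dots> = total_length M"
    by (simp add: total_length_def sum_list_sum_nth atLeast0LessThan)
  finally show ?thesis .
qed

lemma ctx_pred:
  assumes "x \<in> occs M"
  shows "ctx M (pred_occ M x) = case_nat (char_at M x) (ctx M x)"
proof
  fix j
  obtain q p where x: "x = (q, p)" by (cases x)
  define n where "n = length (M ! q)"
  have p: "p < n" using assms by (simp add: x occs_def n_def)
  have "((p + n - 1) mod n + 1 + j) mod n = (p + n - 1 + 1 + j) mod n"
    unfolding add.assoc[of _ 1 j] by (rule mod_add_left_eq)
  also have "p + n - 1 + 1 + j = p + j + n" using p by simp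
  also have "(p + j + n) mod n = (p + j) mod n" by simp
  finally have "ctx M (pred_occ M x) j = M ! q ! ((p + j) mod n)"
    by (simp add: ctx_def pred_occ_def x n_def)
  also have "\<dots> = case_nat (char_at M x) (ctx M x) j"
    using p by (cases j) (simp_all add: ctx_def char_at_def x n_def)
  finally show "ctx M (pred_occ M x) j = case_nat (char_at M x) (ctx M x) j" .
qed

lemma pred_occ_in: "x \<in> occs M \<Longrightarrow> pred_occ M x \<in> occs M"
  by (auto simp: occs_def pred_occ_def intro!: mod_less_divisor)

lemma inj_pred_occ: "inj_on (pred_occ M) (occs M)"
proof (rule inj_onI)
  fix x y assume x: "x \<in> occs M" and y: "y \<in> occs M" and eq: "pred_occ M x = pred_occ M y"
  define n where "n = length (M ! fst x)"
  have f: "fst x = fst y" using eq by (simp add: pred_occ_def)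
  have lt: "snd x < n" "snd y < n" using x y f by (auto simp: occs_def n_def)
  have "(snd x + n - 1) mod n = (snd y + n - 1) mod n"
    using eq f by (simp add: pred_occ_def n_def)
  then have "(snd x + n - 1 + 1) mod n = (snd y + n - 1 + 1) mod n" by (rule mod_add_cong) simp
  then have "snd x = snd y" using lt by simp
  then show "x = y" using f by (simp add: prod_eq_iff)
qed

lemma image_pred_occ: "pred_occ M ` occs M = occs M"
  using inj_pred_occ pred_occ_in by (intro card_subset_eq) (auto simp: card_image)

text \<open>After a whole number of turns the context comes back to the character itself. With the
  length of another string as \<open>m\<close>, the same index works for both strings.\<close>

lemma char_at_eq_ctx: "x \<in> occs M \<Longrightarrow> 0 < m \<Longrightarrow> char_at M x = ctx M x (length (M ! fst x) * m - 1)"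
proof -
  assume x: "x \<in> occs M" and m: "0 < m"
  define n where "n = length (M ! fst x)"
  have p: "snd x < n" using x by (auto simp: occs_def n_def)
  then have eq: "snd x + 1 + (n * m - 1) = snd x + n * m" using m by simp
  have "(snd x + 1 + (n * m - 1)) mod n = snd x" unfolding eq using p by simp
  then show ?thesis by (simp add: char_at_def ctx_def n_def)
qed

lemma char_at_cong: "x \<in> occs M \<Longrightarrow> y \<in> occs M \<Longrightarrow> ctx M x = ctx M y \<Longrightarrow> char_at M x = char_at M y"
  using char_at_eq_ctx[of x M "length (M ! fst y)"] char_at_eq_ctx[of y M "length (M ! fst x)"]
  by (force simp: occs_def mult.commute)

lemma length_le_total: "x \<in> occs M \<Longrightarrow> length (M ! fst x) \<le> total_length M"
  unfolding total_length_def by (rule member_le_sum_list) (auto simp: occs_def)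

text \<open>The product of the two string lengths is a common period of both contexts and at most
  the square of the total length; this is where the cutoff comes from.\<close>

lemma ctx_agree:
  assumes x: "x \<in> occs M" and y: "y \<in> occs M"
    and eq: "\<And>j. j < total_length M * total_length M \<Longrightarrow> ctx M x j = ctx M y j"
  shows "ctx M x = ctx M y"
proof
  fix j
  define a b where "a = length (M ! fst x)" and "b = length (M ! fst y)"
  have ab: "0 < a" "0 < b" using x y by (auto simp: a_def b_def occs_def)
  have per: "ctx M z (j mod (length (M ! fst z) * m)) = ctx M z j" for z m
    unfolding ctx_def by (metis (no_types, lifting) mod_add_right_eq mod_mod_cancel dvd_triv_left)
  have "a * b \<le> total_length M * total_length M"
    using length_le_total[OF x] length_le_total[OF y] by (auto simp: a_def b_def intro: mult_le_mono)
  moreover have "j mod (a * b) < a * b" using ab by simp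
  ultimately have "ctx M x (j mod (a * b)) = ctx M y (j mod (a * b))" by (intro eq) simp
  then show "ctx M x j = ctx M y j"
    using per[of x b] per[of y a] by (simp add: a_def b_def mult.commute)
qed

lemma encode_runs_simps: "encode_runs [] = []" "encode_runs ((a, n) # rs) = a # n # encode_runs rs"
  by (simp_all add: encode_runs_def)

lemma length_encode_runs: "length (encode_runs rs) = 2 * length rs"
  by (induction rs) (auto simp: encode_runs_simps)

lemma nth_encode_runs: "r < length rs \<Longrightarrow>
  encode_runs rs ! (2 * r) = fst (rs ! r) \<and> encode_runs rs ! (2 * r + 1) = snd (rs ! r)"
proof (induction rs arbitrary: r)
  case (Cons a rs)
  then show ?case by (cases r; cases a) (auto simp: encode_runs_simps)
qed simp

text \<open>\<open>XS i\<close> is a chosen order that witnesses that \<open>Bs ! i\<close> is a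
  transform. The row numbers used by the merge are positions in the concatenation of these
  orders.\<close>

locale merge_input =
  fixes k \<sigma> :: nat and Ms :: "collection list" and Bs :: "nat list list" and XS :: "nat \<Rightarrow> (nat \<times> nat) list"
    and N R :: nat and inp :: "nat list"
  assumes k: "1 \<le> k" "length Ms = k" "length Bs = k"
    and over: "i < k \<Longrightarrow> collection_over \<sigma> (Ms ! i)"
    and order: "i < k \<Longrightarrow> context_order (Ms ! i) (XS i)"
    and Bs: "i < k \<Longrightarrow> Bs ! i = map (char_at (Ms ! i)) (XS i)"
    and N: "N = total_length (concat Ms)" and R: "R = total_runs Bs"
    and inp: "inp = encode_input \<sigma> Bs"
begin

abbreviation "M \<equiv> concat Ms"

definition lift :: "nat \<Rightarrow> nat \<times> nat \<Rightarrow> nat \<times> nat" where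
  "lift i x = (offs ((!) Ms) i + fst x, snd x)"

lemma M_nth: "i < k \<Longrightarrow> q < length (Ms ! i) \<Longrightarrow> M ! (offs ((!) Ms) i + q) = Ms ! i ! q"
  using nth_concat_upt[of i k q "(!) Ms"] concat_map_nth[of Ms] k by simp

lemma length_M: "length M = offs ((!) Ms) k"
  using length_concat_upt[of "(!) Ms" k] concat_map_nth[of Ms] k by simp

lemma source_nth: "i < k \<Longrightarrow> q < length (Ms ! i) \<Longrightarrow> source Ms (offs ((!) Ms) i + q) = i"
  using nth_concat_upt[of i k q "\<lambda>i. replicate (length (Ms ! i)) i"] k
  by (simp add: source_def offs_def)

lemma lift_props:
  assumes i: "i < k" and x: "x \<in> occs (Ms ! i)"
  shows "lift i x \<in> occs M" "char_at M (lift i x) = char_at (Ms ! i) x" "ctx M (lift i x) = ctx (Ms ! i) x"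
    "source Ms (fst (lift i x)) = i"
proof -
  have q: "fst x < length (Ms ! i)" "snd x < length (Ms ! i ! fst x)" using x by (auto simp: occs_def)
  have "offs ((!) Ms) (Suc i) \<le> offs ((!) Ms) k" using i by (intro offs_mono) simp
  then have "offs ((!) Ms) i + fst x < length M" using q unfolding length_M by simp
  then show "lift i x \<in> occs M" using M_nth[OF i q(1)] q by (simp add: occs_def lift_def)
  show "char_at M (lift i x) = char_at (Ms ! i) x" "ctx M (lift i x) = ctx (Ms ! i) x"
    using M_nth[OF i q(1)] by (simp_all add: char_at_def ctx_def lift_def)
  show "source Ms (fst (lift i x)) = i" using source_nth[OF i q(1)] by (simp add: lift_def)
qed

lemma occs_M:
  assumes "z \<in> occs M"
  obtains i x where "i < k" "x \<in> occs (Ms ! i)" "z = lift i x"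
proof -
  obtain q p where z: "z = (q, p)" "q < offs ((!) Ms) k" "p < length (M ! q)"
    using assms by (auto simp: occs_def length_M)
  obtain i r where i: "i < k" "r < length (Ms ! i)" "q = offs ((!) Ms) i + r"
    using offs_locate[OF z(2)] by blast
  show ?thesis using that[of i "(r, p)"] i z M_nth[of i r] by (auto simp: occs_def lift_def)
qed

lemma XS: "i < k \<Longrightarrow> distinct (XS i)" "i < k \<Longrightarrow> set (XS i) = occs (Ms ! i)"
    "i < k \<Longrightarrow> sorted_wrt (\<lambda>x y. \<not> less_fun (ctx (Ms ! i) y) (ctx (Ms ! i) x)) (XS i)"
  using order by (auto simp: context_order_def)

definition L :: "nat \<Rightarrow> (nat \<times> nat) list" where
  "L i = map (lift i) (XS i)"

definition Y :: "(nat \<times> nat) list" where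
  "Y = concat (map L [0..<k])"

abbreviation "Q y \<equiv> ctx M (Y ! y)"

definition src :: "nat \<Rightarrow> nat" where
  "src y = source Ms (fst (Y ! y))"

lemma set_L: "i < k \<Longrightarrow> set (L i) = lift i ` occs (Ms ! i)"
  by (simp add: L_def XS)

lemma source_L: "i < k \<Longrightarrow> z \<in> set (L i) \<Longrightarrow> source Ms (fst z) = i"
  by (auto simp: set_L lift_props simp del: split_paired_All)

lemma set_Y: "set Y = occs M"
proof -
  have "set Y = (\<Union>i<k. lift i ` occs (Ms ! i))" unfolding Y_def by (auto simp: set_L)
  also have "\<dots> = occs M"
  proof (intro subset_antisym subsetI)
    fix z assume "z \<in> occs M"
    then obtain i x where "i < k" "x \<in> occs (Ms ! i)" "z = lift i x" by (rule occs_M)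
    then show "z \<in> (\<Union>i<k. lift i ` occs (Ms ! i))" by blast
  qed (use lift_props(1) in blast)
  finally show ?thesis .
qed

lemma distinct_Y: "distinct Y"
proof -
  have "distinct (concat (map L [0..<j]))" if "j \<le> k" for j
    using that
  proof (induction j)
    case (Suc j)
    have "inj_on (lift j) (set (XS j))" by (auto simp: inj_on_def lift_def)
    then have "distinct (L j)" using XS Suc.prems by (simp add: L_def distinct_map)
    moreover have "set (L j) \<inter> set (concat (map L [0..<j])) = {}"
    proof (rule ccontr)
      assume "set (L j) \<inter> set (concat (map L [0..<j])) \<noteq> {}"
      then obtain z i where z: "z \<in> set (L j)" "z \<in> set (L i)" "i < j" by auto
      then have "source Ms (fst z) = j" "source Ms (fst z) = i"
        using Suc.prems by (auto intro: source_L)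
      then show False using z by simp
    qed
    ultimately show ?case using Suc by auto
  qed simp
  then show ?thesis unfolding Y_def by blast
qed

lemma length_Y: "length Y = N"
  using distinct_card[OF distinct_Y] card_occs[of M] by (simp add: set_Y N)

lemma Y_in: "y < N \<Longrightarrow> Y ! y \<in> occs M"
  using nth_mem[of y Y] by (simp add: set_Y length_Y)

lemma offs_L: "offs L i = offs ((!) Bs) i" if "i \<le> k"
  unfolding offs_def using that by (intro sum.cong) (auto simp: Bs L_def)

lemma offs_Bs_k: "offs ((!) Bs) k = N"
  using length_concat_upt[of L k] offs_L[of k] by (simp add: Y_def[symmetric] length_Y)

lemma Y_block:
  assumes i: "i < k" and y: "offs ((!) Bs) i \<le> y" "y < offs ((!) Bs) (Suc i)"
  shows "Y ! y = lift i (XS i ! (y - offs ((!) Bs) i))" "XS i ! (y - offs ((!) Bs) i) \<in> occs (Ms ! i)"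
    "y - offs ((!) Bs) i < length (XS i)"
proof -
  define r where "r = y - offs ((!) Bs) i"
  have r: "r < length (XS i)" "y = offs L i + r" using y i offs_L[of i] by (auto simp: r_def Bs)
  show "Y ! y = lift i (XS i ! r)"
    using nth_concat_upt[of i k r L] i r by (simp add: Y_def L_def)
  show "XS i ! r \<in> occs (Ms ! i)" using r XS(2)[OF i] nth_mem by blast
  show "r < length (XS i)" by (rule r)
qed

lemma src_block: "i < k \<Longrightarrow> offs ((!) Bs) i \<le> y \<Longrightarrow> y < offs ((!) Bs) (Suc i) \<Longrightarrow> src y = i"
  using Y_block[of i y] lift_props(4)[of i] by (simp add: src_def)

lemma block_of: 
  assumes "y < N"
  shows "src y < k" "offs ((!) Bs) (src y) \<le> y" "y < offs ((!) Bs) (Suc (src y))"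
proof -
  obtain i r where "i < k" "r < length (Bs ! i)" "y = offs ((!) Bs) i + r"
    using offs_locate[of y "(!) Bs" k] assms offs_Bs_k by auto
  then show "src y < k" "offs ((!) Bs) (src y) \<le> y" "y < offs ((!) Bs) (Suc (src y))"
    using src_block[of i y] by auto
qed

lemma Q_sorted: "i < k \<Longrightarrow> offs ((!) Bs) i \<le> y \<Longrightarrow> y < y' \<Longrightarrow> y' < offs ((!) Bs) (Suc i) \<Longrightarrow>
    \<not> less_fun (Q y') (Q y)"
proof -
  assume a: "i < k" "offs ((!) Bs) i \<le> y" "y < y'" "y' < offs ((!) Bs) (Suc i)"
  have y: "y < offs ((!) Bs) (Suc i)" and y': "offs ((!) Bs) i \<le> y'" using a by auto
  note Y1 = Y_block[OF a(1,2) y] and Y2 = Y_block[OF a(1) y' a(4)]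
  have "y - offs ((!) Bs) i < y' - offs ((!) Bs) i" using a by simp
  then show ?thesis
    using sorted_wrt_nth_less[OF XS(3)[OF a(1)] _ Y2(3)] Y1 Y2 lift_props(3)[OF a(1)] by auto
qed

lemma char_less: "x \<in> occs M \<Longrightarrow> char_at M x < \<sigma>"
proof -
  assume "x \<in> occs M"
  then obtain i z where z: "i < k" "z \<in> occs (Ms ! i)" "x = lift i z" by (rule occs_M)
  have "Ms ! i ! fst z \<in> set (Ms ! i)" "char_at (Ms ! i) z \<in> set (Ms ! i ! fst z)"
    using z by (auto simp: occs_def char_at_def)
  then show ?thesis using over[OF z(1)] lift_props(2)[OF z(1,2)] z(3) by (auto simp: collection_over_def)
qed

lemma ctx_less: "x \<in> occs M \<Longrightarrow> ctx M x j < \<sigma>"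
proof -
  assume x: "x \<in> occs M"
  define p where "p = (snd x + 1 + j) mod length (M ! fst x)"
  have "(fst x, p) \<in> occs M" using x by (auto simp: occs_def p_def intro!: mod_less_divisor)
  from char_less[OF this] show ?thesis by (simp add: char_at_def ctx_def p_def)
qed

text \<open>The context over the tagged alphabet. A context never leaves its string, so all its
  characters carry the same tag.\<close>

definition tc :: "nat \<times> nat \<Rightarrow> nat \<Rightarrow> nat" where
  "tc x j = source Ms (fst x) * \<sigma> + ctx M x j"

definition tch :: "nat \<times> nat \<Rightarrow> nat" where
  "tch x = source Ms (fst x) * \<sigma> + char_at M x"

lemma tc_pred: "x \<in> occs M \<Longrightarrow> tc (pred_occ M x) = case_nat (tch x) (tc x)"
proof
  fix j assume x: "x \<in> occs M"
  have "source Ms (fst (pred_occ M x)) = source Ms (fst x)" by (simp add: pred_occ_def)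
  then show "tc (pred_occ M x) j = case_nat (tch x) (tc x) j"
    using ctx_pred[OF x] by (cases j) (simp_all add: tc_def tch_def)
qed

text \<open>Within an input the common tag cancels. Across inputs the tags differ by at least
  \<open>\<sigma>\<close>, which outweighs any difference of characters.\<close>

lemma tc_sorted: "y < y' \<Longrightarrow> y' < N \<Longrightarrow> \<not> less_fun (tc (Y ! y')) (tc (Y ! y))"
proof
  assume y: "y < y'" "y' < N" and less: "less_fun (tc (Y ! y')) (tc (Y ! y))"
  have b: "src y < k" "offs ((!) Bs) (src y) \<le> y" "y < offs ((!) Bs) (Suc (src y))"
    and b': "src y' < k" "offs ((!) Bs) (src y') \<le> y'" "y' < offs ((!) Bs) (Suc (src y'))"
    using block_of[of y] block_of[of y'] y by auto
  have le: "src y \<le> src y'"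
  proof (rule ccontr)
    assume "\<not> src y \<le> src y'"
    then have "offs ((!) Bs) (Suc (src y')) \<le> offs ((!) Bs) (src y)" by (intro offs_mono) simp
    then show False using b b' y by simp
  qed
  obtain l where l: "tc (Y ! y') l < tc (Y ! y) l" "\<And>m. m < l \<Longrightarrow> tc (Y ! y') m = tc (Y ! y) m"
    using less by (auto simp: less_fun_def)
  show False
  proof (cases "src y = src y'")
    case True
    then have "less_fun (Q y') (Q y)"
      using l by (intro less_funI exI[of _ l]) (auto simp: tc_def src_def)
    then show False using Q_sorted[OF b(1,2) y(1)] b'(3) True by simp
  next
    case False
    then have "Suc (src y) * \<sigma> \<le> src y' * \<sigma>" using le by (intro mult_le_mono1) simp
    moreover have "ctx M (Y ! y) l < \<sigma>" using ctx_less[OF Y_in] y by simp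
    ultimately show False using l(1) by (simp add: tc_def src_def)
  qed
qed

definition P :: "nat list" where
  "P = sort_key (\<lambda>y. tch (Y ! y)) [0..<N]"

lemma length_P [simp]: "length P = N" and set_P [simp]: "set P = {..<N}"
  by (auto simp: P_def)

text \<open>The occurrences, each moved back by one character and sorted stably by that character,
  are again in the order of their contexts.\<close>

lemma tc_P: "y < N \<Longrightarrow> tc (Y ! y) = case_nat (tch (Y ! (P ! y))) (tc (Y ! (P ! y)))"
proof -
  assume y: "y < N"
  let ?g = "\<lambda>y. case_nat (tch (Y ! y)) (tc (Y ! y))"
  have mY: "image_mset (\<lambda>y. f (Y ! y)) (mset [0..<N]) = image_mset f (mset_set (occs M))" for f :: "nat \<times> nat \<Rightarrow> 'z"
  proof -
    have "map (\<lambda>y. f (Y ! y)) [0..<N] = map f Y"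
      using length_Y by (auto intro!: nth_equalityI)
    then have "image_mset (\<lambda>y. f (Y ! y)) (mset [0..<N]) = image_mset f (mset Y)"
      by (metis mset_map)
    also have "mset Y = mset_set (occs M)" using mset_set_set[OF distinct_Y] set_Y by simp
    finally show ?thesis .
  qed
  \<comment> \<open>Both sides are sorted lists of the same multiset. Only contexts are compared: if
    some are equal, \<open>P ! y\<close> need not be the row of the occurrence that actually follows
    \<open>Y ! y\<close>.\<close>
  have "map ?g P = map (\<lambda>y. tc (Y ! y)) [0..<N]"
  proof (rule sorted_wrt_unique[where le = "\<lambda>f g. \<not> less_fun g f"])
    have "mset (map ?g P) = image_mset (\<lambda>y. ?g y) (mset [0..<N])" by (simp add: P_def)
    also have "\<dots> = image_mset (\<lambda>x. case_nat (tch x) (tc x)) (mset_set (occs M))" by (rule mY)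
    also have "\<dots> = image_mset (\<lambda>x. tc (pred_occ M x)) (mset_set (occs M))"
      by (intro image_mset_cong) (simp add: tc_pred)
    also have "\<dots> = image_mset tc (image_mset (pred_occ M) (mset_set (occs M)))"
      by (simp add: multiset.map_comp comp_def)
    also have "image_mset (pred_occ M) (mset_set (occs M)) = mset_set (occs M)"
      using image_mset_mset_set[OF inj_pred_occ] image_pred_occ by simp
    also have "image_mset tc (mset_set (occs M)) = mset (map (\<lambda>y. tc (Y ! y)) [0..<N])"
      using mY[of tc] by simp
    finally show "mset (map ?g P) = mset (map (\<lambda>y. tc (Y ! y)) [0..<N])" .
    show "sorted_wrt (\<lambda>f g. \<not> less_fun g f) (map (\<lambda>y. tc (Y ! y)) [0..<N])"
      using tc_sorted by (auto simp: sorted_wrt_iff_nth_less)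
    have "sorted_wrt (\<lambda>a b. tch (Y ! a) < tch (Y ! b) \<or> tch (Y ! a) = tch (Y ! b) \<and> a < b) P"
      unfolding P_def by (intro sorted_wrt_sort_key) simp
    \<comment> \<open>Different tagged characters decide the comparison at once; for equal ones
      stability keeps the row order, in which the remaining contexts are sorted.\<close>
    then have "sorted_wrt (\<lambda>a b. \<not> less_fun (?g b) (?g a)) P"
    proof (rule sorted_wrt_mono_rel[rotated])
      fix a b assume ab: "a \<in> set P" "b \<in> set P"
        and le: "tch (Y ! a) < tch (Y ! b) \<or> tch (Y ! a) = tch (Y ! b) \<and> a < b"
      show "\<not> less_fun (?g b) (?g a)"
      proof
        assume "less_fun (?g b) (?g a)"
        then obtain l where l: "?g b l < ?g a l" "\<And>m. m < l \<Longrightarrow> ?g b m = ?g a m"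
          by (auto simp: less_fun_def)
        show False
        proof (cases l)
          case 0
          then show False using l(1) le by simp
        next
          case (Suc l')
          then have "tch (Y ! b) = tch (Y ! a)" using l(2)[of 0] by simp
          then have "a < b" using le by simp
          moreover have "tc (Y ! b) l' < tc (Y ! a) l'" using l(1) Suc by simp
          moreover have "tc (Y ! b) m = tc (Y ! a) m" if "m < l'" for m
            using l(2)[of "Suc m"] that Suc by simp
          ultimately show False using tc_sorted[of a b] ab by (auto intro: less_funI)
        qed
      qed
    qed
    then show "sorted_wrt (\<lambda>f g. \<not> less_fun g f) (map ?g P)" by (simp add: sorted_wrt_map)
  qed (rule not_less_fun_antisym)
  then have "map ?g P ! y = map (\<lambda>y. tc (Y ! y)) [0..<N] ! y" by simp
  then show ?thesis using y by simp
qed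

lemma P_less: "y < N \<Longrightarrow> P ! y < N"
  using nth_mem[of y P] by simp

lemma sigma_pos: "0 < N \<Longrightarrow> 0 < \<sigma>"
  using char_less[OF Y_in[of 0]] by simp

text \<open>Obtained from \<open>tc_P\<close> by reduction modulo \<open>\<sigma>\<close>, which
  removes the tags.\<close>

lemma Q_P: "y < N \<Longrightarrow> Q y 0 = char_at M (Y ! (P ! y))" "y < N \<Longrightarrow> Q y (Suc j) = Q (P ! y) j"
proof -
  assume y: "y < N"
  have m: "(a * \<sigma> + b) mod \<sigma> = b" if "b < \<sigma>" for a b using that by simp
  have "Q y j = tc (Y ! y) j mod \<sigma>" "char_at M (Y ! y) = tch (Y ! y) mod \<sigma>" if "y < N" for y j
    using ctx_less[OF Y_in[OF that]] char_less[OF Y_in[OF that]] by (simp_all add: tc_def tch_def)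
  then show "Q y 0 = char_at M (Y ! (P ! y))" "Q y (Suc j) = Q (P ! y) j"
    using tc_P[OF y] y P_less[OF y] by simp_all
qed


section \<open>Runs of the inputs and the layout of the encoded input\<close>

definition RL :: "nat \<Rightarrow> (nat \<times> nat) list" where
  "RL i = rle (Bs ! i)"

definition goff :: "nat \<Rightarrow> nat" where
  "goff = offs RL"

definition ch :: "nat \<Rightarrow> nat" where
  "ch g = fst (concat (map RL [0..<k]) ! g)"

definition Len :: "nat \<Rightarrow> nat" where
  "Len g = snd (concat (map RL [0..<k]) ! g)"

definition K :: "nat \<Rightarrow> nat" where
  "K g = concat (map (\<lambda>i. map (\<lambda>r. i * \<sigma> + fst r) (RL i)) [0..<k]) ! g"

lemma run_nth:
  assumes "i < k" "r < length (RL i)"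
  shows "ch (goff i + r) = fst (RL i ! r)" "Len (goff i + r) = snd (RL i ! r)"
    "K (goff i + r) = i * \<sigma> + fst (RL i ! r)"
  using nth_concat_upt[of i k r RL] nth_concat_upt[of i k r "\<lambda>i. map (\<lambda>r. i * \<sigma> + fst r) (RL i)"] assms
  by (simp_all add: ch_def Len_def K_def goff_def offs_def)

lemma goff_k: "goff k = R"
  using k by (simp add: R total_runs_def goff_def offs_def RL_def sum_list_sum_nth atLeast0LessThan)

lemma run_locate:
  assumes "g < R"
  obtains i r where "i < k" "r < length (RL i)" "g = goff i + r"
  using offs_locate[of g RL k] assms goff_k by (auto simp: goff_def)

lemma expand_RL: "expand (RL i) = Bs ! i"
  by (simp add: RL_def expand_rle)

lemma RL_pos: "r < length (RL i) \<Longrightarrow> 0 < snd (RL i ! r)"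
  using rle_pos[of "RL i ! r" "Bs ! i"] nth_mem[of r "RL i"] by (simp add: RL_def)

lemma expand_upt: "expand rs = concat (map (\<lambda>r. replicate (snd (rs ! r)) (fst (rs ! r))) [0..<length rs])"
proof -
  have "expand rs = concat (map (\<lambda>r. replicate (snd r) (fst r)) (map ((!) rs) [0..<length rs]))"
    by (simp add: expand_def map_nth case_prod_beta')
  then show ?thesis by (simp add: comp_def)
qed

lemma length_Bs: "length (Bs ! i) = (\<Sum>r<length (RL i). snd (RL i ! r))"
  using arg_cong[OF expand_RL[of i], of length] unfolding expand_upt length_concat_upt by (simp add: offs_def)

lemma sum_Len: "i \<le> k \<Longrightarrow> (\<Sum>g<goff i. Len g) = offs ((!) Bs) i"
proof (induction i)
  case (Suc i)
  have "(\<Sum>g<goff i + n. Len g) = (\<Sum>g<goff i. Len g) + (\<Sum>r<n. Len (goff i + r))" for n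
    by (induction n) auto
  then have "(\<Sum>g<goff (Suc i). Len g) = (\<Sum>g<goff i. Len g) + (\<Sum>r<length (RL i). Len (goff i + r))"
    by (simp add: goff_def)
  also have "(\<Sum>r<length (RL i). Len (goff i + r)) = length (Bs ! i)"
    unfolding length_Bs using Suc.prems by (intro sum.cong) (auto simp: run_nth)
  finally show ?case using Suc by simp
qed (simp add: goff_def)

lemma sum_Len_run: "i < k \<Longrightarrow> r \<le> length (RL i) \<Longrightarrow>
    (\<Sum>g<goff i + r. Len g) = offs ((!) Bs) i + (\<Sum>r'<r. snd (RL i ! r'))"
  by (induction r) (simp_all add: sum_Len run_nth)

text \<open>The row number is resolved into an input, a run of it and an offset in that run;
  expanding the encoding then gives the character, and the input gives the tag.\<close>

lemma tch_run:
  assumes g: "g < R" and y: "(\<Sum>g'<g. Len g') \<le> y" "y < (\<Sum>g'<g. Len g') + Len g"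
  shows "tch (Y ! y) = K g" "y < N"
proof -
  obtain i r where i: "i < k" "r < length (RL i)" "g = goff i + r" using run_locate[OF g] .
  define d where "d = y - (\<Sum>g'<g. Len g')"
  define x where "x = (\<Sum>r'<r. snd (RL i ! r')) + d"
  have yx: "y = offs ((!) Bs) i + x" "d < snd (RL i ! r)"
    using y sum_Len_run[of i r] i run_nth(2)[OF i(1,2)] by (auto simp: d_def x_def)
  have "Bs ! i ! x = concat (map (\<lambda>r. replicate (snd (RL i ! r)) (fst (RL i ! r))) [0..<length (RL i)]) ! x"
    using expand_RL[of i] expand_upt[of "RL i"] by simp
  also have "\<dots> = fst (RL i ! r)"
    using nth_concat_upt[of r "length (RL i)" d "\<lambda>r. replicate (snd (RL i ! r)) (fst (RL i ! r))"] i yx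
    by (simp add: x_def offs_def)
  finally have B: "Bs ! i ! x = fst (RL i ! r)" .
  have "x < length (Bs ! i)"
  proof -
    have "x < (\<Sum>r'<Suc r. snd (RL i ! r'))" using yx by (simp add: x_def)
    also have "\<dots> \<le> length (Bs ! i)" unfolding length_Bs using i by (intro sum_mono2) auto
    finally show ?thesis .
  qed
  then have "y < offs ((!) Bs) (Suc i)" using yx by auto
  also have "offs ((!) Bs) (Suc i) \<le> offs ((!) Bs) k" using i by (intro offs_mono) simp
  finally show "y < N" by (simp add: offs_Bs_k)
  have "Bs ! i ! x = char_at (Ms ! i) (XS i ! x)"
    using Bs[OF i(1)] \<open>x < length (Bs ! i)\<close> by simp
  also have "\<dots> = char_at M (Y ! y)"
    using Y_block[OF i(1), of y] yx \<open>x < length (Bs ! i)\<close> lift_props(2)[OF i(1)] by simp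
  finally have "char_at M (Y ! y) = fst (RL i ! r)" using B by simp
  moreover have "source Ms (fst (Y ! y)) = i"
    using src_block[OF i(1), of y] yx \<open>x < length (Bs ! i)\<close> by (simp add: src_def)
  ultimately show "tch (Y ! y) = K g" using i run_nth by (simp add: tch_def)
qed

lemma inp_eq: "inp = \<sigma> # concat (map (\<lambda>i. length (RL i) # encode_runs (RL i)) [0..<k])"
proof -
  have "map (\<lambda>B. length (rle B) # encode_runs (rle B)) Bs = map (\<lambda>i. length (RL i) # encode_runs (RL i)) [0..<k]"
    using k by (auto simp: RL_def intro!: nth_equalityI)
  then show ?thesis by (simp add: inp encode_input_def)
qed

lemma offs_inp: "offs (\<lambda>i. length (RL i) # encode_runs (RL i)) i = i + 2 * goff i"
  by (induction i) (auto simp: length_encode_runs goff_def)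

lemma length_inp: "length inp = 1 + k + 2 * R"
  by (simp add: inp_eq length_concat_upt offs_inp goff_k)

lemma inp_nth: "i < k \<Longrightarrow> r < Suc (2 * length (RL i)) \<Longrightarrow>
    inp ! (1 + (i + 2 * goff i + r)) = (length (RL i) # encode_runs (RL i)) ! r"
  using nth_concat_upt[of i k r "\<lambda>i. length (RL i) # encode_runs (RL i)"]
  by (simp add: inp_eq offs_inp length_encode_runs)

lemma Bs_nonempty: "i < k \<Longrightarrow> Bs ! i \<noteq> []"
proof -
  assume i: "i < k"
  then have "Ms ! i \<noteq> []" "Ms ! i ! 0 \<in> set (Ms ! i)" "\<forall>S \<in> set (Ms ! i). S \<noteq> []"
    using over[OF i] by (auto simp: collection_over_def)
  then have "(0, 0) \<in> occs (Ms ! i)" by (auto simp: occs_def)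
  then show ?thesis using Bs[OF i] XS(2)[OF i] by auto
qed

lemma k_le_R: "k \<le> R"
proof -
  have "i \<le> goff i" if "i \<le> k" for i
    using that
  proof (induction i)
    case (Suc i)
    obtain b bs where "Bs ! i = b # bs" using Bs_nonempty[of i] Suc.prems by (cases "Bs ! i") auto
    then have "1 \<le> length (RL i)" by (simp add: RL_def)
    moreover have "goff (Suc i) = goff i + length (RL i)" by (simp add: goff_def)
    moreover have "i \<le> goff i" using Suc by simp
    ultimately show ?case by linarith
  qed simp
  then show ?thesis using goff_k by force
qed

lemma R_le_N: "R \<le> N"
proof -
  have "R = (\<Sum>g<R. 1)" by simp
  also have "\<dots> \<le> (\<Sum>g<R. Len g)"
  proof (rule sum_mono)
    fix g assume "g \<in> {..<R}"
    then obtain i r where "i < k" "r < length (RL i)" "g = goff i + r" by (auto elim: run_locate)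
    then show "1 \<le> Len g" using run_nth(2) RL_pos[of r i] by simp
  qed
  also have "\<dots> = N" using sum_Len[of k] goff_k offs_Bs_k by simp
  finally show ?thesis .
qed

lemma ch_less: "g < R \<Longrightarrow> ch g < \<sigma>"
proof -
  assume "g < R"
  then obtain i r where i: "i < k" "r < length (RL i)" "g = goff i + r" by (rule run_locate)
  have "RL i ! r \<in> set (RL i)" using i by simp
  then have "fst (RL i ! r) \<in> set (expand (RL i))"
    using RL_pos[OF i(2)] by (force simp: expand_def)
  then have "fst (RL i ! r) \<in> char_at (Ms ! i) ` occs (Ms ! i)"
    unfolding expand_RL Bs[OF i(1)] by (simp add: XS(2)[OF i(1)])
  then obtain x where "x \<in> occs (Ms ! i)" "fst (RL i ! r) = char_at (Ms ! i) x" by auto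
  then show ?thesis using char_less lift_props(1,2)[OF i(1)] run_nth(1)[OF i(1,2)] i(3) by metis
qed

end

section \<open>Instantiating the abstract merge with the given transforms\<close>

locale merge_input_ram = merge_input +
  fixes W :: nat
  assumes W_lin: "32 * N + 2 * (k * \<sigma>) + 100 < W" and W_sq: "N * N < W"
begin

sublocale rt: run_table W k \<sigma> N R inp goff ch K Len
proof unfold_locales
  show "k \<le> R" "R \<le> N" "1 \<le> k" by (rule k_le_R R_le_N k)+
  show "1 \<le> \<sigma>" using sigma_pos k_le_R R_le_N k by simp
  show "goff 0 = 0" "goff k = R" by (simp_all add: goff_def goff_k[unfolded goff_def])
  show "goff i \<le> goff (Suc i)" for i by (simp add: goff_def)
  show "length inp = 1 + k + 2 * R" by (rule length_inp)
  show "inp ! 0 = \<sigma>" by (simp add: inp_eq)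
  show "inp ! (i + (2 * goff i + 1)) = goff (Suc i) - goff i" if "i < k" for i
    using inp_nth[OF that, of 0] by (simp add: goff_def)
  show "inp ! (i + (2 * g + 2)) = ch g \<and> inp ! (i + (2 * g + 3)) = Len g \<and> K g = i * \<sigma> + ch g"
    if g: "i < k" "goff i \<le> g" "g < goff (Suc i)" for i g
  proof -
    define r where "r = g - goff i"
    have r: "r < length (RL i)" "g = goff i + r" using g by (auto simp: r_def goff_def)
    have e: "1 + (i + 2 * goff i + (1 + 2 * r)) = i + (2 * g + 2)"
      "1 + (i + 2 * goff i + (2 + 2 * r)) = i + (2 * g + 3)" using r by auto
    have "inp ! (i + (2 * g + 2)) = fst (RL i ! r)" "inp ! (i + (2 * g + 3)) = snd (RL i ! r)"
      using inp_nth[OF g(1), of "1 + 2 * r", unfolded e] inp_nth[OF g(1), of "2 + 2 * r", unfolded e]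
        r nth_encode_runs[OF r(1)] by simp_all
    then show ?thesis using r run_nth[OF g(1) r(1)] by simp
  qed
  show "ch g < \<sigma>" if "g < R" for g by (rule ch_less[OF that])
  show "(\<Sum>g<R. Len g) = N" using sum_Len[of k] goff_k offs_Bs_k by simp
qed (rule W_lin W_sq)+

lemma Lst_goff: "i \<le> k \<Longrightarrow> rt.Lst (goff i) = offs ((!) Bs) i"
  by (simp add: rt.Lst_def sum_Len)

text \<open>The rows fall into runs with constant tagged character, so
  \<open>sort_key_concat\<close> reduces the permutation of \<open>N\<close> rows to the sorting
  permutation of \<open>R\<close> runs.\<close>

lemma P_eq: "P = concat (map (\<lambda>t. [rt.Lst (rt.Prm t)..<rt.Lst (Suc (rt.Prm t))]) [0..<R])"
proof -
  have upt: "[0..<rt.Lst g] = concat (map (\<lambda>g. [rt.Lst g..<rt.Lst (Suc g)]) [0..<g])" for g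
  proof (induction g)
    case (Suc g)
    have "[0..<rt.Lst (Suc g)] = [0..<rt.Lst g] @ [rt.Lst g..<rt.Lst (Suc g)]"
      using upt_add_eq_append[of 0 "rt.Lst g" "Len g"] by (simp add: rt.Lst_simps)
    then show ?case using Suc by simp
  qed (simp add: rt.Lst_simps)
  have "P = sort_key (\<lambda>y. tch (Y ! y)) (concat (map (\<lambda>g. [rt.Lst g..<rt.Lst (Suc g)]) [0..<R]))"
    unfolding P_def upt[symmetric] by (simp add: rt.Lst_simps)
  also have "\<dots> = concat (map (\<lambda>g. [rt.Lst g..<rt.Lst (Suc g)]) (sort_key K [0..<R]))"
    using tch_run(1) by (intro sort_key_concat) (simp add: rt.Lst_def)
  also have "sort_key K [0..<R] = map rt.Prm [0..<R]"
    by (rule nth_equalityI) (simp_all add: rt.Prm_def rt.perm_def)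
  finally show ?thesis by (simp add: comp_def)
qed

text \<open>The inverse LF mapping is \<open>P\<close>, the transform consists of the characters
  along \<open>Y\<close>, and the compared contexts are the untagged ones. Input \<open>i\<close>
  owns the rows of the runs from \<open>goff i\<close> up to, excluding,
  \<open>goff (Suc i)\<close>.\<close>

sublocale mr: merge_runs W k \<sigma> N R inp "\<lambda>y. char_at M (Y ! y)" "(!) P" K Len rt.Lst rt.Prm rt.FS
  "\<lambda>y. ctx M (Y ! y)" "\<lambda>i. rt.Lst (goff (Suc i))" "\<lambda>i. rt.Lst (goff i)" src
proof unfold_locales
  show "K g < k * \<sigma>" "rt.Prm g < R" if "g < R" for g using rt.K_less rt.Prm_less that by auto
  show "0 < Len g" if "g < R" for g
    using run_locate[OF that] run_nth(2) RL_pos by metis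
  show "rt.Lst g + Len g \<le> N" if "g < R" for g
    using rt.Lst_le_N[of "Suc g"] that by (simp add: rt.Lst_simps)
  show "rt.FS 0 = 0" "rt.FS R = N" "rt.FS (Suc g) = rt.FS g + Len (rt.Prm g)" for g
    by (simp_all add: rt.FS_simps)
  show "P ! y = rt.Lst (rt.Prm g) + (y - rt.FS g)"
    if "g < R" "rt.FS g \<le> y" "y < rt.FS (Suc g)" for g y
  proof -
    have "offs (\<lambda>t. [rt.Lst (rt.Prm t)..<rt.Lst (Suc (rt.Prm t))]) t = rt.FS t" for t
      by (simp add: offs_def rt.FS_def rt.Lst_simps)
    then show ?thesis
      using nth_concat_upt[of g R "y - rt.FS g" "\<lambda>t. [rt.Lst (rt.Prm t)..<rt.Lst (Suc (rt.Prm t))]"] that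
      by (simp add: P_eq rt.Lst_simps rt.FS_simps)
  qed
  show "char_at M (Y ! y) = K g mod \<sigma>" if "g < R" "rt.Lst g \<le> y" "y < rt.Lst g + Len g" for g y
  proof -
    have "tch (Y ! y) = K g" "y < N" using tch_run[of g y] that by (simp_all add: rt.Lst_def)
    then show ?thesis using char_less[OF Y_in[of y]] by (simp add: tch_def flip: \<open>tch (Y ! y) = K g\<close>)
  qed
  show "P ! y < N" if "y < N" for y by (rule P_less[OF that])
  show "Q y 0 = char_at M (Y ! (P ! y))" "Q y (Suc j) = Q (P ! y) j" if "y < N" for y j
    by (rule Q_P[OF that])+
  show "Q y j < \<sigma>" if "y < N" for y j by (rule ctx_less[OF Y_in[OF that]])
  show "Q y = Q y'" if "y < N" "y' < N" "\<And>j. j < N * N \<Longrightarrow> Q y j = Q y' j" for y y'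
    using ctx_agree[OF Y_in Y_in, of y y'] that by (simp add: N)
  show "rt.Lst (goff (Suc i)) \<le> N" if "i < k" for i
    using rt.Lst_le_N[OF rt.goff_le[of "Suc i"]] that by simp
  show "rt.Lst (goff i) \<le> rt.Lst (goff (Suc i))" if "i < k" for i
    by (intro rt.Lst_mono rt.goff_mono that)
  show "rt.Lst (goff (Suc i)) \<le> rt.Lst (goff j)" if "i < j" "j < k" for i j
    using that by (intro rt.Lst_mono) (simp add: goff_def offs_mono flip: offs_simps(2))
  show "src y < k \<and> rt.Lst (goff (src y)) \<le> y \<and> y < rt.Lst (goff (Suc (src y)))" if "y < N" for y
    using block_of[OF that] by (simp add: Lst_goff)
  show "\<not> less_fun (Q y') (Q y)"
    if "i < k" "rt.Lst (goff i) \<le> y" "y < y'" "y' < rt.Lst (goff (Suc i))" for i y y'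
    using Q_sorted[of i y y'] that by (simp add: Lst_goff)
  show "Suc g < R \<and> rt.Lst (Suc g) = rt.Lst g + Len g" if "g < R" "rt.Lst g + Len g < N" for g
    using that rt.Lst_simps by (metis Suc_lessI nat_neq_iff)
qed

end

section \<open>The whole program and its running time\<close>

definition merge_prog :: "nat \<Rightarrow> com" where
  "merge_prog k =
     parse k;; radix_sort k;; prefix_sums;; Assign ''r'' (Const 0);; Assign ''o'' (Const 0);;
     Assign ''q'' (Const 0);; merge_loop k;; flush"

lemma parse_stcols [simp]: "stcols (parse k) = {5, 6, 7, 8, 9, 12, 13}"
  by (auto simp: parse_def)

lemma merge_loop_stcols [simp]: "stcols (merge_loop k) \<subseteq> {..<16}"
  by (auto simp: merge_loop_def)

lemma sum_enat: "(\<Sum>x\<in>A. enat (f x)) = enat (\<Sum>x\<in>A. f x)"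
  by (induction A rule: infinite_finite_induct) (auto simp: zero_enat_def)

context merge_input_ram
begin

definition merge_time :: nat where
  "merge_time = 250 + 100 * k + 140 * R + (300 + 250 * R) * floorlog 2 (k * \<sigma>) +
     mr.PC * (mr.pot 0 + mr.pot (mr.nb 0)) + 100 * (k * R)"

lemma merge_prog_correct:
  "wp W (16 * R) inp (merge_prog k) init_state (\<lambda>t s'. t \<le> merge_time \<and>
     outp s' = encode_runs (rle (map (\<lambda>y. char_at M (Y ! y)) mr.Z)))"
  unfolding merge_prog_def
  apply simp
  apply (rule wp_call[OF rt.parse_correct])
  subgoal by simp
  subgoal premises q1 for t1 s1
  proof -
    have p1: "t1 \<le> 50 + 100 * k + 100 * R" "rt.parsed s1" "\<forall>g<R. col s1 9 g = g"
      using q1(1) by auto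
    have o1: "outp s1 = []" using q1(4) by (simp add: init_state_def)
    have k1: "rt.keyed s1" using p1(2) by (simp add: rt.parsed_def rt.keyed_def)
    show ?thesis
      apply (rule wp_call[OF rt.radix_sort_correct[OF k1 p1(3)]])
      subgoal by simp
      subgoal premises q2 for t2 s2
      proof -
        have r2: "x \<in> {''S'', ''R'', ''N'', ''D''} \<Longrightarrow> reg s2 x = reg s1 x" for x using q2(2)[of x] by auto
        have c2: "j < 16 \<Longrightarrow> j \<notin> {9, 10} \<Longrightarrow> col s2 j = col s1 j" for j using q2(3)[of j] by simp
        have o2: "outp s2 = []" using q2(4) o1 by simp
        have k2: "rt.keyed s2" using k1 by (simp add: rt.keyed_def r2 c2)
        have p2: "t2 \<le> 20 + (300 + 250 * R) * floorlog 2 (k * \<sigma>)" "\<forall>g<R. col s2 9 g = rt.Prm g"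
          using q2(1) by auto
        show ?thesis
          apply (rule wp_call[OF rt.prefix_sums_correct[OF k2 p2(2)]])
          subgoal by simp
          subgoal premises q3 for t3 s3
          proof -
            have r3: "x \<in> {''S'', ''R'', ''N'', ''D''} \<Longrightarrow> reg s3 x = reg s1 x" for x
              using q3(2)[of x] r2 by auto
            have c3: "j < 16 \<Longrightarrow> j \<noteq> 11 \<Longrightarrow> col s3 j = col s2 j" for j using q3(3)[of j] by simp
            have o3: "outp s3 = []" using q3(4) o2 by simp
            have p3: "t3 \<le> 20 + 40 * R" "\<forall>g<R. col s3 11 g = rt.FS g" using q3(1) by auto
            define s4 where "s4 = s3\<lparr>reg := (reg s3)(''r'' := 0, ''o'' := 0, ''q'' := 0)\<rparr>"
            have tab: "mr.tab s4"
              using p1(2) p2(2) p3(2) by (simp add: mr.tab_def rt.parsed_def s4_def r3 c3 c2)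
            have hd: "mr.heads s4 (\<lambda>i. rt.Lst (goff i))"
              using p1(2) rt.Lst_le_N rt.goff_le by (simp add: mr.heads_def rt.parsed_def s4_def c3 c2)
            have rn: "mr.runs s4 (\<lambda>i. rt.Lst (goff i))"
            proof -
              have "goff i < R" "0 < Len (goff i)" if i: "i < k" "rt.Lst (goff i) < N" for i
              proof -
                show "goff i < R" using rt.goff_le[of i] i rt.Lst_simps(3) by (cases "goff i = R") auto
                then show "0 < Len (goff i)" by (rule mr.Len_pos)
              qed
              then show ?thesis
                using p1(2) rt.goff_le by (simp add: mr.runs_def rt.parsed_def s4_def c3 c2)
            qed
            have wr: "mr.written s4 []"
              using rt.sigma_pos o3 by (simp add: mr.written_def s4_def pend_def encode_runs_def)
            have ml: "wp W (16 * R) inp (merge_loop k) s4 (\<lambda>t s'.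
                t \<le> mr.PC * (mr.pot 0 + mr.pot (mr.nb 0)) + 100 * (k * R) + 10 \<and>
                mr.written s' (map (\<lambda>y. char_at M (Y ! y)) mr.Z))"
              using mr.merge_loop_correct[OF tab hd rn _ wr] by (simp add: s4_def)
            show ?thesis
              apply (insert rt.W_lin)
              apply (simp add: s4_def[symmetric])
              apply (rule wp_mono[OF ml])
              subgoal premises q4 for t5 s5
              proof -
                have "wp W (16 * R) inp flush s5 (\<lambda>t s'. t \<le> 10 \<and>
                    outp s' = encode_runs (rle (map (\<lambda>y. char_at M (Y ! y)) mr.Z)) \<and>
                    reg s' = reg s5 \<and> mem s' = mem s5)"
                  using q4(2) by (intro mr.flush_correct) simp_all
                then show ?thesis
                  by (rule wp_mono) (use p1(1) p2(1) p3(1) q4(2) in \<open>simp add: merge_time_def\<close>)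
              qed
              done
          qed
          done
      qed
      done
  qed
  done

section \<open>Comparison of the computed order with an arbitrary context order\<close>

context
  fixes xs :: "(nat \<times> nat) list"
  assumes xs: "context_order M xs"
begin

lemma xs_props: "distinct xs" "set xs = occs M" "length xs = N"
    "sorted_wrt (\<lambda>x y. \<not> less_fun (ctx M y) (ctx M x)) xs"
proof -
  show 1: "distinct xs" "set xs = occs M" "sorted_wrt (\<lambda>x y. \<not> less_fun (ctx M y) (ctx M x)) xs"
    using xs by (auto simp: context_order_def)
  show "length xs = N" using distinct_card[OF 1(1)] 1(2) card_occs[of M] by (simp add: N)
qed

lemma mset_Y: "mset Y = mset xs"
  using set_eq_iff_mset_eq_distinct[OF distinct_Y xs_props(1)] set_Y xs_props(2) by simp

text \<open>Both orders sort the same multiset of contexts and can differ only among equal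
  ones.\<close>

lemma map_Z: "map (\<lambda>y. ctx M (Y ! y)) mr.Z = map (ctx M) xs"
proof (rule sorted_wrt_unique[where le = "\<lambda>f g. \<not> less_fun g f"])
  have "map (\<lambda>y. ctx M (Y ! y)) [0..<N] = map (ctx M) Y"
    using length_Y by (auto intro!: nth_equalityI)
  then have "mset (map (\<lambda>y. ctx M (Y ! y)) [0..<N]) = mset (map (ctx M) Y)" by simp
  then show "mset (map (\<lambda>y. ctx M (Y ! y)) mr.Z) = mset (map (ctx M) xs)"
    by (simp add: mr.Z_def mset_Y)
  show "sorted_wrt (\<lambda>f g. \<not> less_fun g f) (map (\<lambda>y. ctx M (Y ! y)) mr.Z)"
    using mr.Z_not_less by (auto simp: sorted_wrt_iff_nth_less)
  show "sorted_wrt (\<lambda>f g. \<not> less_fun g f) (map (ctx M) xs)"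
    using xs_props(4) by (simp add: sorted_wrt_map)
qed (rule not_less_fun_antisym)

lemma ctx_Z: "t < N \<Longrightarrow> ctx M (Y ! (mr.Z ! t)) = ctx M (xs ! t)"
  using arg_cong[OF map_Z, of "\<lambda>l. l ! t"] xs_props(3) by simp

lemma xs_in: "t < N \<Longrightarrow> xs ! t \<in> occs M"
  using nth_mem[of t xs] xs_props by simp

lemma chars_Z: "map (\<lambda>y. char_at M (Y ! y)) mr.Z = map (char_at M) xs"
proof (rule nth_equalityI)
  fix t assume "t < length (map (\<lambda>y. char_at M (Y ! y)) mr.Z)"
  then have t: "t < N" by simp
  then show "map (\<lambda>y. char_at M (Y ! y)) mr.Z ! t = map (char_at M) xs ! t"
    using char_at_cong[OF Y_in[OF mr.Z_less[OF t]] xs_in[OF t] ctx_Z[OF t]] xs_props(3) by simp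
qed (simp add: xs_props(3))

lemma boundaries_eq: "boundaries os = {b. 0 < b \<and> b < length os \<and> os ! (b - 1) \<noteq> os ! b}"
proof (intro set_eqI iffI)
  fix b assume "b \<in> boundaries os"
  then obtain a where a: "b < length os" "is_block os a b" by (auto simp: boundaries_def)
  then have ab: "a < b" "\<forall>j \<in> {a..<b}. os ! j = os ! a" "os ! b \<noteq> os ! a"
    unfolding is_block_def by blast+
  have "b - 1 \<in> {a..<b}" using ab(1) by auto
  from bspec[OF ab(2) this] have "os ! (b - 1) \<noteq> os ! b" using ab(3) by metis
  then show "b \<in> {b. 0 < b \<and> b < length os \<and> os ! (b - 1) \<noteq> os ! b}" using a(1) ab(1)
    by (intro CollectI conjI) simp_all
next
  fix b assume "b \<in> {b. 0 < b \<and> b < length os \<and> os ! (b - 1) \<noteq> os ! b}"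
  then have b: "0 < b" "b < length os" "os ! (b - 1) \<noteq> os ! b" by auto
  \<comment> \<open>The block that ends at \<open>b\<close> starts at the least index from which the
    sequence is constant up to \<open>b\<close>; minimality gives maximality of the block.\<close>
  define a where "a = (LEAST a. \<forall>j \<in> {a..<b}. os ! j = os ! (b - 1))"
  have ex: "\<forall>j \<in> {b - 1..<b}. os ! j = os ! (b - 1)"
  proof
    fix j assume "j \<in> {b - 1..<b}"
    then have "j = b - 1" using b(1) by auto
    then show "os ! j = os ! (b - 1)" by simp
  qed
  have a: "\<forall>j \<in> {a..<b}. os ! j = os ! (b - 1)" unfolding a_def by (rule LeastI) (rule ex)
  have "a \<le> b - 1" unfolding a_def by (rule Least_le) (rule ex)
  then have ab: "a < b" using b by simp
  have oa: "os ! a = os ! (b - 1)" using bspec[OF a, of a] ab by simp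
  have "os ! (a - 1) \<noteq> os ! a" if "0 < a"
  proof
    assume eq: "os ! (a - 1) = os ! a"
    have "\<forall>j \<in> {a - 1..<b}. os ! j = os ! (b - 1)"
    proof
      fix j assume "j \<in> {a - 1..<b}"
      then have "j = a - 1 \<or> j \<in> {a..<b}" by auto
      then show "os ! j = os ! (b - 1)"
      proof
        assume "j = a - 1"
        then show ?thesis by (simp only: eq oa)
      next
        assume "j \<in> {a..<b}"
        then show ?thesis by (rule bspec[OF a])
      qed
    qed
    then have "a \<le> a - 1" unfolding a_def by (rule Least_le)
    then show False using that by simp
  qed
  moreover have "\<forall>j \<in> {a..<b}. os ! j = os ! a" using a unfolding oa .
  moreover have "os ! b \<noteq> os ! a" using b(3) unfolding oa by metis
  ultimately have "is_block os a b" using ab b(2) unfolding is_block_def by (metis less_imp_le)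
  then show "b \<in> boundaries os" using b by (auto simp: boundaries_def)
qed

abbreviation "os \<equiv> map (source Ms \<circ> fst) xs"

lemma finite_boundaries: "finite (boundaries os)"
  by (rule finite_subset[of _ "{..<length os}"]) (auto simp: boundaries_def)

text \<open>Equal contexts in different inputs would lie around a boundary whose longest common prefix
  is infinite.\<close>

lemma same_source:
  assumes fin: "boundary_lcp_sum Ms xs \<noteq> \<infinity>"
    and t: "t \<le> u" "u < N" and eq: "ctx M (xs ! t) = ctx M (xs ! u)"
  shows "os ! t = os ! u"
proof (rule ccontr)
  assume ne: "os ! t \<noteq> os ! u"
  have le: "\<not> less_fun (ctx M (xs ! j)) (ctx M (xs ! i))" if "i \<le> j" "j < N" for i j
    using sorted_wrt_nth_less[OF xs_props(4), of i j] that xs_props(3) less_fun_irrefl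
    by (cases "i = j") auto
  have mid: "ctx M (xs ! v) = ctx M (xs ! t)" if "t \<le> v" "v \<le> u" for v
    using le[OF that(1)] le[OF that(2) t(2)] that t eq by (intro not_less_fun_antisym) auto
  have "\<exists>b. t < b \<and> b \<le> u \<and> os ! (b - 1) \<noteq> os ! b"
  proof (rule ccontr)
    assume no: "\<not> (\<exists>b. t < b \<and> b \<le> u \<and> os ! (b - 1) \<noteq> os ! b)"
    have "os ! v = os ! t" if "t \<le> v" "v \<le> u" for v
      using that
    proof (induction v rule: dec_induct)
      case (step v)
      have "os ! (Suc v - 1) = os ! Suc v" using no step.hyps(1) step.prems less_Suc_eq_le by blast
      then have "os ! Suc v = os ! v" by (simp only: diff_Suc_1)
      then show ?case using step.IH step.prems by (simp only: Suc_leD)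
    qed simp
    from this[OF t(1)] show False using ne by simp
  qed
  then obtain b where b: "t < b" "b \<le> u" "os ! (b - 1) \<noteq> os ! b" by blast
  then have "b \<in> boundaries os" using t(2) xs_props(3) by (simp add: boundaries_eq)
  moreover have "lcp (ctx M (xs ! (b - 1))) (ctx M (xs ! b)) = \<infinity>"
    using mid[of b] mid[of "b - 1"] b by (simp add: lcp_def)
  ultimately have "boundary_lcp_sum Ms xs = \<infinity>"
    unfolding boundary_lcp_sum_def using finite_boundaries by (simp add: sum.remove)
  then show False using fin by simp
qed

text \<open>For finite \<open>L\<close>, occurrences with equal contexts share their input, so the
  way ties are broken cannot move a boundary.\<close>

lemma source_Z: "boundary_lcp_sum Ms xs \<noteq> \<infinity> \<Longrightarrow> t < N \<Longrightarrow> src (mr.Z ! t) = os ! t"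
proof -
  assume fin: "boundary_lcp_sum Ms xs \<noteq> \<infinity>" and t: "t < N"
  have "Y ! (mr.Z ! t) \<in> set xs" using Y_in[OF mr.Z_less[OF t]] xs_props(2) by simp
  then obtain u where u: "u < N" "xs ! u = Y ! (mr.Z ! t)" using xs_props(3) by (auto simp: in_set_conv_nth)
  have eq: "ctx M (xs ! u) = ctx M (xs ! t)" unfolding u(2) by (rule ctx_Z[OF t])
  have "os ! u = os ! t"
  proof (cases "u \<le> t")
    case True
    then show ?thesis by (rule same_source[OF fin _ t eq])
  next
    case False
    then have "t \<le> u" by simp
    from same_source[OF fin this u(1) eq[symmetric]] show ?thesis by (rule sym)
  qed
  moreover have "os ! u = src (mr.Z ! t)" using u xs_props(3) by (simp add: src_def)
  ultimately show ?thesis by simp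
qed

lemma bd_eq: "boundary_lcp_sum Ms xs \<noteq> \<infinity> \<Longrightarrow> mr.bd = boundaries os"
  using source_Z xs_props(3) by (auto simp: mr.bd_def boundaries_eq)

text \<open>If the sum is finite, the contexts at every boundary differ, and the cutoff value of
  \<open>clcp\<close> never enters.\<close>

lemma lcp_sum_eq:
  assumes fin: "boundary_lcp_sum Ms xs \<noteq> \<infinity>"
  shows "boundary_lcp_sum Ms xs =
    enat (\<Sum>b\<in>mr.bd. mr.clcp (ctx M (Y ! (mr.Z ! (b - 1)))) (ctx M (Y ! (mr.Z ! b))))"
proof -
  have "lcp (ctx M (xs ! (b - 1))) (ctx M (xs ! b)) =
      enat (mr.clcp (ctx M (Y ! (mr.Z ! (b - 1)))) (ctx M (Y ! (mr.Z ! b))))" if b: "b \<in> mr.bd" for b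
  proof -
    have b': "0 < b" "b < N" "os ! (b - 1) \<noteq> os ! b"
      using b xs_props(3) unfolding bd_eq[OF fin] boundaries_eq by auto
    have "ctx M (xs ! (b - 1)) \<noteq> ctx M (xs ! b)" using same_source[OF fin, of "b - 1" b] b' by auto
    then show ?thesis using ctx_Z[of b] ctx_Z[of "b - 1"] b' by (simp add: lcp_def mr.clcp_def)
  qed
  then have "boundary_lcp_sum Ms xs =
      (\<Sum>b\<in>mr.bd. enat (mr.clcp (ctx M (Y ! (mr.Z ! (b - 1)))) (ctx M (Y ! (mr.Z ! b)))))"
    unfolding boundary_lcp_sum_def bd_eq[OF fin, symmetric] by (intro sum.cong) auto
  also have "\<dots> = enat (\<Sum>b\<in>mr.bd. mr.clcp (ctx M (Y ! (mr.Z ! (b - 1)))) (ctx M (Y ! (mr.Z ! b))))"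
    by (rule sum_enat)
  finally show ?thesis .
qed

end

text \<open>Across a boundary with longest common prefix 0 the first character of the context
  increases, so there are at most \<open>\<sigma>\<close> such boundaries.\<close>

lemma card_bd:
  "card mr.bd \<le> \<sigma> + (\<Sum>b\<in>mr.bd. mr.clcp (ctx M (Y ! (mr.Z ! (b - 1)))) (ctx M (Y ! (mr.Z ! b))))"
proof -
  let ?c = "\<lambda>b. mr.clcp (ctx M (Y ! (mr.Z ! (b - 1)))) (ctx M (Y ! (mr.Z ! b)))"
  let ?f = "\<lambda>t. ctx M (Y ! (mr.Z ! t)) 0"
  define B0 where "B0 = {b \<in> mr.bd. ?c b = 0}"
  have mono: "?f t \<le> ?f u" if "t \<le> u" "u < N" for t u
    using mr.Z_not_less[OF that] by (auto simp: less_fun_def not_less[symmetric])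
  have step: "?f (b - 1) < ?f b" if "b \<in> B0" for b
  proof -
    have b: "0 < b" "b < N" "?c b = 0" using that by (auto simp: B0_def mr.bd_def)
    have "?f (b - 1) \<noteq> ?f b"
    proof (cases "ctx M (Y ! (mr.Z ! (b - 1))) = ctx M (Y ! (mr.Z ! b))")
      case True
      then show ?thesis using b by (simp add: mr.clcp_def)
    next
      case False
      then have "\<exists>j. ctx M (Y ! (mr.Z ! (b - 1))) j \<noteq> ctx M (Y ! (mr.Z ! b)) j" by (simp add: fun_eq_iff)
      from LeastI_ex[OF this] show ?thesis using b(3) False by (simp add: mr.clcp_def)
    qed
    then show ?thesis using mono[of "b - 1" b] b by simp
  qed
  have "inj_on ?f B0"
  proof (rule linorder_inj_onI)
    fix x y assume xy: "x < y" "x \<in> B0" "y \<in> B0"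
    have "?f x \<le> ?f (y - 1)" using mono[of x "y - 1"] xy by (auto simp: B0_def mr.bd_def)
    then show "?f x \<noteq> ?f y" using step[OF xy(3)] by simp
  qed auto
  moreover have "?f ` B0 \<subseteq> {..<\<sigma>}"
    using ctx_less[OF Y_in[OF mr.Z_less]] by (auto simp: B0_def mr.bd_def)
  ultimately have "card B0 \<le> \<sigma>" using card_inj_on_le[of ?f B0 "{..<\<sigma>}"] by simp
  moreover have "card (mr.bd - B0) \<le> sum ?c mr.bd"
  proof -
    have "card (mr.bd - B0) = (\<Sum>b\<in>mr.bd - B0. 1)" by simp
    also have "\<dots> \<le> sum ?c (mr.bd - B0)" by (rule sum_mono) (auto simp: B0_def)
    also have "\<dots> \<le> sum ?c mr.bd" by (rule sum_mono2) auto
    finally show ?thesis .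
  qed
  moreover have "card mr.bd = card B0 + card (mr.bd - B0)"
    using card_Diff_subset[of B0 mr.bd] card_mono[of mr.bd B0] finite_subset[of B0 mr.bd] by (auto simp: B0_def)
  ultimately show ?thesis by linarith
qed

text \<open>Each boundary weighs one more than its LCP and is counted at most twice.
  \<open>card_bd\<close> bounds the number of boundaries by \<open>\<sigma>\<close> plus the LCP
  sum, and the end of the order, of weight 1, contributes the 2.\<close>

lemma pot_le:
  "mr.pot 0 + mr.pot (mr.nb 0) \<le>
    4 * (\<Sum>b\<in>mr.bd. mr.clcp (ctx M (Y ! (mr.Z ! (b - 1)))) (ctx M (Y ! (mr.Z ! b)))) + 2 * \<sigma> + 2"
proof -
  let ?c = "\<lambda>b. mr.clcp (ctx M (Y ! (mr.Z ! (b - 1)))) (ctx M (Y ! (mr.Z ! b)))"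
  have N0: "0 < N" using k k_le_R R_le_N by simp
  have "{b \<in> insert N mr.bd. 0 < b} = insert N mr.bd" using N0 by (auto simp: mr.bd_def)
  then have "mr.pot 0 = (\<Sum>b\<in>insert N mr.bd. mr.wt b)" by (simp add: mr.pot_def)
  also have "\<dots> = mr.wt N + (\<Sum>b\<in>mr.bd. mr.wt b)" by (rule sum.insert) (auto simp: mr.bd_def)
  also have "(\<Sum>b\<in>mr.bd. mr.wt b) = (\<Sum>b\<in>mr.bd. Suc (?c b))"
    by (intro sum.cong) (auto simp: mr.wt_def mr.bd_def)
  also have "\<dots> = sum ?c mr.bd + card mr.bd" by (simp add: sum_Suc)
  finally have "mr.pot 0 = 1 + sum ?c mr.bd + card mr.bd" by (simp add: mr.wt_def)
  moreover have "mr.pot (mr.nb 0) \<le> mr.pot 0" using mr.pot_nb[OF N0] by simp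
  ultimately show ?thesis using card_bd by linarith
qed

end

text \<open>Charges the \<open>r * log m\<close> steps of the radix sort for \<open>r = R\<close> and \<open>m = k * \<sigma>\<close>. The alphabet need
  not be polynomial in the total length, so \<open>log m\<close> alone is not polylogarithmic.\<close>

lemma mult_floorlog_le: "r * floorlog 2 m \<le> r * floorlog 2 r + 2 * m"
proof (cases "r = 0 \<or> m = 0")
  case True
  then show ?thesis by (auto simp: floorlog_def)
next
  case False
  define b where "b = floorlog 2 m"
  have "2 ^ (b - 1) \<le> m" using floorlog_bounds[of m 2] False by (simp add: b_def)
  moreover have "0 < b" using False by (simp add: b_def compute_floorlog[of 2 m])
  ultimately have m: "2 ^ b \<le> 2 * m" by (cases b) auto
  show ?thesis
  proof (cases "b \<le> floorlog 2 r")
    case True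
    then show ?thesis by (simp add: b_def trans_le_add1)
  next
    case False
    then obtain e where e: "b = floorlog 2 r + e" using le_Suc_ex nat_le_linear by blast
    have "r * e \<le> 2 ^ floorlog 2 r * 2 ^ e"
      using floorlog_bounds[of r 2] \<open>\<not> (r = 0 \<or> m = 0)\<close> less_exp[of e] by (intro mult_le_mono) auto
    also have "\<dots> = 2 ^ b" by (simp add: e power_add)
    finally show ?thesis using m by (simp add: b_def[symmetric] e add_mult_distrib2)
  qed
qed

text \<open>The argument \<open>n + 1\<close> keeps the logarithm at least 1 even for
  \<open>n = 1\<close>, so that it absorbs the rounding.\<close>

lemma floorlog_le_log:
  assumes "1 \<le> n"
  shows "real (floorlog 2 n) \<le> 2 * log 2 (real n + 1)"
proof -
  have "real (floorlog 2 n) \<le> log 2 (real n) + 1"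
    using assms by (simp add: floorlog_def)
  moreover have "log 2 (real n) \<le> log 2 (real n + 1)" using assms by simp
  moreover have "1 \<le> log 2 (real n + 1)" using assms by simp
  ultimately show ?thesis by linarith
qed

section \<open>The final estimate of the running time\<close>

context merge_input_ram
begin

text \<open>All factors are at least 1, so every term is dominated by \<open>K' * e ^ 2 * S\<close>.
  The square stems from nested binary searches: each probe for a block end itself searches the run
  table once per input and character.\<close>

lemma merge_time_le:
  assumes pot: "mr.pot 0 + mr.pot (mr.nb 0) \<le> 4 * l + 2 * \<sigma> + 2"
  shows "real merge_time \<le>
    20000 * (real k + 1) * log 2 (real N + 1) ^ 2 * (real l + real \<sigma> + real R)"
proof -
  define e where "e = log 2 (real N + 1)"
  define S where "S = real l + real \<sigma> + real R"
  define K' where "K' = real k + 1"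
  have N1: "1 \<le> N" "1 \<le> R" using k k_le_R R_le_N by simp_all
  have e1: "1 \<le> e" unfolding e_def using N1 by simp
  have ee: "e \<le> e ^ 2" "1 \<le> e ^ 2"
    using one_le_power[OF e1, of 2] self_le_power[OF e1, of 2] by simp_all
  have fN: "real (floorlog 2 N) \<le> 2 * e" unfolding e_def by (rule floorlog_le_log[OF N1(1)])
  have fR: "real (floorlog 2 R) \<le> 2 * e"
    using fN floorlog_mono[OF R_le_N, of 2] by linarith
  have S: "1 \<le> S" "real R \<le> S" "real \<sigma> \<le> S" using N1 by (simp_all add: S_def)
  have K': "1 \<le> K'" "real k \<le> K'" by (simp_all add: K'_def)
  have pos: "0 \<le> e" "0 \<le> S" "0 \<le> K'" using e1 S K' by simp_all
  have FC: "real mr.FC \<le> 560 * K' * e"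
  proof -
    have "real mr.FC = 500 * K' + 30 * (real k * real (floorlog 2 R))"
      by (simp add: mr.FC_def K'_def algebra_simps)
    moreover have "real k * real (floorlog 2 R) \<le> K' * (2 * e)" using fR K' pos by (intro mult_mono) simp_all
    moreover have "K' \<le> K' * e" using e1 K' by (simp add: mult_le_cancel_left1)
    ultimately show ?thesis by simp
  qed
  have PC: "real mr.PC \<le> 4000 * K' * e ^ 2"
  proof -
    have "real mr.PC = 2 * (real mr.FC * (1 + real (floorlog 2 N))) + 60 * real (floorlog 2 N) + 500"
      by (simp add: mr.PC_def algebra_simps)
    moreover have "real mr.FC * (1 + real (floorlog 2 N)) \<le> (560 * K' * e) * (3 * e)"
      using FC fN e1 pos by (intro mult_mono) simp_all
    moreover have "60 * real (floorlog 2 N) + 500 \<le> 620 * e ^ 2" using fN ee by simp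
    moreover have "620 * e ^ 2 \<le> 620 * (K' * e ^ 2)" using K' by (simp add: mult_le_cancel_right1)
    moreover have "(560 * K' * e) * (3 * e) = 1680 * (K' * e ^ 2)" by (simp add: power2_eq_square)
    moreover have "0 \<le> K' * e ^ 2" using pos by simp
    ultimately show ?thesis by simp
  qed
  have "real (mr.pot 0 + mr.pot (mr.nb 0)) \<le> real (4 * l + 2 * \<sigma> + 2)" using pot by (rule of_nat_mono)
  also have "\<dots> \<le> 4 * S" using N1 by (simp add: S_def)
  finally have "real mr.PC * real (mr.pot 0 + mr.pot (mr.nb 0)) \<le> (4000 * K' * e ^ 2) * (4 * S)"
    using PC pos by (intro mult_mono) simp_all
  then have main: "real (mr.PC * (mr.pot 0 + mr.pot (mr.nb 0))) \<le> 16000 * (K' * e ^ 2 * S)" by simp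
  have sort: "real ((300 + 250 * R) * floorlog 2 (k * \<sigma>)) \<le> 2200 * (K' * e ^ 2 * S)"
  proof -
    have "(300 + 250 * R) * floorlog 2 (k * \<sigma>) \<le> (550 * R) * floorlog 2 (k * \<sigma>)"
      using N1 by (intro mult_le_mono1) simp
    also have "\<dots> \<le> 550 * (R * floorlog 2 R + 2 * (k * \<sigma>))"
      using mult_floorlog_le[of R "k * \<sigma>"] by simp
    finally have "real ((300 + 250 * R) * floorlog 2 (k * \<sigma>)) \<le> real (550 * (R * floorlog 2 R + 2 * (k * \<sigma>)))"
      by (rule of_nat_mono)
    also have "\<dots> = 550 * (real R * real (floorlog 2 R)) + 1100 * (real k * real \<sigma>)" by simp
    also have "real R * real (floorlog 2 R) \<le> S * (2 * e)" using S fR pos by (intro mult_mono) simp_all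
    also have "real k * real \<sigma> \<le> K' * S" using S K' pos by (intro mult_mono) simp_all
    also have "550 * (S * (2 * e)) + 1100 * (K' * S) \<le> 1100 * (K' * e ^ 2 * S) + 1100 * (K' * e ^ 2 * S)"
    proof -
      have "1 * e \<le> K' * e ^ 2" using K' ee pos by (intro mult_mono) simp_all
      then have "S * e \<le> S * (K' * e ^ 2)" using pos by (intro mult_left_mono) simp_all
      moreover have "K' * 1 \<le> K' * e ^ 2" using ee pos by (intro mult_left_mono) simp_all
      then have "(K' * 1) * S \<le> (K' * e ^ 2) * S" using pos by (intro mult_right_mono) simp_all
      ultimately show ?thesis by (simp add: algebra_simps)
    qed
    finally show ?thesis by (simp add: algebra_simps)
  qed
  have rest: "real (250 + 100 * k + 140 * R + 100 * (k * R)) \<le> 590 * (K' * e ^ 2 * S)"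
  proof -
    have 1: "1 * 1 \<le> K' * S" using K' S by (intro mult_mono) simp_all
    have 2: "real k * 1 \<le> K' * S" using K' S by (intro mult_mono) simp_all
    have 3: "1 * real R \<le> K' * S" using K' S by (intro mult_mono) simp_all
    have 4: "real k * real R \<le> K' * S" using K' S by (intro mult_mono) simp_all
    have "real (250 + 100 * k + 140 * R + 100 * (k * R)) = 250 + 100 * real k + 140 * real R + 100 * (real k * real R)"
      by simp
    also have "\<dots> \<le> 590 * (K' * S)" using 1 2 3 4 by simp
    also have "K' * S \<le> e ^ 2 * (K' * S)" using mult_right_mono[OF ee(2), of "K' * S"] pos by simp
    finally show ?thesis by (simp add: algebra_simps)
  qed
  have "real merge_time = real (250 + 100 * k + 140 * R + 100 * (k * R)) +
      real ((300 + 250 * R) * floorlog 2 (k * \<sigma>)) + real (mr.PC * (mr.pot 0 + mr.pot (mr.nb 0)))"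
    by (simp add: merge_time_def)
  also have "\<dots> \<le> 18790 * (K' * e ^ 2 * S)" using main sort rest by simp
  also have "\<dots> \<le> 20000 * (K' * e ^ 2 * S)" using pos by (intro mult_right_mono) simp_all
  finally show ?thesis by (simp add: K'_def e_def S_def algebra_simps)
qed

end

text \<open>The base is at least 3, so \<open>k\<close> factors exceed \<open>k\<close>, seven more
  (\<open>3 ^ 7 = 2187\<close>) exceed the numerical coefficients, and one is left for
  \<open>N\<close> and \<open>\<sigma>\<close>.\<close>

lemma word_bound:
  fixes k \<sigma> N :: nat
  assumes "1 \<le> k" "1 \<le> \<sigma>" "1 \<le> N"
  shows "32 * N + 2 * (k * \<sigma>) + 100 < (N + \<sigma> + 1) ^ (k + 8)" "N * N < (N + \<sigma> + 1) ^ (k + 8)"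
proof -
  define U where "U = N + \<sigma> + 1"
  have U: "3 \<le> U" using assms by (simp add: U_def)
  have "k < 3 ^ k" by (induction k) auto
  then have "2187 * (k + 1) \<le> 3 ^ (k + 7)" by (simp add: power_add)
  also have "\<dots> \<le> U ^ (k + 7)" using U by (rule power_mono) simp
  finally have "U * (2187 * (k + 1)) \<le> U * U ^ (k + 7)" by simp
  also have "\<dots> = U ^ (k + 8)" by (simp flip: power_Suc add: eval_nat_numeral)
  finally have *: "U * (2187 * (k + 1)) \<le> U ^ (k + 8)" .
  have "k * \<sigma> \<le> k * U" by (intro mult_le_mono2) (simp add: U_def)
  moreover have "N \<le> U" by (simp add: U_def)
  moreover have "U * (2187 * (k + 1)) = 2187 * U + 2187 * (k * U)" by (simp add: algebra_simps)
  ultimately have "32 * N + 2 * (k * \<sigma>) + 100 < U * (2187 * (k + 1))" using U by linarith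
  then show "32 * N + 2 * (k * \<sigma>) + 100 < (N + \<sigma> + 1) ^ (k + 8)" using * by (simp add: U_def)
  have "N * N < U * U" using assms by (intro mult_strict_mono) (simp_all add: U_def)
  also have "\<dots> = U ^ 2" by (simp add: power2_eq_square)
  also have "\<dots> \<le> U ^ (k + 8)" using U by (intro power_increasing) simp_all
  finally show "N * N < (N + \<sigma> + 1) ^ (k + 8)" by (simp add: U_def)
qed

theorem theorem1:
  fixes k :: nat
  assumes "1 \<le> k"
  shows "\<exists>(prog :: com) (cw :: nat) (cs :: nat) (ct :: real) (d :: nat). 0 < ct \<and>
    (\<forall>(\<sigma> :: nat) (Ms :: collection list) (Bs :: nat list list) (xs :: (nat \<times> nat) list) N R L.
       length Ms = k \<longrightarrow>
       (\<forall>M \<in> set Ms. collection_over \<sigma> M) \<longrightarrow>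
       list_all2 is_ebwt Ms Bs \<longrightarrow>
       context_order (concat Ms) xs \<longrightarrow>
       N = total_length (concat Ms) \<longrightarrow>
       R = total_runs Bs \<longrightarrow>
       L = boundary_lcp_sum Ms xs \<longrightarrow>
       (\<exists>t s'.
          exec ((N + \<sigma> + 1) ^ cw) (cs * R) (encode_input \<sigma> Bs) prog init_state t s' \<and>
          outp s' = encode_runs (rle (map (char_at (concat Ms)) xs)) \<and>
          ereal (real t) \<le> ereal (ct * log 2 (real N + 1) ^ d) *
            (ereal_of_enat L + ereal (real \<sigma>) + ereal (real R))))"
proof (rule exI[of _ "merge_prog k"], rule exI[of _ "k + 8"], rule exI[of _ 16],
    rule exI[of _ "20000 * (real k + 1)"], rule exI[of _ 2], intro conjI allI impI)
  show "0 < 20000 * (real k + 1)" by simp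
  fix \<sigma> Ms Bs xs N R L
  assume k: "length Ms = k" and over: "\<forall>M \<in> set Ms. collection_over \<sigma> M"
    and Bs: "list_all2 is_ebwt Ms Bs" and xs: "context_order (concat Ms) xs"
    and N: "N = total_length (concat Ms)" and R: "R = total_runs Bs" and L: "L = boundary_lcp_sum Ms xs"
  have "\<forall>i<k. \<exists>X. context_order (Ms ! i) X \<and> Bs ! i = map (char_at (Ms ! i)) X"
    using Bs k by (auto simp: list_all2_conv_all_nth is_ebwt_def)
  then obtain XS where XS: "\<And>i. i < k \<Longrightarrow> context_order (Ms ! i) (XS i) \<and> Bs ! i = map (char_at (Ms ! i)) (XS i)"
    by metis
  interpret merge_input k \<sigma> Ms Bs XS N R "encode_input \<sigma> Bs"
    using assms k over Bs XS N R by unfold_locales (auto simp: list_all2_conv_all_nth)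
  have N1: "1 \<le> N" using assms k_le_R R_le_N by linarith
  have s1: "1 \<le> \<sigma>" using sigma_pos N1 by simp
  interpret merge_input_ram k \<sigma> Ms Bs XS N R "encode_input \<sigma> Bs" "(N + \<sigma> + 1) ^ (k + 8)"
    using word_bound[OF assms s1 N1] by unfold_locales
  obtain t s' where run: "exec ((N + \<sigma> + 1) ^ (k + 8)) (16 * R) (encode_input \<sigma> Bs) (merge_prog k) init_state t s'"
    and t: "t \<le> merge_time"
    and out: "outp s' = encode_runs (rle (map (\<lambda>y. char_at (concat Ms) (Y ! y)) mr.Z))"
    using merge_prog_correct unfolding wp_def by blast
  have e1: "1 \<le> log 2 (real N + 1)" using N1 by simp
  have "ereal (real t) \<le> ereal (20000 * (real k + 1) * log 2 (real N + 1) ^ 2) *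
      (ereal_of_enat L + ereal (real \<sigma>) + ereal (real R))"
  proof (cases "L = \<infinity>")
    case True
    \<comment> \<open>The right-hand side is infinite only if the factor in front is positive;
      termination and output do not depend on \<open>L\<close>.\<close>
    have "0 < log 2 (real N + 1) ^ 2" using e1 by (intro zero_less_power) linarith
    then have "0 < 20000 * (real k + 1) * log 2 (real N + 1) ^ 2" by (intro mult_pos_pos) simp_all
    moreover have "log 2 (real N + 1) \<noteq> 0" using e1 by linarith
    ultimately show ?thesis using True by simp
  next
    case False
    let ?l = "\<Sum>b\<in>mr.bd. mr.clcp (ctx (concat Ms) (Y ! (mr.Z ! (b - 1)))) (ctx (concat Ms) (Y ! (mr.Z ! b)))"
    have "L = enat ?l" using lcp_sum_eq[OF xs] False L by simp
    moreover have "real t \<le> 20000 * (real k + 1) * log 2 (real N + 1) ^ 2 * (real ?l + real \<sigma> + real R)"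
      using merge_time_le[OF pot_le] t by linarith
    ultimately show ?thesis by simp
  qed
  then show "\<exists>t s'. exec ((N + \<sigma> + 1) ^ (k + 8)) (16 * R) (encode_input \<sigma> Bs) (merge_prog k) init_state t s' \<and>
      outp s' = encode_runs (rle (map (char_at (concat Ms)) xs)) \<and>
      ereal (real t) \<le> ereal (20000 * (real k + 1) * log 2 (real N + 1) ^ 2) *
        (ereal_of_enat L + ereal (real \<sigma>) + ereal (real R))"
    using run out chars_Z[OF xs] by auto
qed

end
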